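(* Let $G=\mathbb{Z}/p\mathbb{Z}$ with $p\geq 2$ a prime, let $A,B\subseteq G$ be nonempty subsets with $A+B\neq G$, and set $C=-\,(G\setminus (A+B))$. Suppose $|A|\geq |B|$ and, defining the integer $r$ by $|A+B|=|A|+|B|+r$, $$|A+B|=|A|+|B|+r\leq \min\{|A|+1.0527|B|-3,\; p-9(r+3)\}.$$ Then there are arithmetic progressions $P_A,P_B,P_C\subseteq G$, all having a common difference, such that $X\subseteq P_X$ and $|P_X|\leq |X|+r+1$ for all $X\in\{A,B,C\}$.
   Context: $A+B=\{a+b: a\in A, b\in B\}$ and $-X=\{-x:x\in X\}$. An arithmetic progression in $G$ with difference $d\in G$ is a set of the form $\{a, a+d, \ldots, a+(n-1)d\}$ with $a\in G$, $n\ge 1$. *)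

theory Defs
  imports Complex_Main "HOL-Number_Theory.Residues"
begin

abbreviation Zmod :: "nat \<Rightarrow> int ring"
  where "Zmod p \<equiv> residue_ring (int p)"

text \<open>The \<open>n\<close> listed terms need not be distinct: an arithmetic progression is just the set
  of its terms, so difference \<open>\<zero>\<close> (a singleton) and the whole group are allowed.\<close>

definition arith_progression :: "('a, 'b) ring_scheme \<Rightarrow> 'a \<Rightarrow> 'a set \<Rightarrow> bool"
  where "arith_progression G d P \<longleftrightarrow>
    d \<in> carrier G \<and>
    (\<exists>a\<in>carrier G. \<exists>n::nat. n \<ge> 1 \<and> P = {a \<oplus>\<^bsub>G\<^esub> [i] \<cdot>\<^bsub>G\<^esub> d | i::nat. i < n})"

end

theory Submission
  imports Defs "HOL-Library.Set_Algebras" "HOL-Analysis.Analysis"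
begin

text \<open>
  Put \<open>s = r + 3\<close>. The sets \<open>A\<close>, \<open>B\<close>, \<open>C\<close> form a triple with \<open>0 \<notin> A + B + C\<close> and
  \<open>\<bar>A\<bar> + \<bar>B\<bar> + \<bar>C\<bar> = p - r\<close>, and the hypotheses are used symmetrically from then on. Let \<open>Y\<close> be
  the smallest of the three. Among all sets \<open>Z\<close> with at least \<open>2\<bar>Y\<bar>/3\<close> elements for which
  \<open>Z + Y\<close> leaves as many elements uncovered, take one minimizing \<open>\<bar>Z + Y\<bar> - \<bar>Z\<bar>\<close> and, subject to
  that, \<open>\<bar>Z\<bar>\<close> (an atom in the sense of Hamidoune). Translates of an atom have small intersections,
  so by Cauchy--Schwarz \<open>\<bar>Z\<bar> \<le> 1.26 \<bar>Y\<bar>\<close>: the pair \<open>Y\<close>, \<open>Z\<close> is balanced. For a balanced pair some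
  character has a large Fourier coefficient at \<open>Y\<close> and at \<open>Z\<close> simultaneously, hence large parts of both
  lie in half circles and add like sets of integers. Freiman's \<open>3k-4\<close> theorem for two sets of integers
  (via Kneser's theorem modulo the diameter of the longer set) puts these parts into short
  progressions, and an extremal choice of the parts shows that nothing of \<open>Y\<close> is left over. A
  progression around \<open>Y\<close> with at most \<open>r + 1\<close> holes finally forces the other two sets of the triple
  into progressions with the same difference.
\<close>

section \<open>Kneser's theorem\<close>

text \<open>The size hypotheses enter in this form: every set of the triple has at least 9s
  elements, and the two sets other than the smallest have at least 37.9s together, because 18.95 *
  0.0527 < 1 gives 18.95s <= |B|. The obstacle is imbalance: the other two sets may be far larger
  than Y, and a half circle may then miss more elements of a large set than Y has altogether, so
  that lifting the pair to the integers fails. The atom Z is a partner of size comparable with Y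
  that does not increase the excess |Z + Y| - |Z| - |Y|, while the complement of Z + Y stays at
  least as large as Z. The fraction 2/3 is a compromise: a larger one weakens the bound on the
  intersections and with it the upper bound for |Z|, a smaller one admits atoms too small against Y.
  Primality of p makes stabilizers trivial and all nonzero dilations invertible; the latter lets a
  difference found by the 3k-4 theorem be normalized to 1.\<close>

definition stab :: "'a::ab_group_add set \<Rightarrow> 'a set" where
  "stab S = {g. (+) g ` S = S}"

definition subgrp :: "'a::ab_group_add set \<Rightarrow> bool" where
  "subgrp H \<longleftrightarrow> 0 \<in> H \<and> (\<forall>x\<in>H. \<forall>y\<in>H. x - y \<in> H)"

lemma subgrp_0: "subgrp H \<Longrightarrow> 0 \<in> H"
  by (simp add: subgrp_def)

lemma subgrp_minus: "subgrp H \<Longrightarrow> x \<in> H \<Longrightarrow> - x \<in> H"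
  unfolding subgrp_def by (metis diff_0)

lemma subgrp_diff: "subgrp H \<Longrightarrow> x \<in> H \<Longrightarrow> y \<in> H \<Longrightarrow> x - y \<in> H"
  by (simp add: subgrp_def)

lemma subgrp_add: "subgrp H \<Longrightarrow> x \<in> H \<Longrightarrow> y \<in> H \<Longrightarrow> x + y \<in> H"
  using subgrp_diff[of H x "- y"] subgrp_minus[of H y] by simp

lemma stab_iff: "finite S \<Longrightarrow> g \<in> stab S \<longleftrightarrow> (\<forall>x\<in>S. g + x \<in> S)"
proof
  assume "finite S" and *: "\<forall>x\<in>S. g + x \<in> S"
  then have "(+) g ` S \<subseteq> S" "card ((+) g ` S) = card S" by (auto simp: card_image)
  with \<open>finite S\<close> show "g \<in> stab S" unfolding stab_def by (simp add: card_subset_eq)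
qed (auto simp: stab_def)

lemma stab_add: "g \<in> stab S \<Longrightarrow> x \<in> S \<Longrightarrow> g + x \<in> S"
  unfolding stab_def by blast

lemma subgrp_stab: "subgrp (stab S)"
  unfolding subgrp_def
proof (intro conjI ballI)
  show "0 \<in> stab S" by (simp add: stab_def)
  fix x y assume "x \<in> stab S" "y \<in> stab S"
  then have x: "(+) x ` S = S" and y: "(+) y ` S = S" by (auto simp: stab_def)
  have "(+) (x - y) ` S = (+) (x - y) ` ((+) y ` S)" using y by simp
  also have "\<dots> = S" using x by (simp add: image_image)
  finally show "x - y \<in> stab S" by (simp add: stab_def)
qed

lemma finite_stab: "finite S \<Longrightarrow> S \<noteq> {} \<Longrightarrow> finite (stab S)"
proof -
  assume "finite S" "S \<noteq> {}"
  then obtain s where "s \<in> S" by blast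
  then have "(\<lambda>g. g + s) ` stab S \<subseteq> S" by (auto intro: stab_add)
  with \<open>finite S\<close> have "finite ((\<lambda>g. g + s) ` stab S)" by (rule rev_finite_subset)
  then show ?thesis by (rule finite_imageD) (auto simp: inj_on_def)
qed

lemma stab_translate: "stab ((+) t ` S) = stab S"
proof -
  have "(+) g ` ((+) t ` S) = (+) t ` ((+) g ` S)" for g by (simp add: image_image add.left_commute)
  moreover have "(+) t ` U = (+) t ` V \<longleftrightarrow> U = V" for U V by (simp add: inj_image_eq_iff)
  ultimately show ?thesis by (simp add: stab_def)
qed

lemma set_plus_translate: "A + (+) t ` B = (+) t ` (A + B)" for t :: "'a::ab_group_add"
  by (auto simp: set_plus_def image_iff) (metis add.left_commute)+

lemma subset_set_plus: "0 \<in> H \<Longrightarrow> S \<subseteq> S + H" for S :: "'a::ab_group_add set"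
  by (force simp: set_plus_def)

lemma set_plus_nonempty: "A \<noteq> {} \<Longrightarrow> B \<noteq> {} \<Longrightarrow> A + B \<noteq> {}" for A :: "'a::ab_group_add set"
  by (auto simp: set_plus_def)

lemma plus_stab: "S + stab S = S"
proof
  show "S + stab S \<subseteq> S"
  proof
    fix x assume "x \<in> S + stab S"
    then obtain s g where "s \<in> S" "g \<in> stab S" "x = g + s" by (auto elim!: set_plus_elim simp: add.commute)
    then show "x \<in> S" by (simp add: stab_add)
  qed
  show "S \<subseteq> S + stab S" by (rule subset_set_plus) (rule subgrp_0[OF subgrp_stab])
qed

lemma card_le_set_plus:
  fixes A B :: "'a::ab_group_add set"
  assumes "finite A" "finite B" "B \<noteq> {}"
  shows "card A \<le> card (A + B)"
proof -
  obtain b where "b \<in> B" using assms by blast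
  then have "(+) b ` A \<subseteq> A + B" by (auto simp: set_plus_def add.commute)
  then have "card ((+) b ` A) \<le> card (A + B)" by (intro card_mono finite_set_plus assms)
  then show ?thesis by (simp add: card_image)
qed

lemma subgrp_sum: "subgrp H \<Longrightarrow> H + H = H"
  using subgrp_add[of H] subset_set_plus[of H H] subgrp_0[of H] by (auto simp: set_plus_def)

lemma coset_eq:
  assumes "subgrp H" "x \<in> (+) c ` H" shows "(+) x ` H = (+) c ` H"
proof -
  obtain h where h: "h \<in> H" "x = c + h" using assms by blast
  have "\<exists>k'\<in>H. c + k = x + k'" if "k \<in> H" for k
    using that h assms by (intro bexI[of _ "k - h"]) (auto simp: subgrp_diff)
  moreover have "\<exists>k'\<in>H. x + k = c + k'" if "k \<in> H" for k
    using that h assms by (intro bexI[of _ "h + k"]) (auto simp: subgrp_add add.assoc)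
  ultimately show ?thesis by (auto simp: image_def)
qed

lemma coset_disj:
  assumes "subgrp H" "(+) x ` H \<noteq> (+) c ` H" shows "(+) x ` H \<inter> (+) c ` H = {}"
proof (rule ccontr)
  assume "\<not> ?thesis"
  then obtain y where "y \<in> (+) x ` H" "y \<in> (+) c ` H" by blast
  then have "(+) y ` H = (+) x ` H" "(+) y ` H = (+) c ` H" using coset_eq[OF assms(1)] by metis+
  with assms(2) show False by simp
qed

lemma mem_coset_iff: "x \<in> (+) c ` H \<longleftrightarrow> x - c \<in> H" for x :: "'a::ab_group_add"
proof
  assume "x - c \<in> H"
  then show "x \<in> (+) c ` H" by (intro image_eqI[of _ _ "x - c"]) (auto simp: algebra_simps)
qed auto

lemma coset_self: "subgrp H \<Longrightarrow> c \<in> (+) c ` H"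
  using subgrp_0[of H] mem_coset_iff[of c c H] by simp

text \<open>
  The proof of Kneser's theorem follows DeVos. After a translation, \<open>A \<inter> B\<close> is nonempty and smaller
  than \<open>A\<close>; a subset \<open>C\<close> of \<open>A + B\<close> is called convergent (\<open>conv\<close> below) if with \<open>K = stab C\<close> it satisfies
  \<open>\<bar>A \<inter> B\<bar> + \<bar>A \<union> B + K\<bar> \<le> \<bar>C\<bar> + \<bar>K\<bar>\<close>. A convergent set with smallest stabilizer \<open>H\<close> can be enlarged
  inside one \<open>H\<close>-coset in two ways, and neither enlargement is convergent.
\<close>

context
  fixes n :: nat and A B :: "'a::ab_group_add set"
  assumes fin: "finite A" "finite B" and ne: "A \<noteq> {}" "B \<noteq> {}"
    and nm: "card (A + B) = n"
    and IH: "\<And>A' B' :: 'a set. finite A' \<Longrightarrow> finite B' \<Longrightarrow> A' \<noteq> {} \<Longrightarrow> B' \<noteq> {} \<Longrightarrow>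
      card (A' + B') < n \<or> card (A' + B') = n \<and> card (A' + stab (A' + B')) < card A \<Longrightarrow>
      card A' + card B' \<le> card (A' + B') + card (stab (A' + B'))"
    and per: "A + stab (A + B) = A" "B + stab (A + B) = B"
begin

text \<open>Kneser's inequality for the closures of both sets under the stabilizer. Closing changes
  neither the sumset nor \<open>A' + K\<close>, so the induction measure is the same and
  \<open>IH\<close> applies to the closed pair.\<close>

lemma kneser_IH_closed:
  fixes A' B' K :: "'a set"
  assumes "finite A'" "finite B'" "A' \<noteq> {}" "B' \<noteq> {}" and K: "K = stab (A' + B')"
    and "card (A' + B') < n \<or> card (A' + B') = n \<and> card (A' + K) < card A"
  shows "card (A' + K) + card (B' + K) \<le> card (A' + B') + card K"
proof -
  have K': "subgrp K" "finite K" using K subgrp_stab finite_stab finite_set_plus[OF assms(1,2)] set_plus_nonempty[OF assms(3,4)] by auto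
  have eq: "(A' + K) + (B' + K) = A' + B'"
  proof -
    have "(A' + K) + (B' + K) = (A' + B') + (K + K)" by (simp add: add_ac)
    also have "\<dots> = A' + B'" using subgrp_sum[OF K'(1)] plus_stab K by metis
    finally show ?thesis .
  qed
  have "A' + K + K = A' + K" using subgrp_sum[OF K'(1)] by (simp add: add.assoc)
  moreover have "A' + K \<noteq> {}" "B' + K \<noteq> {}" using assms(3,4) subgrp_0[OF K'(1)] by (auto intro!: set_plus_nonempty)
  ultimately show ?thesis using IH[of "A' + K" "B' + K"] eq assms K' by (auto simp: finite_set_plus)
qed

lemma kneser_step_aux:
  assumes a: "a \<in> A" "a' \<in> A" and aB: "a \<in> B" "a' \<notin> B"
  shows "card A + card B \<le> card (A + B) + card (stab (A + B))"
proof (rule ccontr)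
  define S where "S = A + B"
  define H0 where "H0 = stab S"
  assume "\<not> ?thesis"
  then have neg: "n + card H0 < card A + card B" using nm by (simp add: S_def H0_def)
  define P where "P = A \<inter> B"
  define Q where "Q = A \<union> B"
  have finS: "finite S" and neS: "S \<noteq> {}" using fin ne by (auto simp: S_def finite_set_plus set_plus_nonempty)
  have finPQ: "finite P" "finite Q" "P \<noteq> {}" "Q \<noteq> {}" using fin a aB by (auto simp: P_def Q_def)
  have sH0: "subgrp H0" unfolding H0_def by (rule subgrp_stab)
  have perA: "\<And>h x. h \<in> H0 \<Longrightarrow> x \<in> A \<Longrightarrow> h + x \<in> A"
    using per(1) unfolding S_def[symmetric] H0_def[symmetric] by (metis set_plus_intro add.commute)
  have perB: "\<And>h x. h \<in> H0 \<Longrightarrow> x \<in> B \<Longrightarrow> h + x \<in> B"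
    using per(2) unfolding S_def[symmetric] H0_def[symmetric] by (metis set_plus_intro add.commute)
  have cPQ: "card P + card Q = card A + card B"
    using card_Un_Int[OF fin] by (simp add: P_def Q_def)
  define conv where "conv = (\<lambda>C. C \<subseteq> S \<and> C \<noteq> {} \<and> H0 \<subseteq> stab C \<and>
      card P + card (Q + stab C) \<le> card C + card (stab C))"
  have "conv (P + Q)"
  proof -
    define K where "K = stab (P + Q)"
    have sub: "P + Q \<subseteq> S"
    proof
      fix x assume "x \<in> P + Q"
      then obtain p q where pq: "p \<in> P" "q \<in> Q" "x = p + q" by (elim set_plus_elim)
      then consider "q \<in> A" | "q \<in> B" by (auto simp: Q_def)
      then show "x \<in> S"
      proof cases
        case 1
        then have "q + p \<in> S" unfolding S_def using pq by (intro set_plus_intro) (auto simp: P_def)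
        then show ?thesis using pq by (simp add: add.commute)
      next
        case 2
        then show ?thesis unfolding S_def using pq by (auto simp: P_def intro: set_plus_intro)
      qed
    qed
    have fPQ: "finite (P + Q)" using finPQ by (simp add: finite_set_plus)
    have H0K: "H0 \<subseteq> K"
    proof
      fix h assume h: "h \<in> H0"
      have "h + x \<in> P + Q" if x: "x \<in> P + Q" for x
      proof -
        obtain u v where "u \<in> P" "v \<in> Q" "x = u + v" using x by (auto simp: set_plus_def)
        then have "h + x = (h + u) + v" "h + u \<in> P" using h perA perB by (auto simp: P_def add.assoc)
        then show ?thesis using \<open>v \<in> Q\<close> by (metis set_plus_intro)
      qed
      then show "h \<in> K" using fPQ by (simp add: K_def stab_iff)
    qed
    \<comment> \<open>If \<open>P + Q\<close> is all of \<open>S\<close>, then \<open>K = H0\<close>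
      and \<open>P\<close> is an \<open>H0\<close>-periodic proper subset of \<open>A\<close>; the
      second component of the lexicographic measure drops.\<close>
    have "card (P + Q) < n \<or> card (P + Q) = n \<and> card (P + K) < card A"
    proof (cases "card (P + Q) < n")
      case False
      then have "P + Q = S" using sub finS nm by (metis S_def card_seteq not_le_imp_less)
      then have KH: "K = H0" by (simp add: K_def H0_def)
      have "P + K \<subseteq> P"
      proof
        fix x assume "x \<in> P + K"
        then obtain p h where "p \<in> P" "h \<in> H0" "x = h + p" using KH by (auto elim!: set_plus_elim simp: add.commute)
        then show "x \<in> P" using perA perB by (simp add: P_def)
      qed
      moreover have "P \<subset> A" using a aB by (auto simp: P_def)
      ultimately have "card (P + K) < card A" using fin by (meson psubset_card_mono subset_psubset_trans)
      then show ?thesis using \<open>P + Q = S\<close> nm by (simp add: S_def)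
    qed auto
    from kneser_IH_closed[OF finPQ(1,2,3,4) K_def this]
    have "card (P + K) + card (Q + K) \<le> card (P + Q) + card K" .
    moreover have "card P \<le> card (P + K)"
      using finPQ K_def subgrp_0[OF subgrp_stab, of "P + Q"] finite_stab[OF fPQ set_plus_nonempty[OF finPQ(3,4)]]
      by (intro card_le_set_plus) auto
    moreover have "P + Q \<noteq> {}" using finPQ by (simp add: set_plus_nonempty)
    ultimately show ?thesis unfolding conv_def using sub H0K K_def by simp
  qed
  then obtain C where C: "conv C" and Cmin: "\<And>C'. conv C' \<Longrightarrow> card (stab C) \<le> card (stab C')"
    using ex_has_least_nat[of conv "P + Q" "\<lambda>C. card (stab C)"] by blast
  define H where "H = stab C"
  have C': "C \<subseteq> S" "C \<noteq> {}" "H0 \<subseteq> H" "card P + card (Q + H) \<le> card C + card H"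
    using C by (auto simp: conv_def H_def)
  have finC: "finite C" using C'(1) finS by (rule finite_subset)
  have sH: "subgrp H" "finite H" using subgrp_stab finite_stab finC C'(2) by (auto simp: H_def)
  have cardC: "card C \<le> n" using C'(1) finS nm by (metis S_def card_mono)
  have "H \<noteq> H0"
  proof
    assume "H = H0"
    have "Q \<subseteq> Q + H" using subgrp_0[OF sH(1)] by (rule subset_set_plus)
    then have "card Q \<le> card (Q + H)" using finPQ sH by (intro card_mono) (auto simp: finite_set_plus)
    then show False using C'(4) cardC neg cPQ \<open>H = H0\<close> by simp
  qed
  \<comment> \<open>\<open>g\<close> fixes \<open>C\<close> but not \<open>S\<close>, so some coset
    \<open>c + H\<close> meets \<open>S\<close> without lying inside it. As \<open>C\<close> is a
    union of \<open>H\<close>-cosets inside \<open>S\<close>, it misses \<open>c + H\<close>: there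
    is room to enlarge.\<close>
  then obtain g where g: "g \<in> H" "g \<notin> stab S" using C'(3) H0_def by blast
  then obtain s where s: "s \<in> S" "g + s \<notin> S" using finS by (auto simp: stab_iff)
  obtain u v where uv: "u \<in> A" "v \<in> B" "s = u + v" using s by (auto simp: S_def set_plus_def)
  define c where "c = u + v"
  have cH: "\<not> (+) c ` H \<subseteq> S" using g s uv by (auto simp: c_def add.commute)
  have CcH: "C \<inter> (+) c ` H = {}"
  proof (rule ccontr)
    assume "C \<inter> (+) c ` H \<noteq> {}"
    then obtain x where x: "x \<in> C" "x \<in> (+) c ` H" by blast
    then have "(+) c ` H = (+) x ` H" using coset_eq[OF sH(1)] by metis
    also have "\<dots> \<subseteq> C" using x stab_add[of _ C x] by (auto simp: H_def add.commute)
    finally show False using cH C'(1) by blast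
  qed
  \<comment> \<open>Enlarge \<open>C\<close> by \<open>D = A1 + B1\<close> inside
    \<open>c + H\<close>. \<open>D\<close> misses the nonempty \<open>C\<close>, so the induction
    hypothesis applies to it; \<open>C \<union> D\<close> has the smaller stabilizer
    \<open>H1\<close>, so by minimality it is not convergent. The inequalities record both facts
    together with the negated claim.\<close>
  have key: "card A1 + card B1 \<le> card (A1 + B1) + card (stab (A1 + B1)) \<and>
      card (A1 + stab (A1 + B1)) + card (B1 + stab (A1 + B1)) \<le> card (A1 + B1) + card (stab (A1 + B1)) \<and>
      card (Q + H) + card (A1 + B1) < card Q + card H \<and>
      card (Q + H) + card (A1 + B1) + card (stab (A1 + B1)) < card H + card (Q + stab (A1 + B1)) \<and>
      card (A1 + B1) + 2 * card (stab (A1 + B1)) \<le> card H \<and> stab (A1 + B1) \<subseteq> H"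
    if A1: "A1 = A \<inter> (+) u' ` H" "A1 \<noteq> {}" and B1: "B1 = B \<inter> (+) v' ` H" "B1 \<noteq> {}"
      and uv': "u' + v' = c" for A1 B1 u' v'
  proof -
    define D where "D = A1 + B1"
    define H1 where "H1 = stab D"
    have fA1: "finite A1" "finite B1" using fin A1 B1 by auto
    have finD: "finite D" and neD: "D \<noteq> {}" using fA1 A1(2) B1(2) by (auto simp: D_def finite_set_plus set_plus_nonempty)
    have DS: "D \<subseteq> S" unfolding D_def S_def A1 B1 by (rule set_plus_mono2) auto
    have Dc: "D \<subseteq> (+) c ` H"
    proof
      fix x assume "x \<in> D"
      then obtain h k where "h \<in> H" "k \<in> H" "x = (u' + h) + (v' + k)"
        unfolding D_def A1 B1 by (auto simp: set_plus_def)
      then have "x = c + (h + k)" "h + k \<in> H" using uv' sH(1) by (auto simp: add_ac subgrp_add)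
      then show "x \<in> (+) c ` H" by blast
    qed
    have Dd: "x - c \<in> H" if "x \<in> D" for x
      using subsetD[OF Dc that] by (simp only: mem_coset_iff)
    have Dne: "D \<noteq> (+) c ` H" using DS cH by blast
    have CD: "C \<inter> D = {}" using CcH Dc by blast
    have cCD: "card C + card D \<le> n"
    proof -
      have "card C + card D = card (C \<union> D)" using CD finC finD by (simp add: card_Un_disjoint)
      also have "\<dots> \<le> card S" using C'(1) DS finS by (intro card_mono) auto
      finally show ?thesis using nm by (simp add: S_def)
    qed
    have lt: "card D < n" using cCD C'(2) finC card_gt_0_iff[of C] by simp
    have ih1: "card A1 + card B1 \<le> card D + card H1"
      using IH[OF fA1 A1(2) B1(2)] lt by (simp add: D_def H1_def)
    have ih2: "card (A1 + H1) + card (B1 + H1) \<le> card D + card H1"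
      using kneser_IH_closed[OF fA1 A1(2) B1(2), of H1] lt by (simp add: D_def H1_def)
    have sH1: "subgrp H1" "finite H1" using subgrp_stab finite_stab finD neD by (auto simp: H1_def)
    have H1H: "H1 \<subseteq> H"
    proof
      fix h assume h: "h \<in> H1"
      obtain d where d: "d \<in> D" using neD by blast
      then have "h + d \<in> D" using h by (simp add: H1_def stab_add)
      then have "h + d - c \<in> H" "d - c \<in> H" using d Dd by blast+
      then have "(h + d - c) - (d - c) \<in> H" by (rule subgrp_diff[OF sH(1)])
      then show "h \<in> H" by simp
    qed
    have H0H1: "H0 \<subseteq> H1"
    proof
      fix h assume h: "h \<in> H0"
      have "h + x \<in> D" if x: "x \<in> D" for x
      proof -
        obtain y z where yz: "y \<in> A1" "z \<in> B1" "x = y + z" using x by (auto simp: D_def set_plus_def)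
        have "y - u' \<in> H" using yz A1 mem_coset_iff by blast
        then have "h + (y - u') \<in> H" using h C'(3) by (auto intro: subgrp_add[OF sH(1)])
        then have "h + y \<in> (+) u' ` H" using mem_coset_iff[of "h + y" u' H] by (simp add: add_diff_eq)
        then have "h + y \<in> A1" using yz h perA A1 by auto
        then have "(h + y) + z \<in> D" using yz by (auto simp: D_def set_plus_def)
        then show ?thesis using yz by (simp add: add.assoc)
      qed
      then show "h \<in> H1" using finD by (simp add: H1_def stab_iff)
    qed
    have H1ne: "H1 \<noteq> H"
    proof
      assume e: "H1 = H"
      obtain d where d: "d \<in> D" using neD by blast
      have "d \<in> (+) c ` H" using d Dc by blast
      then have "(+) c ` H = (+) d ` H" using coset_eq[OF sH(1)] by metis
      also have "\<dots> \<subseteq> D" using d e stab_add[of _ D d] by (auto simp: H1_def add.commute)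
      finally show False using Dne Dc by blast
    qed
    then have cH1: "card H1 < card H" using H1H sH(2) by (simp add: psubsetI psubset_card_mono)
    have stCD: "stab (C \<union> D) = H1"
    proof
      have "h \<in> stab (C \<union> D)" if "h \<in> H1" for h
        using that H1H finC finD by (subst stab_iff) (auto simp: H_def H1_def stab_add)
      then show "H1 \<subseteq> stab (C \<union> D)" by blast
      show "stab (C \<union> D) \<subseteq> H1"
      proof
        fix h assume h: "h \<in> stab (C \<union> D)"
        \<comment> \<open>Otherwise \<open>h\<close> carries \<open>D\<close>, which lies in a
          single \<open>H\<close>-coset, into \<open>C\<close>. \<open>C\<close> is
          \<open>H\<close>-periodic, so shifting back by \<open>h\<close> would put all of
          \<open>c + H\<close> into \<open>C \<union> D\<close>, hence into
          \<open>D\<close>.\<close>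
        have inH: "h \<in> H"
        proof (rule ccontr)
          assume nH: "h \<notin> H"
          have out: "h + d \<in> C" if d: "d \<in> D" for d
          proof -
            have "h + d \<in> C \<union> D" using stab_add[OF h, of d] d by blast
            moreover have "h + d \<notin> D"
            proof
              assume "h + d \<in> D"
              then have "h + d - c \<in> H" "d - c \<in> H" using d Dd by blast+
              then have "(h + d - c) - (d - c) \<in> H" by (rule subgrp_diff[OF sH(1)])
              then show False using nH by simp
            qed
            ultimately show ?thesis by blast
          qed
          obtain d where d: "d \<in> D" using neD by blast
          have "(+) c ` H \<subseteq> C \<union> D"
          proof
            fix x assume "x \<in> (+) c ` H"
            then have "x - c \<in> H" "d - c \<in> H" using Dd[OF d] by (simp_all only: mem_coset_iff)
            then have "(x - c) - (d - c) \<in> H" by (rule subgrp_diff[OF sH(1)])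
            then have "x - d \<in> H" by simp
            then have "(x - d) + (h + d) \<in> C" using stab_add[of "x - d" C "h + d"] out[OF d] by (simp only: H_def)
            then have "- h + ((x - d) + (h + d)) \<in> C \<union> D"
              using stab_add[OF subgrp_minus[OF subgrp_stab h]] by blast
            moreover have "- h + ((x - d) + (h + d)) = x" by simp
            ultimately show "x \<in> C \<union> D" by simp
          qed
          then show False using CcH Dne Dc by blast
        qed
        have "h + d \<in> D" if d: "d \<in> D" for d
        proof -
          have "h + d \<in> C \<union> D" using stab_add[OF h, of d] d by blast
          moreover have "h + d \<notin> C"
          proof
            assume "h + d \<in> C"
            then have "- h + (h + d) \<in> C"
              using stab_add[of "- h" C "h + d"] subgrp_minus[OF sH(1) inH] by (simp only: H_def)
            then show False using CD d by auto
          qed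
          ultimately show ?thesis by blast
        qed
        then show "h \<in> H1" using finD by (simp add: H1_def stab_iff)
      qed
    qed
    have nc: "card C + card D + card H1 < card P + card (Q + H1)"
    proof (rule ccontr)
      assume "\<not> ?thesis"
      then have "card P + card (Q + stab (C \<union> D)) \<le> card (C \<union> D) + card (stab (C \<union> D))"
        using stCD CD finC finD by (simp add: card_Un_disjoint)
      then have "conv (C \<union> D)" unfolding conv_def using C' DS H0H1 stCD by auto
      then show False using Cmin cH1 stCD by (fastforce simp: H_def)
    qed
    have QH: "card (Q + H1) \<le> card (Q + H)"
      using finPQ sH H1H by (intro card_mono finite_set_plus set_plus_mono2) auto
    have lt2: "card D + card H1 < card H" using nc QH C'(4) by linarith
    \<comment> \<open>The part of \<open>c + H\<close> outside \<open>D\<close> is a union of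
      \<open>H1\<close>-cosets and has more than \<open>card H1\<close> elements, so it contains at
      least two of them.\<close>
    have "card D + 2 * card H1 \<le> card H"
    proof -
      define R where "R = (+) c ` H - D"
      have cR: "card R = card H - card D" unfolding R_def using Dc sH(2) finD
        by (simp add: card_Diff_subset card_image)
      have perR: "(+) x ` H1 \<subseteq> R" if x: "x \<in> R" for x
      proof
        fix y assume "y \<in> (+) x ` H1"
        then obtain h where h: "h \<in> H1" "y = x + h" by blast
        have "x - c + h \<in> H" using x h H1H mem_coset_iff
          by (auto simp: R_def intro!: subgrp_add[OF sH(1)])
        then have "y \<in> (+) c ` H" using mem_coset_iff[of y c H] h by (simp add: algebra_simps)
        moreover have "y \<notin> D"
        proof
          assume "y \<in> D"
          then have "- h + y \<in> D"
            using stab_add[of "- h" D y] subgrp_minus[OF sH1(1) h(1)] by (simp only: H1_def)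
          then show False using x h by (simp add: R_def)
        qed
        ultimately show "y \<in> R" by (simp add: R_def)
      qed
      have finR: "finite R" using sH by (simp add: R_def)
      have "card R > card H1" using cR lt2 by simp
      then obtain x where x: "x \<in> R" by fastforce
      have "card ((+) x ` H1) = card H1" by (simp add: card_image)
      then have "\<not> R \<subseteq> (+) x ` H1" using \<open>card R > card H1\<close> sH1
        by (metis card_mono finite_imageI leD)
      then obtain y where y: "y \<in> R" "y \<notin> (+) x ` H1" by blast
      have "(+) x ` H1 \<inter> (+) y ` H1 = {}" using coset_disj[OF sH1(1)] coset_self[OF sH1(1), of y] y by blast
      then have "card ((+) x ` H1 \<union> (+) y ` H1) = 2 * card H1"
        using sH1(2) by (simp add: card_Un_disjoint card_image)
      moreover have "card ((+) x ` H1 \<union> (+) y ` H1) \<le> card R" using perR x y finR by (intro card_mono) auto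
      ultimately show ?thesis using cR lt2 by simp
    qed
    moreover have "card (Q + H) + card D < card Q + card H"
      using C'(4) cCD neg cPQ by linarith
    moreover have "card (Q + H) + card D + card H1 < card H + card (Q + H1)"
      using nc C'(4) by linarith
    ultimately show ?thesis using ih1 ih2 H1H unfolding D_def H1_def by blast
  qed
  define A1 where "A1 = A \<inter> (+) u ` H"
  define B1 where "B1 = B \<inter> (+) v ` H"
  have ne1: "A1 \<noteq> {}" "B1 \<noteq> {}" using uv coset_self[OF sH(1)] by (auto simp: A1_def B1_def)
  note k1 = key[OF A1_def ne1(1) B1_def ne1(2) c_def[symmetric]]
  have uQ: "(+) u ` H \<subseteq> Q + H" "(+) v ` H \<subseteq> Q + H" using uv by (auto simp: Q_def set_plus_def)
  have fQH: "finite (Q + H)" using finPQ sH by (simp add: finite_set_plus)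
  have QQH: "Q \<subseteq> Q + H" using subgrp_0[OF sH(1)] by (rule subset_set_plus)
  have cardc: "card ((+) x ` H) = card H" for x by (simp add: card_image)
  show False
  proof (cases "(+) u ` H = (+) v ` H")
    case True
    define H1 where "H1 = stab (A1 + B1)"
    have H1H: "H1 \<subseteq> H" using k1 by (simp add: H1_def)
    have fH1: "finite H1" using H1H sH finite_subset by blast
    have fA1: "finite A1" "finite B1" using fin by (auto simp: A1_def B1_def)
    \<comment> \<open>Both pieces lie in one coset. Its points outside \<open>Q + H1\<close> number
      at most \<open>card (Q + H) - card (Q + H1)\<close>, and the others are in the closures of
      \<open>A1\<close> and \<open>B1\<close>; this contradicts the failure of convergence.\<close>
    have "(+) u ` H \<subseteq> (Q + H) - (Q + H1) \<union> ((A1 + H1) \<union> (B1 + H1))"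
    proof
      fix x assume x: "x \<in> (+) u ` H"
      show "x \<in> (Q + H) - (Q + H1) \<union> ((A1 + H1) \<union> (B1 + H1))"
      proof (cases "x \<in> Q + H1")
        case True
        then obtain q h where q: "q \<in> Q" "h \<in> H1" "x = q + h" by (auto simp: set_plus_def)
        have "x - u \<in> H" using x by (simp only: mem_coset_iff)
        then have "(x - u) - h \<in> H" by (rule subgrp_diff[OF sH(1)]) (use q H1H in blast)
        moreover have "(x - u) - h = q - u" using q by simp
        ultimately have "q \<in> (+) u ` H" by (simp only: mem_coset_iff)
        then have "q \<in> A1 \<union> B1" using q \<open>(+) u ` H = (+) v ` H\<close> by (auto simp: A1_def B1_def Q_def)
        then show ?thesis using q by (auto simp: set_plus_def)
      qed (use x uQ in auto)
    qed
    then have "card ((+) u ` H) \<le> card (((Q + H) - (Q + H1)) \<union> ((A1 + H1) \<union> (B1 + H1)))"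
      using fQH fA1 fH1 by (intro card_mono) (auto simp: finite_set_plus)
    also have "\<dots> \<le> card ((Q + H) - (Q + H1)) + (card (A1 + H1) + card (B1 + H1))"
      by (meson add_left_mono card_Un_le order_trans)
    also have "card ((Q + H) - (Q + H1)) = card (Q + H) - card (Q + H1)"
      using finite_set_plus[OF finPQ(2) fH1] set_plus_mono2[OF order_refl H1H, of Q] by (rule card_Diff_subset)
    finally have "card H \<le> (card (Q + H) - card (Q + H1)) + (card (A1 + H1) + card (B1 + H1))"
      using cardc by simp
    moreover have "card (Q + H1) \<le> card (Q + H)" using fQH H1H by (intro card_mono set_plus_mono2) auto
    ultimately show False using k1 unfolding H1_def[symmetric] by linarith
  next
    case False
    then have dis: "(+) u ` H \<inter> (+) v ` H = {}" by (rule coset_disj[OF sH(1)])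
    define A2 where "A2 = A \<inter> (+) v ` H"
    define B2 where "B2 = B \<inter> (+) u ` H"
    have fin': "finite A1" "finite B1" "finite A2" "finite B2"
      using fin by (auto simp: A1_def B1_def A2_def B2_def)
    \<comment> \<open>\<open>Q\<close> misses at most \<open>card (Q + H) - card Q\<close> points of
      the two cosets. This forces \<open>A2\<close> and \<open>B2\<close> to be nonempty, and
      \<open>v + u = c\<close> too, so \<open>key\<close> applies to a second enlargement; the two
      sets of bounds add up to a contradiction.\<close>
    have J: "2 * card H + card Q \<le> card (Q + H) + card (A1 \<union> B2) + card (A2 \<union> B1)"
    proof -
      define X where "X = (+) u ` H \<union> (+) v ` H"
      have cX: "card X = 2 * card H" using dis sH(2) cardc by (simp add: X_def card_Un_disjoint)
      have "card (Q \<union> X) + card (Q \<inter> X) = card Q + card X"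
        using finPQ sH(2) card_Un_Int[of Q X] by (simp add: X_def)
      moreover have "card (Q \<union> X) \<le> card (Q + H)" using fQH uQ QQH by (intro card_mono) (auto simp: X_def)
      moreover have "Q \<inter> X = (A1 \<union> B2) \<union> (A2 \<union> B1)"
        by (auto simp: Q_def X_def A1_def A2_def B1_def B2_def)
      moreover have "card ((A1 \<union> B2) \<union> (A2 \<union> B1)) \<le> card (A1 \<union> B2) + card (A2 \<union> B1)" by (rule card_Un_le)
      ultimately show ?thesis using cX by simp
    qed
    have un: "card (A1 \<union> B2) \<le> card H" "card (A2 \<union> B1) \<le> card H"
      using cardc[of u] cardc[of v] sH(2)
      by (metis A1_def B2_def card_mono finite_imageI Un_least inf_le2,
          metis A2_def B1_def card_mono finite_imageI Un_least inf_le2)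
    have un': "card (A1 \<union> B2) \<le> card A1 + card B2" "card (A2 \<union> B1) \<le> card A2 + card B1"
      by (rule card_Un_le)+
    have "card A1 \<le> card (A1 + B1)" "card B1 \<le> card (A1 + B1)"
      using card_le_set_plus[of A1 B1] card_le_set_plus[of B1 A1] fin' ne1 by (auto simp: add.commute)
    then have "card B2 \<noteq> 0" "card A2 \<noteq> 0" using k1 J un un' by linarith+
    then have ne2: "A2 \<noteq> {}" "B2 \<noteq> {}" by auto
    have "v + u = c" by (simp add: c_def add.commute)
    note k2 = key[OF A2_def ne2(1) B2_def ne2(2) this]
    show False using k1 k2 J un' by linarith
  qed
qed

end

theorem kneser:
  fixes A B :: "'a::ab_group_add set"
  assumes "finite A" "A \<noteq> {}" "finite B" "B \<noteq> {}"
  shows "card A + card B \<le> card (A + B) + card (stab (A + B))"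
proof -
  \<comment> \<open>Two nested inductions: on the size of the sumset and, for fixed sumset size, on
    the size of the closure of \<open>A\<close> under the stabilizer.\<close>
  have "card A + card B \<le> card (A + B) + card (stab (A + B))"
    if "finite A" "A \<noteq> {}" "finite B" "B \<noteq> {}" "card (A + B) = n" "card (A + stab (A + B)) = m"
    for n m and A B :: "'a set"
    using that
  proof (induction n arbitrary: m A B rule: less_induct)
    case (less n)
    note outer = less.IH
    from less.prems show ?case
    proof (induction m arbitrary: A B rule: less_induct)
      case (less m A0 B0)
      define H0 where "H0 = stab (A0 + B0)"
      define A where "A = A0 + H0"
      define B where "B = B0 + H0"
      have finS: "finite (A0 + B0)" "A0 + B0 \<noteq> {}" using less.prems by (auto simp: finite_set_plus set_plus_nonempty)
      have sH0: "subgrp H0" "finite H0" using subgrp_stab finite_stab finS by (auto simp: H0_def)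
      have H0ne: "H0 \<noteq> {}" using subgrp_0[OF sH0(1)] by blast
      have AB: "A + B = A0 + B0"
      proof -
        have "A + B = (A0 + B0) + (H0 + H0)" by (simp add: A_def B_def add_ac)
        then show ?thesis using subgrp_sum[OF sH0(1)] plus_stab H0_def by metis
      qed
      have fin: "finite A" "finite B" "A \<noteq> {}" "B \<noteq> {}" using less.prems sH0 H0ne
        by (auto simp: A_def B_def finite_set_plus set_plus_nonempty)
      have le: "card A0 \<le> card A" "card B0 \<le> card B"
        using less.prems sH0 H0ne by (auto simp: A_def B_def intro: card_le_set_plus)
      have per: "A + H0 = A" "B + H0 = B"
        using subgrp_sum[OF sH0(1)] by (auto simp: A_def B_def add.assoc)
      have cA: "card A = m" using less.prems by (simp add: A_def H0_def)
      have IH: "card A' + card B' \<le> card (A' + B') + card (stab (A' + B'))"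
        if "finite A'" "finite B'" "A' \<noteq> {}" "B' \<noteq> {}"
          "card (A' + B') < n \<or> card (A' + B') = n \<and> card (A' + stab (A' + B')) < card A"
        for A' B' :: "'a set"
        using outer[of "card (A' + B')" A' B'] less.IH[of "card (A' + stab (A' + B'))" A' B'] that cA
        by blast
      have "card A + card B \<le> card (A0 + B0) + card H0"
      proof (rule ccontr)
        assume neg: "\<not> ?thesis"
        obtain a where a: "a \<in> A" using fin by blast
        \<comment> \<open>Some \<open>a' - a\<close> is not a stabilizer of \<open>A + B\<close>,
          hence does not map \<open>B\<close> into itself either. Translating the witness
          \<open>b\<close> to \<open>a\<close> yields \<open>B'\<close>, which contains
          \<open>a\<close> but not \<open>a'\<close>.\<close>
        have "\<exists>a'\<in>A. a' - a \<notin> H0"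
        proof (rule ccontr)
          assume "\<not> ?thesis"
          then have "A \<subseteq> (+) a ` H0" using mem_coset_iff by blast
          then have "card A \<le> card ((+) a ` H0)" using sH0 by (intro card_mono) auto
          then have "card A \<le> card H0" by (simp add: card_image)
          moreover have "card B \<le> card (A0 + B0)" using card_le_set_plus[of B A] fin AB by (simp add: add.commute)
          ultimately show False using neg by simp
        qed
        then obtain a' where a': "a' \<in> A" "a' - a \<notin> H0" by blast
        have "\<exists>b\<in>B. (a' - a) + b \<notin> B"
        proof (rule ccontr)
          assume "\<not> ?thesis"
          then have *: "\<And>b. b \<in> B \<Longrightarrow> (a' - a) + b \<in> B" by blast
          have "(a' - a) + x \<in> A + B" if x: "x \<in> A + B" for x
          proof -
            obtain u v where "u \<in> A" "v \<in> B" "x = u + v" using x by (auto simp: set_plus_def)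
            then have "(a' - a) + x = u + ((a' - a) + v)" by (simp add: algebra_simps)
            then show ?thesis using *[of v] \<open>u \<in> A\<close> \<open>v \<in> B\<close> by (metis set_plus_intro)
          qed
          then show False using a' finS by (simp add: H0_def stab_iff AB)
        qed
        then obtain b where b: "b \<in> B" "(a' - a) + b \<notin> B" by blast
        define B' where "B' = (+) (a - b) ` B"
        have st: "stab (A + B') = H0" by (simp add: B'_def set_plus_translate stab_translate AB H0_def)
        have cB: "card B' = card B" by (simp add: B'_def card_image)
        have cS: "card (A + B') = card (A0 + B0)" by (simp add: B'_def set_plus_translate card_image AB)
        have perB: "B' + H0 = B'"
          using per(2) set_plus_translate[of H0 "a - b" B] by (simp add: B'_def add.commute)
        have aB: "a \<in> B'" using b by (force simp: B'_def)
        have aB': "a' \<notin> B'"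
        proof
          assume "a' \<in> B'"
          then obtain x where x: "x \<in> B" "a' = (a - b) + x" by (auto simp: B'_def)
          then have "x = (a' - a) + b" by (simp add: algebra_simps)
          then show False using b x by simp
        qed
        have "card A + card B' \<le> card (A + B') + card (stab (A + B'))"
        proof (rule kneser_step_aux[of A B' n a a'])
          show "card (A + B') = n" using cS less.prems by simp
          show "A + stab (A + B') = A" "B' + stab (A + B') = B'" using per perB st by auto
        qed (use fin a a' aB aB' IH in \<open>auto simp: B'_def\<close>)
        then show False using neg cB cS st by simp
      qed
      then show ?case using le by (simp add: H0_def)
    qed
  qed
  with assms show ?thesis by blast
qed

section \<open>Cyclic groups as images of the integers\<close>

quotient_type circ = real / "\<lambda>x y. x - y \<in> \<int>"
proof (intro equivpI reflpI sympI transpI)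
  fix x y z :: real
  show "x - x \<in> \<int>" by simp
  show "y - x \<in> \<int>" if "x - y \<in> \<int>" using Ints_minus[OF that] by simp
  show "x - z \<in> \<int>" if "x - y \<in> \<int>" "y - z \<in> \<int>" using Ints_add[OF that] by simp
qed

instantiation circ :: ab_group_add
begin

lift_definition zero_circ :: circ is 0 .
lift_definition plus_circ :: "circ \<Rightarrow> circ \<Rightarrow> circ" is "(+)"
  by (metis Ints_add add_diff_add)
lift_definition uminus_circ :: "circ \<Rightarrow> circ" is uminus
  by (metis Ints_minus minus_diff_minus)
lift_definition minus_circ :: "circ \<Rightarrow> circ \<Rightarrow> circ" is "(-)"
  by (metis Ints_diff diff_diff_eq2 diff_add_eq add_diff_eq diff_diff_add add.commute)

instance by standard (transfer; simp)+

end

text \<open>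
  A cyclic group of order \<open>m\<close> is represented by a homomorphism from the integers with kernel
  \<open>m\<int>\<close>; its range is the group and \<open>\<psi> 1\<close> a generator. Working inside \<open>\<real>/\<int>\<close> provides the groups
  \<open>\<int>/m\<int>\<close> for all \<open>m\<close> in one type.
\<close>

definition cyc :: "nat \<Rightarrow> (int \<Rightarrow> 'a::ab_group_add) \<Rightarrow> bool" where
  "cyc m \<psi> \<longleftrightarrow> m > 0 \<and> (\<forall>a b. \<psi> (a + b) = \<psi> a + \<psi> b) \<and> (\<forall>a. \<psi> a = 0 \<longleftrightarrow> int m dvd a)"

lemma ex_cyc:
  assumes "m > 0" shows "\<exists>\<psi> :: int \<Rightarrow> circ. cyc m \<psi>"
proof -
  have "of_int a / of_nat m \<in> (\<int> :: real set) \<longleftrightarrow> int m dvd a" for a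
  proof
    assume "of_int a / of_nat m \<in> (\<int> :: real set)"
    then obtain k :: int where "of_int a / of_nat m = (of_int k :: real)" by (auto elim: Ints_cases)
    then have "of_int a = (of_int (k * int m) :: real)" using assms by (simp add: field_simps)
    then show "int m dvd a" by (simp only: of_int_eq_iff) simp
  qed (use assms in \<open>auto elim!: dvdE\<close>)
  moreover have "abs_circ x + abs_circ y = abs_circ (x + y)" for x y by (simp add: plus_circ.abs_eq)
  moreover have "abs_circ x = 0 \<longleftrightarrow> x \<in> \<int>" for x by (simp add: zero_circ_def circ.abs_eq_iff)
  ultimately have "cyc m (\<lambda>a. abs_circ (of_int a / of_nat m))"
    using assms by (simp add: cyc_def add_divide_distrib)
  then show ?thesis by blast
qed

lemma cyc_add: "cyc m \<psi> \<Longrightarrow> \<psi> (a + b) = \<psi> a + \<psi> b"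
  by (simp add: cyc_def)

lemma cyc_pos: "cyc m \<psi> \<Longrightarrow> m > 0"
  by (simp add: cyc_def)

lemma cyc_0_iff: "cyc m \<psi> \<Longrightarrow> \<psi> a = 0 \<longleftrightarrow> int m dvd a"
  by (simp add: cyc_def)

lemma cyc_diff: "cyc m \<psi> \<Longrightarrow> \<psi> (a - b) = \<psi> a - \<psi> b"
  using cyc_add[of m \<psi> "a - b" b] by (simp add: algebra_simps)

lemma cyc_0: "cyc m \<psi> \<Longrightarrow> \<psi> 0 = 0"
  by (simp add: cyc_0_iff)

lemma cyc_minus: "cyc m \<psi> \<Longrightarrow> \<psi> (- a) = - \<psi> a"
  using cyc_diff[of m \<psi> 0 a] cyc_0[of m \<psi>] by simp

lemma cyc_eq_iff: "cyc m \<psi> \<Longrightarrow> \<psi> a = \<psi> b \<longleftrightarrow> int m dvd a - b"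
  using cyc_diff[of m \<psi> a b] cyc_0_iff[of m \<psi> "a - b"] by auto

lemma cyc_mod: "cyc m \<psi> \<Longrightarrow> \<psi> (a mod int m) = \<psi> a"
  by (simp add: cyc_eq_iff mod_eq_dvd_iff[symmetric])

lemma cyc_inj:
  assumes "cyc m \<psi>" "X \<subseteq> {u..<u + int m}" shows "inj_on \<psi> X"
proof (rule inj_onI)
  fix x y assume *: "x \<in> X" "y \<in> X" "\<psi> x = \<psi> y"
  then have "int m dvd x - y" using assms by (simp add: cyc_eq_iff)
  moreover have "x \<in> {u..<u + int m}" "y \<in> {u..<u + int m}" using * assms(2) by blast+
  then have "\<bar>x - y\<bar> < int m" by auto
  ultimately show "x = y" using dvd_imp_le_int[of "x - y" "int m"] by fastforce
qed

lemma cyc_range: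
  assumes "cyc m \<psi>" shows "range \<psi> = \<psi> ` {u..<u + int m}"
proof -
  have "\<psi> a \<in> \<psi> ` {u..<u + int m}" for a
  proof (rule image_eqI)
    show "\<psi> a = \<psi> (u + (a - u) mod int m)"
      using assms by (simp add: cyc_add cyc_mod cyc_diff)
    show "u + (a - u) mod int m \<in> {u..<u + int m}" using cyc_pos[OF assms] by simp
  qed
  then show ?thesis by auto
qed

lemma cyc_card_range: "cyc m \<psi> \<Longrightarrow> card (range \<psi>) = m" "cyc m \<psi> \<Longrightarrow> finite (range \<psi>)"
proof -
  assume "cyc m \<psi>"
  then have r: "range \<psi> = \<psi> ` {0..<int m}" and i: "inj_on \<psi> {0..<int m}"
    using cyc_range[of m \<psi> 0] by (auto intro!: cyc_inj[of m \<psi> _ 0])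
  show "card (range \<psi>) = m" unfolding r by (simp add: card_image i)
  show "finite (range \<psi>)" unfolding r by simp
qed

lemma cyc_subgrp:
  assumes "cyc m \<psi>" shows "subgrp (range \<psi>)"
  unfolding subgrp_def
proof (intro conjI ballI)
  show "0 \<in> range \<psi>" using cyc_0[OF assms] by (metis rangeI)
  fix x y assume "x \<in> range \<psi>" "y \<in> range \<psi>"
  then obtain a b where "x = \<psi> a" "y = \<psi> b" by blast
  then have "x - y = \<psi> (a - b)" by (simp add: cyc_diff[OF assms])
  then show "x - y \<in> range \<psi>" by simp
qed

lemma cyc_image_plus: "cyc m \<psi> \<Longrightarrow> \<psi> ` (A + B) = \<psi> ` A + \<psi> ` B"
proof (intro Set.set_eqI iffI)
  assume c: "cyc m \<psi>"
  fix x
  show "x \<in> \<psi> ` A + \<psi> ` B" if "x \<in> \<psi> ` (A + B)"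
    using that c by (auto elim!: set_plus_elim simp: cyc_add intro!: set_plus_intro)
  assume "x \<in> \<psi> ` A + \<psi> ` B"
  then obtain a b where ab: "a \<in> A" "b \<in> B" "x = \<psi> a + \<psi> b" by (auto elim!: set_plus_elim)
  then have "x = \<psi> (a + b)" using c by (simp add: cyc_add)
  then show "x \<in> \<psi> ` (A + B)" using ab by (auto intro: set_plus_intro)
qed

section \<open>Freiman's 3k-4 theorem for two sets of integers\<close>

text \<open>In each residue class met by \<open>T\<close> the largest member is not in
  \<open>B\<close>, since adding \<open>l\<close> to an element of \<open>B\<close> stays in
  \<open>T\<close> and in the class. So \<open>T\<close> contains, besides \<open>B\<close>, one
  further element per class.\<close>

lemma card_fibre_gain:
  assumes cyc: "cyc l \<phi>" and "finite T" "B \<subseteq> T" "\<And>b. b \<in> B \<Longrightarrow> b + int l \<in> T"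
  shows "card B + card (\<phi> ` T) \<le> card T"
proof -
  define U where "U = {t\<in>T. \<forall>t'\<in>T. \<phi> t' = \<phi> t \<longrightarrow> t' \<le> t}"
  have "inj_on \<phi> U" unfolding U_def by (rule inj_onI) (metis (mono_tags, lifting) mem_Collect_eq order_antisym)
  moreover have "\<phi> ` T \<subseteq> \<phi> ` U"
  proof
    fix y assume y: "y \<in> \<phi> ` T"
    define t where "t = Max {t\<in>T. \<phi> t = y}"
    have "t \<in> {t\<in>T. \<phi> t = y}" unfolding t_def using y assms(2) by (intro Max_in) auto
    moreover have "t' \<le> t" if "t' \<in> T" "\<phi> t' = y" for t'
      unfolding t_def using that assms(2) by (intro Max_ge) auto
    ultimately show "y \<in> \<phi> ` U" by (auto simp: U_def)
  qed
  ultimately have "card (\<phi> ` T) \<le> card U"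
    using assms(2) by (metis (no_types, lifting) U_def card_image card_mono finite_imageI finite_subset mem_Collect_eq subsetI)
  moreover have "B \<inter> U = {}"
  proof -
    have "\<phi> (b + int l) = \<phi> b" for b using cyc by (simp add: cyc_eq_iff)
    then show ?thesis using assms(4) cyc_pos[OF cyc] by (force simp: U_def)
  qed
  moreover have "card (B \<union> U) \<le> card T" using assms by (intro card_mono) (auto simp: U_def)
  moreover have "finite B" "finite U" using assms finite_subset by (auto simp: U_def)
  ultimately show ?thesis by (simp add: card_Un_disjoint)
qed

text \<open>Pigeonhole: by the size condition \<open>X\<close> and \<open>g - Y\<close> cannot be
  disjoint.\<close>

lemma plus_eq_group:
  assumes G: "subgrp G" "finite G" and "X \<subseteq> G" "Y \<subseteq> G" "card X + card Y > card G"
  shows "X + Y = G"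
proof
  show "X + Y \<subseteq> G" using assms by (auto simp: set_plus_def intro!: subgrp_add)
  show "G \<subseteq> X + Y"
  proof
    fix g assume g: "g \<in> G"
    have "X \<inter> (\<lambda>y. g - y) ` Y \<noteq> {}"
    proof
      assume "X \<inter> (\<lambda>y. g - y) ` Y = {}"
      moreover have "finite X" "finite Y" using assms finite_subset by auto
      moreover have "card ((\<lambda>y. g - y) ` Y) = card Y" by (simp add: card_image inj_on_def)
      ultimately have "card (X \<union> (\<lambda>y. g - y) ` Y) = card X + card Y" by (simp add: card_Un_disjoint)
      moreover have "card (X \<union> (\<lambda>y. g - y) ` Y) \<le> card G"
        using assms g by (intro card_mono) (auto intro: subgrp_diff)
      ultimately show False using assms by simp
    qed
    then obtain y where "y \<in> Y" "g - y \<in> X" by blast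
    then have "(g - y) + y \<in> X + Y" by blast
    then show "g \<in> X + Y" by simp
  qed
qed

text \<open>The sums \<open>x + Min B\<close> and \<open>Max A + y\<close> share only
  \<open>Max A + Min B\<close>.\<close>

lemma card_sumset_int:
  fixes A B :: "int set"
  assumes "finite A" "finite B" "A \<noteq> {}" "B \<noteq> {}"
  shows "card A + card B \<le> card (A + B) + 1"
proof -
  have "Max A \<in> A" "Min B \<in> B" using assms by simp_all
  then have "(\<lambda>x. x + Min B) ` A \<union> (\<lambda>y. Max A + y) ` B \<subseteq> A + B"
    by (blast intro: set_plus_intro)
  moreover have "(\<lambda>x. x + Min B) ` A \<inter> (\<lambda>y. Max A + y) ` B \<subseteq> {Max A + Min B}"
  proof
    fix z assume "z \<in> (\<lambda>x. x + Min B) ` A \<inter> (\<lambda>y. Max A + y) ` B"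
    then obtain x y where "x \<in> A" "y \<in> B" "z = x + Min B" "z = Max A + y" by auto
    moreover then have "x \<le> Max A" "Min B \<le> y" using assms by auto
    ultimately show "z \<in> {Max A + Min B}" by simp
  qed
  then have "card ((\<lambda>x. x + Min B) ` A \<inter> (\<lambda>y. Max A + y) ` B) \<le> card {Max A + Min B}"
    by (intro card_mono) auto
  moreover have "card ((\<lambda>x. x + Min B) ` A) = card A" "card ((\<lambda>y. Max A + y) ` B) = card B"
    by (auto simp: card_image inj_on_def)
  ultimately show ?thesis
    using card_Un_Int[of "(\<lambda>x. x + Min B) ` A" "(\<lambda>y. Max A + y) ` B"] assms
      card_mono[OF finite_set_plus[OF assms(1,2)], of "(\<lambda>x. x + Min B) ` A \<union> (\<lambda>y. Max A + y) ` B"]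
    by simp
qed

text \<open>Modulo \<open>l\<close> the elements 0 and \<open>l\<close> of \<open>A\<close>
  coincide, so every element of \<open>B\<close> gives two sums in one class, and
  \<open>card_fibre_gain\<close> turns \<open>l \<le> card S\<close> into the first bound. To see
  that \<open>S\<close> is the whole group, its stabilizer \<open>H\<close> is shown by Kneser's
  theorem to contain both images; \<open>gcd\<close> then puts the generator into \<open>H\<close>.
  The second bound works modulo \<open>m\<close>, where the first bound makes pigeonhole
  sufficient.\<close>

lemma three_k_normalized:
  fixes A B :: "int set"
  assumes A: "A \<subseteq> {0..int l}" "0 \<in> A" "int l \<in> A" and B: "B \<subseteq> {0..int m}" "0 \<in> B" "int m \<in> B"
    and ml: "m \<le> l" and gcd: "\<And>D. D > 1 \<Longrightarrow> \<exists>x\<in>A \<union> B. \<not> D dvd x"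
    and small: "card (A + B) + 4 \<le> card A + card B + min (card A) (card B)"
  shows "l + card B \<le> card (A + B)" "m + card A \<le> card (A + B)"
proof -
  have fin: "finite A" "finite B" and ne: "A \<noteq> {}" "B \<noteq> {}" using A B finite_subset by auto
  note finT = finite_set_plus[OF fin]
  have b2: "card B \<ge> 2" "card A \<ge> 2"
    using small card_le_set_plus[of A B] card_le_set_plus[of B A] fin ne by (auto simp: add.commute)
  have m0: "m > 0"
  proof (rule ccontr)
    assume "\<not> m > 0"
    then have "card B \<le> card {0::int}" using B by (intro card_mono) auto
    then show False using b2 by simp
  qed
  then have l0: "l > 0" using ml by simp
  obtain \<phi> :: "int \<Rightarrow> circ" where \<phi>: "cyc l \<phi>" using ex_cyc[OF l0] by blast
  define S where "S = \<phi> ` (A + B)"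
  have S: "S = \<phi> ` A + \<phi> ` B" unfolding S_def by (rule cyc_image_plus[OF \<phi>])
  have finS: "finite S" and neS: "S \<noteq> {}" unfolding S using fin ne by (auto simp: finite_set_plus set_plus_nonempty)
  define H where "H = stab S"
  have sH: "subgrp H" "finite H" unfolding H_def using subgrp_stab finite_stab finS neS by auto
  have H0: "0 \<in> H" using sH(1) by (rule subgrp_0)
  have BT: "B \<subseteq> A + B" "b \<in> B \<Longrightarrow> b + int l \<in> A + B" for b
    using A(2,3) set_plus_intro[of 0 A _ B] set_plus_intro[of "int l" A b B] by (auto simp: add.commute)
  have cardT: "card B + card S \<le> card (A + B)"
    unfolding S_def by (rule card_fibre_gain[OF \<phi> finT BT])
  have cA: "card A \<le> card (\<phi> ` A) + 1"
  proof -
    have "inj_on \<phi> (A - {int l})" using A(1) by (intro cyc_inj[OF \<phi>, of _ 0]) force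
    then have "card A - 1 = card (\<phi> ` (A - {int l}))" using A(3) fin by (simp add: card_image)
    also have "\<dots> \<le> card (\<phi> ` A)" using fin by (intro card_mono) auto
    finally show ?thesis by simp
  qed
  have cB: "card B \<le> card (\<phi> ` B) + 1"
  proof -
    have "inj_on \<phi> (B - {int m})" using B(1) ml by (intro cyc_inj[OF \<phi>, of _ 0]) force
    then have "card B - 1 = card (\<phi> ` (B - {int m}))" using B(3) fin by (simp add: card_image)
    also have "\<dots> \<le> card (\<phi> ` B)" using fin by (intro card_mono) auto
    finally show ?thesis by simp
  qed
  have kn: "card (\<phi> ` A + H) + card (\<phi> ` B + H) \<le> card S + card H"
  proof -
    have "(\<phi> ` A + H) + (\<phi> ` B + H) = S + (H + H)" unfolding S by (simp add: add_ac)
    also have "\<dots> = S" using subgrp_sum[OF sH(1)] plus_stab[of S] by (simp add: H_def)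
    finally have "(\<phi> ` A + H) + (\<phi> ` B + H) = S" .
    moreover have "\<phi> ` A + H \<noteq> {}" "\<phi> ` B + H \<noteq> {}" using ne H0 by (auto intro!: set_plus_nonempty)
    ultimately show ?thesis using kneser[of "\<phi> ` A + H" "\<phi> ` B + H"] fin sH
      by (simp add: finite_set_plus H_def)
  qed
  have "\<phi> ` A \<subseteq> H"
  proof (rule ccontr)
    assume nA: "\<not> \<phi> ` A \<subseteq> H"
    have HA: "H \<subset> \<phi> ` A + H"
    proof
      have "\<phi> 0 = 0" using \<phi> by (rule cyc_0)
      then have "0 \<in> \<phi> ` A" using A(2) by (metis image_eqI)
      then show "H \<subseteq> \<phi> ` A + H" using set_plus_intro[of 0 "\<phi> ` A" _ H] by force
      have "\<phi> ` A \<subseteq> \<phi> ` A + H" using H0 by (rule subset_set_plus)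
      then show "H \<noteq> \<phi> ` A + H" using nA by blast
    qed
    then have "card H < card (\<phi> ` A + H)" using fin sH by (intro psubset_card_mono) (auto simp: finite_set_plus)
    then have "card (\<phi> ` B + H) < card S" using kn by linarith
    then have "\<not> S \<subseteq> \<phi> ` B + H" using fin sH by (metis card_mono finite_imageI finite_set_plus leD)
    then obtain s where s: "s \<in> S" "s \<notin> \<phi> ` B + H" by blast
    then obtain a b where ab: "a \<in> A" "b \<in> B" "s = \<phi> a + \<phi> b" unfolding S by (auto elim!: set_plus_elim)
    \<comment> \<open>Over the class \<open>s + H\<close> lie at least the
      \<open>card A1 + card B1 - 1\<close> sums from \<open>A1 + B1\<close>; the class avoids the
      image of \<open>B\<close>, so \<open>T0\<close> keeps the full fibre gain
      \<open>card B\<close>. Elements missing from \<open>A1\<close> and \<open>B1\<close> are holes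
      in the closures, which Kneser's inequality limits. Altogether there are at least
      \<open>card A + 2 * card B - 3\<close> sums, against \<open>small\<close>.\<close>
    define A1 where "A1 = {x\<in>A. \<phi> x \<in> (+) (\<phi> a) ` H}"
    define B1 where "B1 = {x\<in>B. \<phi> x \<in> (+) (\<phi> b) ` H}"
    define T0 where "T0 = {t\<in>A + B. \<phi> t \<notin> (+) s ` H}"
    have fin1: "finite A1" "finite B1" using fin by (auto simp: A1_def B1_def)
    have ne1: "A1 \<noteq> {}" "B1 \<noteq> {}" using ab coset_self[OF sH(1)] by (auto simp: A1_def B1_def)
    have T1: "A1 + B1 \<subseteq> A + B - T0"
    proof
      fix t assume "t \<in> A1 + B1"
      then obtain x y where xy: "x \<in> A1" "y \<in> B1" "t = x + y" by (elim set_plus_elim)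
      then have "\<phi> x - \<phi> a \<in> H" "\<phi> y - \<phi> b \<in> H" using mem_coset_iff by (auto simp: A1_def B1_def)
      then have "(\<phi> x - \<phi> a) + (\<phi> y - \<phi> b) \<in> H" by (rule subgrp_add[OF sH(1)])
      then have "\<phi> t - s \<in> H" using xy ab by (simp add: cyc_add[OF \<phi>] algebra_simps)
      then have "\<phi> t \<in> (+) s ` H" by (simp only: mem_coset_iff)
      then show "t \<in> A + B - T0" using xy by (auto simp: T0_def A1_def B1_def)
    qed
    have "B \<subseteq> T0" "\<And>y. y \<in> B \<Longrightarrow> y + int l \<in> T0"
    proof -
      have *: "\<phi> y \<notin> (+) s ` H" if "y \<in> B" for y
      proof
        assume "\<phi> y \<in> (+) s ` H"
        then have "\<phi> y - s \<in> H" by (simp only: mem_coset_iff)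
        then have "s - \<phi> y \<in> H" using subgrp_minus[OF sH(1)] by fastforce
        then have "\<phi> y + (s - \<phi> y) \<in> \<phi> ` B + H" using that by (intro set_plus_intro) auto
        then show False using s by simp
      qed
      then show "B \<subseteq> T0" using BT by (auto simp: T0_def)
      fix y assume "y \<in> B"
      moreover have "\<phi> (y + int l) = \<phi> y" using \<phi> by (simp add: cyc_eq_iff)
      ultimately show "y + int l \<in> T0" using BT * by (auto simp: T0_def)
    qed
    moreover have "T0 \<subseteq> A + B" by (auto simp: T0_def)
    ultimately have cT0: "card B + card (\<phi> ` T0) \<le> card T0"
      using finite_subset[OF _ finT] by (intro card_fibre_gain[OF \<phi>]) auto
    have sHS: "(+) s ` H \<subseteq> S" using s stab_add[of _ S s] by (auto simp: H_def add.commute)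
    have "\<phi> ` T0 = S - (+) s ` H" unfolding T0_def S_def by auto
    then have "card (\<phi> ` T0) + card H = card S"
      using sHS sH(2) finS by (simp add: card_Diff_subset card_image card_mono)
        (metis add.commute card_image card_mono inj_on_add le_add_diff_inverse2)
    moreover have "card T0 + card (A1 + B1) \<le> card (A + B)"
    proof -
      have "card (A1 + B1) \<le> card (A + B - T0)" using T1 finT by (intro card_mono) auto
      also have "\<dots> = card (A + B) - card T0"
        using \<open>T0 \<subseteq> A + B\<close> finT by (intro card_Diff_subset) (auto intro: finite_subset)
      finally show ?thesis using card_mono[OF finT \<open>T0 \<subseteq> A + B\<close>] by linarith
    qed
    moreover note card_sumset_int[OF fin1 ne1]
    moreover have holes: "card (\<phi> ` X) + card H \<le> card (\<phi> ` X + H) + card {x\<in>X. \<phi> x \<in> (+) (\<phi> x0) ` H}"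
      if "finite X" "x0 \<in> X" for X x0
    proof -
      define c where "c = (+) (\<phi> x0) ` H"
      have cc: "card c = card H" "finite c" using sH by (auto simp: c_def card_image)
      have "\<phi> ` X \<subseteq> \<phi> ` X + H" using H0 by (rule subset_set_plus)
      moreover have "c \<subseteq> \<phi> ` X + H" using that by (auto simp: c_def)
      ultimately have "card (\<phi> ` X \<union> c) \<le> card (\<phi> ` X + H)" using that sH by (intro card_mono) (auto simp: finite_set_plus)
      moreover have "card (\<phi> ` X \<union> c) + card (\<phi> ` X \<inter> c) = card (\<phi> ` X) + card c"
        using card_Un_Int[of "\<phi> ` X" c] that cc by simp
      moreover have "\<phi> ` X \<inter> c = \<phi> ` {x\<in>X. \<phi> x \<in> c}" by blast
      then have "card (\<phi> ` X \<inter> c) \<le> card {x\<in>X. \<phi> x \<in> c}" using that by (simp add: card_image_le)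
      ultimately show ?thesis using cc unfolding c_def by linarith
    qed
    note holes[OF fin(1) ab(1)] holes[OF fin(2) ab(2)]
    ultimately show False using kn cT0 cA cB small unfolding A1_def B1_def by linarith
  qed
  moreover have "\<phi> ` B \<subseteq> H"
  proof (rule ccontr)
    assume nB: "\<not> \<phi> ` B \<subseteq> H"
    define B0 where "B0 = {x\<in>B. \<phi> x \<in> H}"
    have fB: "finite B0" "finite (B - B0)" using fin by (auto simp: B0_def)
    have "0 \<in> B0" using B H0 cyc_0[OF \<phi>] by (simp add: B0_def)
    then have neB: "B0 \<noteq> {}" "B - B0 \<noteq> {}" using nB by (auto simp: B0_def)
    \<comment> \<open>With \<open>A\<close> in a single \<open>H\<close>-class, its sums with
      \<open>B0\<close> and with the rest of \<open>B\<close> fall into different classes, giving at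
      least \<open>2 * card A + card B - 2\<close> sums.\<close>
    have "(A + B0) \<inter> (A + (B - B0)) = {}"
    proof (rule ccontr)
      assume "\<not> ?thesis"
      then obtain x y x' y' where *: "x \<in> A" "y \<in> B0" "x' \<in> A" "y' \<in> B - B0" "x + y = x' + y'"
        by (auto elim!: set_plus_elim)
      then have "\<phi> y' = (\<phi> x - \<phi> x') + \<phi> y"
        using cyc_add[OF \<phi>, of x y] cyc_add[OF \<phi>, of x' y'] by (simp add: algebra_simps)
      moreover have "\<phi> x - \<phi> x' \<in> H" using * \<open>\<phi> ` A \<subseteq> H\<close> by (intro subgrp_diff[OF sH(1)]) auto
      moreover have "\<phi> y \<in> H" using * by (simp add: B0_def)
      ultimately have "\<phi> y' \<in> H" by (simp add: subgrp_add[OF sH(1)])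
      then show False using * by (simp add: B0_def)
    qed
    then have "card (A + B0) + card (A + (B - B0)) = card ((A + B0) \<union> (A + (B - B0)))"
      using fin fB by (simp add: card_Un_disjoint finite_set_plus)
    also have "\<dots> \<le> card (A + B)"
      using finT by (intro card_mono Un_least set_plus_mono2) (auto simp: B0_def)
    finally have "card (A + B0) + card (A + (B - B0)) \<le> card (A + B)" .
    moreover have "card B = card B0 + card (B - B0)"
      using fin by (metis (no_types, lifting) B0_def add.commute card_Diff_subset card_mono fB(1) le_add_diff_inverse2 mem_Collect_eq subsetI)
    ultimately show False
      using card_sumset_int[OF fin(1) fB(1) ne(1) neB(1)] card_sumset_int[OF fin(1) fB(2) ne(1) neB(2)] small
      by linarith
  qed
  ultimately have AB: "\<phi> x \<in> H" if "x \<in> A \<union> B" for x using that by blast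
  have one: "\<phi> 1 \<in> H"
  proof -
    \<comment> \<open>Taking remainders, this least \<open>D\<close> divides every element of
      \<open>A\<close> and \<open>B\<close>, so \<open>gcd\<close> forces
      \<open>D = 1\<close>.\<close>
    define D where "D = (LEAST d::nat. d > 0 \<and> \<phi> (int d) \<in> H)"
    have "\<exists>d::nat. d > 0 \<and> \<phi> (int d) \<in> H"
      using l0 cyc_0_iff[OF \<phi>, of "int l"] H0 by (intro exI[of _ l]) simp
    then have D: "D > 0" "\<phi> (int D) \<in> H" unfolding D_def by (metis (mono_tags, lifting) LeastI_ex)+
    have Dmult: "\<phi> (int D * int k) \<in> H" for k
    proof (induction k)
      case (Suc k)
      have "\<phi> (int D * int (Suc k)) = \<phi> (int D * int k) + \<phi> (int D)"
        by (simp add: cyc_add[OF \<phi>, symmetric] algebra_simps)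
      then show ?case using Suc D by (simp add: subgrp_add[OF sH(1)])
    qed (use cyc_0[OF \<phi>] H0 in simp)
    have "int D dvd x" if x: "x \<in> A \<union> B" for x
    proof -
      have x0: "x \<ge> 0" using x A(1) B(1) by auto
      then have "\<phi> (int D * int (nat (x div int D))) \<in> H" by (rule_tac Dmult)
      then have "\<phi> x - \<phi> (int D * (x div int D)) \<in> H" using AB[OF x] x0
        by (simp add: subgrp_diff[OF sH(1)] pos_imp_zdiv_nonneg_iff D(1))
      then have "\<phi> (x mod int D) \<in> H"
        by (simp add: cyc_diff[OF \<phi>, symmetric] minus_mult_div_eq_mod)
      moreover have "0 \<le> x mod int D" "x mod int D < int D" using D(1) by auto
      ultimately have "\<not> nat (x mod int D) > 0"
        using not_less_Least[of "nat (x mod int D)" "\<lambda>d. d > 0 \<and> \<phi> (int d) \<in> H"] unfolding D_def[symmetric]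
        by (auto simp: nat_less_iff)
      then have "x mod int D = 0" using \<open>0 \<le> x mod int D\<close> by simp
      then show ?thesis by blast
    qed
    then have "\<not> int D > 1" using gcd by blast
    then have "D = 1" using D by simp
    then show ?thesis using D by simp
  qed
  have "range \<phi> \<subseteq> S"
  proof -
    have "\<phi> (int k) \<in> S" for k
    proof (induction k)
      case 0
      have "(0::int) + 0 \<in> A + B" using A(2) B(2) by (rule set_plus_intro)
      then show ?case unfolding S_def by (metis add_0 image_eqI int_ops(1))
    next
      case (Suc k)
      then show ?case using one stab_add[of "\<phi> 1" S "\<phi> (int k)"] cyc_add[OF \<phi>, of 1 "int k"]
        by (simp add: H_def)
    qed
    then have "\<phi> a \<in> S" for a using cyc_mod[OF \<phi>, of a] l0
      by (metis Euclidean_Rings.pos_mod_sign nat_0_le of_nat_0_less_iff)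
    then show ?thesis by blast
  qed
  then have "l \<le> card S" using cyc_card_range[OF \<phi>] finS card_mono by metis
  then show L: "l + card B \<le> card (A + B)" using cardT by linarith
  obtain \<psi> :: "int \<Rightarrow> circ" where \<psi>: "cyc m \<psi>" using ex_cyc[OF m0] by blast
  have "card (\<psi> ` A) + card (\<psi> ` B) > m"
  proof -
    have "inj_on \<psi> (B - {int m})" using B(1) by (intro cyc_inj[OF \<psi>, of _ 0]) force
    then have "card B - 1 = card (\<psi> ` (B - {int m}))" using B(3) fin by (simp add: card_image)
    also have "\<dots> \<le> card (\<psi> ` B)" using fin by (intro card_mono) auto
    finally have 1: "card B \<le> card (\<psi> ` B) + 1" by simp
    \<comment> \<open>The bound on \<open>l\<close> limits how much of \<open>A\<close> can lie in
      \<open>{m..l}\<close>, so enough of it lies below \<open>m\<close>, where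
      \<open>\<psi>\<close> is injective.\<close>
    have "A \<subseteq> (A \<inter> {0..<int m}) \<union> {int m..int l}" using A(1) by auto
    then have "card A \<le> card ((A \<inter> {0..<int m}) \<union> {int m..int l})" by (intro card_mono) auto
    also have "\<dots> \<le> card (A \<inter> {0..<int m}) + card {int m..int l}" by (rule card_Un_le)
    also have "card {int m..int l} = l + 1 - m" using ml by simp
    finally have 2: "card A + m \<le> card (A \<inter> {0..<int m}) + l + 1" using ml by linarith
    have "inj_on \<psi> (A \<inter> {0..<int m})" by (intro cyc_inj[OF \<psi>, of _ 0]) auto
    then have "card (A \<inter> {0..<int m}) = card (\<psi> ` (A \<inter> {0..<int m}))" by (simp add: card_image)
    also have "\<dots> \<le> card (\<psi> ` A)" using fin by (intro card_mono) auto
    finally show ?thesis using 1 2 L small by linarith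
  qed
  then have "\<psi> ` A + \<psi> ` B = range \<psi>"
    using cyc_card_range[OF \<psi>] by (intro plus_eq_group cyc_subgrp[OF \<psi>]) auto
  then have "card (\<psi> ` (A + B)) = m" using cyc_card_range[OF \<psi>] cyc_image_plus[OF \<psi>] by metis
  moreover have "A \<subseteq> A + B" "a \<in> A \<Longrightarrow> a + int m \<in> A + B" for a
    using B(2,3) set_plus_intro[of _ A 0 B] by auto
  ultimately show "m + card A \<le> card (A + B)" using card_fibre_gain[OF \<psi> finT, of A] by simp
qed

text \<open>Translating both minima to 0 and dividing by the gcd of all differences reduces to
  \<open>three_k_normalized\<close>. The exact equations for the maxima are kept because they bound
  \<open>D * L\<close> by the length of any interval containing \<open>A\<close>; this later
  controls \<open>D\<close> itself.\<close>

theorem three_k_minus_four: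
  fixes A B :: "int set"
  assumes fin: "finite A" "finite B" and ne: "A \<noteq> {}" "B \<noteq> {}"
    and small: "card (A + B) + 4 \<le> card A + card B + min (card A) (card B)"
  obtains D :: int and L M :: nat where "D > 0"
    "A \<subseteq> (\<lambda>i. Min A + D * i) ` {0..int L}" "Max A = Min A + D * int L"
    "B \<subseteq> (\<lambda>i. Min B + D * i) ` {0..int M}" "Max B = Min B + D * int M"
    "L + card B \<le> card (A + B)" "M + card A \<le> card (A + B)"
proof -
  define a b where "a = Min A" and "b = Min B"
  define U where "U = (\<lambda>x. x - a) ` A \<union> (\<lambda>x. x - b) ` B"
  define D where "D = Gcd U"
  have card2: "card A \<ge> 2"
    using small card_le_set_plus[of A B] card_le_set_plus[of B A] fin ne by (auto simp: add.commute)
  have ab: "a \<in> A" "b \<in> B" "\<And>x. x \<in> A \<Longrightarrow> a \<le> x" "\<And>x. x \<in> B \<Longrightarrow> b \<le> x"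
    using fin ne by (auto simp: a_def b_def)
  have "D \<noteq> 0"
  proof
    assume "D = 0"
    then have "A \<subseteq> {a}" by (auto simp: D_def U_def)
    then show False using card2 card_mono[of "{a}" A] by simp
  qed
  then have D: "D > 0" by (simp add: D_def order_less_le)
  have Dd: "D dvd u" if "u \<in> U" for u using that by (simp add: D_def)
  define A' where "A' = (\<lambda>x. (x - a) div D) ` A"
  define B' where "B' = (\<lambda>x. (x - b) div D) ` B"
  have eqA: "a + D * ((x - a) div D) = x" if "x \<in> A" for x using Dd[of "x - a"] that by (simp add: U_def)
  have eqB: "b + D * ((x - b) div D) = x" if "x \<in> B" for x using Dd[of "x - b"] that by (simp add: U_def)
  have A: "A = (\<lambda>i. a + D * i) ` A'" unfolding A'_def image_image using eqA by simp
  have B: "B = (\<lambda>i. b + D * i) ` B'" unfolding B'_def image_image using eqB by simp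
  have cA: "card A = card A'" unfolding A using D by (simp add: card_image inj_on_def)
  have cB: "card B = card B'" unfolding B using D by (simp add: card_image inj_on_def)
  have AB: "A + B = (\<lambda>i. (a + b) + D * i) ` (A' + B')"
  proof (intro Set.set_eqI iffI)
    fix x assume "x \<in> A + B"
    then obtain i j where "i \<in> A'" "j \<in> B'" "x = (a + D * i) + (b + D * j)"
      unfolding A B by (auto elim!: set_plus_elim)
    then show "x \<in> (\<lambda>i. (a + b) + D * i) ` (A' + B')"
      by (intro image_eqI[of _ _ "i + j"]) (auto simp: algebra_simps intro: set_plus_intro)
  next
    fix x assume "x \<in> (\<lambda>i. (a + b) + D * i) ` (A' + B')"
    then obtain i j where "i \<in> A'" "j \<in> B'" "x = (a + b) + D * (i + j)" by (auto elim!: set_plus_elim)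
    moreover then have "x = (a + D * i) + (b + D * j)" by (simp add: algebra_simps)
    ultimately show "x \<in> A + B" unfolding A B by (auto intro!: set_plus_intro)
  qed
  have cAB: "card (A + B) = card (A' + B')" unfolding AB using D by (simp add: card_image inj_on_def)
  have fin': "finite A'" "finite B'" "A' \<noteq> {}" "B' \<noteq> {}" using fin ne by (auto simp: A'_def B'_def)
  have nn: "\<And>i. i \<in> A' \<Longrightarrow> i \<ge> 0" "\<And>i. i \<in> B' \<Longrightarrow> i \<ge> 0"
    using ab D by (auto simp: A'_def B'_def pos_imp_zdiv_nonneg_iff)
  have zero: "0 \<in> A'" "0 \<in> B'" using ab(1,2) by (force simp: A'_def, force simp: B'_def)
  define L M where "L = nat (Max A')" and "M = nat (Max B')"
  have LM: "int L = Max A'" "int M = Max B'" using Max_in fin' nn by (auto simp: L_def M_def)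
  have LA: "A' \<subseteq> {0..int L}" "int L \<in> A'" using nn fin' Max_in[of A'] by (auto simp: LM)
  have MB: "B' \<subseteq> {0..int M}" "int M \<in> B'" using nn fin' Max_in[of B'] by (auto simp: LM)
  have g: "\<exists>x\<in>A' \<union> B'. \<not> d dvd x" if d: "d > 1" for d
  proof (rule ccontr)
    assume "\<not> ?thesis"
    then have *: "\<And>x. x \<in> A' \<union> B' \<Longrightarrow> d dvd x" by blast
    have "D * d dvd u" if "u \<in> U" for u
    proof -
      have "\<exists>i\<in>A' \<union> B'. u = D * i" using that A B unfolding U_def by auto
      then show ?thesis using * by auto
    qed
    then have "D * d dvd D" unfolding D_def by (rule Gcd_greatest)
    then have "D * d dvd D * 1" by simp
    then have "d dvd 1" using D by (simp only: dvd_mult_cancel_left) auto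
    then show False using d by simp
  qed
  have sm: "card (A' + B') + 4 \<le> card A' + card B' + min (card A') (card B')"
    using small cA cB cAB by simp
  have "L + card B' \<le> card (A' + B') \<and> M + card A' \<le> card (A' + B')"
  proof (cases "M \<le> L")
    case True
    show ?thesis using three_k_normalized[OF LA(1) zero(1) LA(2) MB(1) zero(2) MB(2) True g sm] by blast
  next
    case False
    have "card (B' + A') + 4 \<le> card B' + card A' + min (card B') (card A')"
      using sm by (simp add: add.commute min.commute)
    from three_k_normalized[OF MB(1) zero(2) MB(2) LA(1) zero(1) LA(2) _ _ this] False g
    show ?thesis by (auto simp: add.commute Un_commute)
  qed
  then have fin_ineq: "L + card B \<le> card (A + B)" "M + card A \<le> card (A + B)" using cA cB cAB by auto
  have "Max A = a + D * int L"
  proof (rule Max_eqI[OF fin(1)])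
    show "a + D * int L \<in> A" unfolding A using LA by blast
    fix y assume "y \<in> A"
    then obtain i where "i \<in> A'" "y = a + D * i" unfolding A by blast
    then show "y \<le> a + D * int L" using LA D by (auto intro!: mult_left_mono)
  qed
  moreover have "Max B = b + D * int M"
  proof (rule Max_eqI[OF fin(2)])
    show "b + D * int M \<in> B" unfolding B using MB by blast
    fix y assume "y \<in> B"
    then obtain i where "i \<in> B'" "y = b + D * i" unfolding B by blast
    then show "y \<le> b + D * int M" using MB D by (auto intro!: mult_left_mono)
  qed
  moreover have "A \<subseteq> (\<lambda>i. a + D * i) ` {0..int L}" "B \<subseteq> (\<lambda>i. b + D * i) ` {0..int M}"
    using A B LA MB by blast+
  ultimately show ?thesis using that[OF D] fin_ineq unfolding a_def b_def by blast
qed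

section \<open>Dilations and integer windows in a cyclic group\<close>

lemma cyc_scale:
  assumes "cyc p \<psi>" "prime p" "\<not> int p dvd D"
  shows "cyc p (\<lambda>n. \<psi> (D * n))" "range (\<lambda>n. \<psi> (D * n)) = range \<psi>"
proof -
  have pr: "prime (int p)" using assms(2) by simp
  show c: "cyc p (\<lambda>n. \<psi> (D * n))"
    unfolding cyc_def using assms pr
    by (auto simp: distrib_left cyc_add cyc_0_iff prime_dvd_mult_iff cyc_pos)
  have "range (\<lambda>n. \<psi> (D * n)) \<subseteq> range \<psi>" by auto
  then show "range (\<lambda>n. \<psi> (D * n)) = range \<psi>"
    using cyc_card_range[OF c] cyc_card_range[OF assms(1)] by (metis card_subset_eq)
qed

text \<open>Used for windows with \<open>v - u < int p\<close>, where every element has at most one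
  lift.\<close>

definition pull :: "(int \<Rightarrow> 'a) \<Rightarrow> int \<Rightarrow> int \<Rightarrow> 'a set \<Rightarrow> int set" where
  "pull \<psi> u v Y = {n\<in>{u..v}. \<psi> n \<in> Y}"

lemma pull_image: "\<psi> ` pull \<psi> u v Y = Y \<inter> \<psi> ` {u..v}"
  by (auto simp: pull_def)

lemma pull_sub: "pull \<psi> u v Y \<subseteq> {u..v}" "finite (pull \<psi> u v Y)"
  by (auto simp: pull_def intro: finite_subset[of _ "{u..v}"])

lemma card_inj_window:
  assumes "cyc p \<psi>" "X \<subseteq> {u..v}" "v - u < int p" shows "card (\<psi> ` X) = card X"
  using cyc_inj[OF assms(1), of X u] assms(2,3) by (intro card_image) force

text \<open>Nothing wraps around: the sums of the windows stay in an interval of at most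
  \<open>p\<close> integers. The pair can therefore be treated as a pair of sets of integers (a
  Freiman isomorphism).\<close>

lemma pull_plus_card:
  assumes "cyc p \<psi>" "A \<subseteq> {u..v}" "B \<subseteq> {s..t}" "(v - u) + (t - s) < int p"
  shows "card (\<psi> ` A + \<psi> ` B) = card (A + B)"
proof -
  have "A + B \<subseteq> {u + s..v + t}" using assms(2,3) by (fastforce elim!: set_plus_elim)
  then show ?thesis using card_inj_window[OF assms(1), of "A + B" "u + s" "v + t"] assms(4)
    by (simp add: cyc_image_plus[OF assms(1)])
qed

text \<open>
  The intervals \<open>I\<close>, \<open>J\<close> of lengths \<open>L + 1\<close>, \<open>M + 1\<close> cover \<open>Y2\<close>, \<open>Z2\<close>, and by \<open>stuck\<close> the first one cannot be
  prolonged to any further element of \<open>Y\<close>. Then every \<open>n \<in> Y - Y2\<close> is so far from \<open>I\<close> that \<open>n + J\<close> contains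
  the whole complement of \<open>I + J\<close>, and the corresponding part \<open>K n\<close> of \<open>J\<close> is almost free of \<open>Z2\<close>; two
  extreme choices of \<open>n\<close> give a long gap in \<open>Z2\<close>.
\<close>

lemma gap_bound:
  assumes cyc: "cyc p \<psi>" and YZ: "finite Y" "finite Z" "Y \<subseteq> range \<psi>"
    and Y2: "Y2 = Y \<inter> \<psi> ` {\<alpha>..\<alpha> + int L}" and Z2: "Z2 = Z \<inter> \<psi> ` {\<beta>..\<beta> + int M}"
    and LM: "L + M < p" and ne: "Y \<noteq> Y2"
    and stuck: "\<And>u v. v - u + int M < int p \<Longrightarrow> {\<alpha>..\<alpha> + int L} \<subseteq> {u..v} \<Longrightarrow> Y \<inter> \<psi> ` {u..v} \<subseteq> Y2"
  shows "int (card Z2) + (int p - 1 - L - M) + min (int p - 1 - L - M) (int (card Y) - card Y2 - 1)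
     \<le> M + 1 + 2 * (int (card (Y + Z)) - card (Y2 + Z2))"
proof -
  define N where "N = pull \<psi> (\<alpha> + L + 1) (\<alpha> + p - 1) Y"
  \<comment> \<open>\<open>c\<close> is the number of residues outside \<open>I + J\<close>;
    \<open>\<epsilon>\<close> counts the sums lost on passing to \<open>Y2\<close> and
    \<open>Z2\<close>.\<close>
  define c where "c = int p - 1 - L - M"
  define \<epsilon> where "\<epsilon> = int (card (Y + Z)) - card (Y2 + Z2)"
  define Zt where "Zt = pull \<psi> \<beta> (\<beta> + M) Z"
  have finYZ: "finite (Y + Z)" using YZ by (simp add: finite_set_plus)
  have sub: "Y2 + Z2 \<subseteq> Y + Z" unfolding Y2 Z2 by (rule set_plus_mono2) auto
  have finN: "finite N" unfolding N_def by (rule pull_sub)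
  have "Y - Y2 \<subseteq> \<psi> ` N"
  proof
    fix y assume y: "y \<in> Y - Y2"
    then obtain n where n: "y = \<psi> n" "n \<in> {\<alpha>..<\<alpha> + int p}" using YZ(3) cyc_range[OF cyc, of \<alpha>] by auto
    then have "n \<notin> {\<alpha>..\<alpha> + int L}" using y Y2 by auto
    then show "y \<in> \<psi> ` N" using n y by (auto simp: N_def pull_def)
  qed
  then have "card (Y - Y2) \<le> card N" using finN by (meson surj_card_le)
  moreover have "Y2 \<subseteq> Y" "finite Y2" using Y2 YZ by auto
  ultimately have cN: "int (card Y) - card Y2 \<le> card N" by (simp add: card_Diff_subset)
  have "Y - Y2 \<noteq> {}" using ne \<open>Y2 \<subseteq> Y\<close> by blast
  then have neN: "N \<noteq> {}" using \<open>Y - Y2 \<subseteq> \<psi> ` N\<close> by blast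
  have Nout: "\<psi> n \<notin> Y2" if "n \<in> N" for n
  proof
    assume "\<psi> n \<in> Y2"
    then obtain i where i: "i \<in> {\<alpha>..\<alpha> + int L}" "\<psi> n = \<psi> i" unfolding Y2 by auto
    then have "int p dvd n - i" using cyc by (simp add: cyc_eq_iff)
    moreover have "0 < n - i" "n - i < int p" using that i by (auto simp: N_def pull_def)
    ultimately show False by (simp add: zdvd_not_zless)
  qed
  have Npos: "\<alpha> + p - M \<le> n \<and> n \<le> \<alpha> + L + M" if n: "n \<in> N" for n
  proof (intro conjI; rule ccontr)
    have r: "\<alpha> + L + 1 \<le> n" "n \<le> \<alpha> + p - 1" "\<psi> n \<in> Y" using n by (auto simp: N_def pull_def)
    {
      assume "\<not> \<alpha> + p - M \<le> n"
      then have "Y \<inter> \<psi> ` {\<alpha>..n} \<subseteq> Y2" using r by (intro stuck) auto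
      moreover have "\<psi> n \<in> \<psi> ` {\<alpha>..n}" using r by (intro imageI) simp
      ultimately show False using r Nout[OF n] by blast
    next
      assume "\<not> n \<le> \<alpha> + L + M"
      then have "Y \<inter> \<psi> ` {n - p..\<alpha> + int L} \<subseteq> Y2" using r by (intro stuck) auto
      moreover have "\<psi> (n - p) \<in> \<psi> ` {n - p..\<alpha> + int L}" using r by (intro imageI) simp
      moreover have "\<psi> (n - p) = \<psi> n" using cyc by (simp add: cyc_eq_iff)
      ultimately show False using r Nout[OF n] by auto
    }
  qed
  \<comment> \<open>\<open>n + K n\<close> is exactly the complement of \<open>I + J\<close>, so
    every element of \<open>Zt\<close> in \<open>K n\<close> yields a sum that is counted by
    \<open>\<epsilon>\<close>.\<close>
  define K where "K = (\<lambda>n. {\<alpha> + \<beta> + L + M + 1 - n..\<alpha> + \<beta> + p - 1 - n})"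
  have Ksub: "K n \<subseteq> {\<beta>..\<beta> + M}" if "n \<in> N" for n using Npos[OF that] by (auto simp: K_def)
  have Kc: "int (card (K n)) = c" for n using LM by (simp add: K_def c_def)
  have few: "int (card (Zt \<inter> K n)) \<le> \<epsilon>" if n: "n \<in> N" for n
  proof -
    have "\<psi> ` ((+) n ` (Zt \<inter> K n)) \<subseteq> Y + Z - (Y2 + Z2)"
    proof (rule subsetI, elim imageE)
      fix x y z assume *: "x = \<psi> y" "y = n + z" "z \<in> Zt \<inter> K n"
      then have "x \<in> Y + Z" using n by (auto simp: cyc_add[OF cyc] Zt_def N_def pull_def intro: set_plus_intro)
      moreover have "x \<notin> Y2 + Z2"
      proof
        assume "x \<in> Y2 + Z2"
        then obtain i j where ij: "i \<in> {\<alpha>..\<alpha> + int L}" "j \<in> {\<beta>..\<beta> + int M}" "x = \<psi> i + \<psi> j"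
          unfolding Y2 Z2 by (auto elim!: set_plus_elim)
        then have "\<psi> y = \<psi> (i + j)" using * cyc_add[OF cyc] by simp
        then have "int p dvd y - (i + j)" using cyc by (simp add: cyc_eq_iff)
        moreover have "0 < y - (i + j)" "y - (i + j) < int p" using * ij by (auto simp: K_def)
        ultimately show False by (simp add: zdvd_not_zless)
      qed
      ultimately show "x \<in> Y + Z - (Y2 + Z2)" by simp
    qed
    then have "card (\<psi> ` ((+) n ` (Zt \<inter> K n))) \<le> card (Y + Z - (Y2 + Z2))"
      using finYZ by (intro card_mono) auto
    moreover have "card (\<psi> ` ((+) n ` (Zt \<inter> K n))) = card (Zt \<inter> K n)"
    proof -
      have "(+) n ` (Zt \<inter> K n) \<subseteq> {\<alpha> + \<beta> + L + M + 1..\<alpha> + \<beta> + p - 1}" by (auto simp: K_def)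
      then have "card (\<psi> ` ((+) n ` (Zt \<inter> K n))) = card ((+) n ` (Zt \<inter> K n))"
        by (rule card_inj_window[OF cyc]) (use LM in auto)
      then show ?thesis by (simp add: card_image)
    qed
    moreover have "int (card (Y + Z - (Y2 + Z2))) = \<epsilon>"
      using sub finYZ by (simp add: \<epsilon>_def card_Diff_subset finite_subset card_mono of_nat_diff)
    ultimately show ?thesis by simp
  qed
  define n1 n2 where "n1 = Min N" and "n2 = Max N"
  have n12: "n1 \<in> N" "n2 \<in> N" using finN neN by (auto simp: n1_def n2_def)
  have "N \<subseteq> {n1..n2}" using finN by (auto simp: n1_def n2_def)
  then have "card N \<le> card {n1..n2}" by (intro card_mono) auto
  then have spread: "int (card N) - 1 \<le> n2 - n1" using neN finN by (cases "n1 \<le> n2 + 1") (auto simp: card_gt_0_iff)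
  define W where "W = K n1 \<union> K n2"
  have W: "W \<subseteq> {\<beta>..\<beta> + M}" using Ksub n12 by (auto simp: W_def)
  have finW: "finite W" using W finite_subset by blast
  \<comment> \<open>Moving \<open>n\<close> moves \<open>K n\<close> by the same amount; the two
    extreme choices differ by at least \<open>card N - 1\<close>, which produces the minimum in the
    conclusion.\<close>
  have cW: "c + min c (n2 - n1) \<le> int (card W)"
  proof -
    have "K n1 \<inter> K n2 \<subseteq> {\<alpha> + \<beta> + L + M + 1 - n1..\<alpha> + \<beta> + p - 1 - n2}" by (auto simp: K_def)
    then have "card (K n1 \<inter> K n2) \<le> card {\<alpha> + \<beta> + L + M + 1 - n1..\<alpha> + \<beta> + p - 1 - n2}"
      by (intro card_mono) auto
    then have "int (card (K n1 \<inter> K n2)) \<le> max 0 (c - (n2 - n1))" by (auto simp: c_def)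
    moreover have "card (K n1) + card (K n2) = card W + card (K n1 \<inter> K n2)"
      unfolding W_def by (rule card_Un_Int) (auto simp: K_def)
    ultimately show ?thesis using Kc[of n1] Kc[of n2] by linarith
  qed
  have "int (card (Zt \<inter> W)) \<le> 2 * \<epsilon>"
  proof -
    have "Zt \<inter> W = (Zt \<inter> K n1) \<union> (Zt \<inter> K n2)" by (auto simp: W_def)
    then have "card (Zt \<inter> W) \<le> card (Zt \<inter> K n1) + card (Zt \<inter> K n2)" by (simp add: card_Un_le)
    then show ?thesis using few[OF n12(1)] few[OF n12(2)] by linarith
  qed
  moreover have "card Zt \<le> card (Zt \<inter> W) + card ({\<beta>..\<beta> + M} - W)"
  proof -
    have "Zt \<subseteq> (Zt \<inter> W) \<union> ({\<beta>..\<beta> + M} - W)" by (auto simp: Zt_def pull_def)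
    then have "card Zt \<le> card ((Zt \<inter> W) \<union> ({\<beta>..\<beta> + M} - W))" using finW by (intro card_mono) auto
    then show ?thesis using card_Un_le order_trans by blast
  qed
  moreover have "int (card ({\<beta>..\<beta> + M} - W)) = M + 1 - int (card W)"
    using W finW card_mono[OF _ W] by (simp add: card_Diff_subset of_nat_diff)
  moreover have "card Z2 \<le> card Zt"
    unfolding Z2 Zt_def pull_image[symmetric] by (rule card_image_le) (rule pull_sub)
  ultimately show ?thesis using cW spread cN unfolding c_def \<epsilon>_def by linarith
qed

section \<open>Progressions modulo a prime\<close>

text \<open>Among all dilations and pairs of windows of total length below \<open>p\<close> that
  contain \<open>Y1\<close> and \<open>Z1\<close>, one capturing most of \<open>Y\<close> and
  \<open>Z\<close> is fixed. Condition \<open>i\<close> lets the 3k-4 theorem act on the captured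
  parts, and dilating by its difference gives short windows. These are again admissible, so no
  prolongation captures anything new, which is the hypothesis \<open>stuck\<close> of
  \<open>gap_bound\<close>. Condition \<open>ii\<close> excludes the resulting gap.\<close>

lemma rectified_pair:
  fixes Y Z :: "'a::ab_group_add set"
  assumes cyc: "cyc p \<psi>" and pr: "prime p" and YZ: "Y \<subseteq> range \<psi>" "Z \<subseteq> range \<psi>"
    and card: "int (card (Y + Z)) = int (card Y) + int (card Z) + r" and r: "r \<ge> -1"
    and p: "int p = int (card Y) + int (card Z) + r + x"
    and I: "u \<le> v" "s \<le> t" "(v - u) + (t - s) < int p"
    and Y1: "Y1 = Y \<inter> \<psi> ` {u..v}" and Z1: "Z1 = Z \<inter> \<psi> ` {s..t}"
    and lossd: "loss = int (card Y) + int (card Z) - int (card Y1) - int (card Z1)"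
    and i: "loss + r + 4 \<le> int (card Y1)" "loss + r + 4 \<le> int (card Z1)"
    and ii: "2 * x > 3 * loss + 4 * r + 6"
  obtains \<psi>' :: "int \<Rightarrow> 'a" and a b :: int where "cyc p \<psi>'" "range \<psi>' = range \<psi>"
    "Y \<subseteq> \<psi>' ` {a..b}" "b - a \<le> int (card Y) + r"
proof -
  have fin: "finite Y" "finite Z" using YZ cyc_card_range[OF cyc] finite_subset by auto
  define val where "val = (\<lambda>(\<psi>' :: int \<Rightarrow> 'a, u', v', s', t').
    card (Y \<inter> \<psi>' ` {u'..v'}) + card (Z \<inter> \<psi>' ` {s'..t'}))"
  define ok where "ok = (\<lambda>(\<psi>' :: int \<Rightarrow> 'a, u', v', s', t').
     cyc p \<psi>' \<and> range \<psi>' = range \<psi> \<and> u' \<le> v' \<and> s' \<le> t' \<and> (v' - u') + (t' - s') < int p \<and>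
     Y1 \<subseteq> \<psi>' ` {u'..v'} \<and> Z1 \<subseteq> \<psi>' ` {s'..t'})"
  have "ok (\<psi>, u, v, s, t)" using cyc I Y1 Z1 by (auto simp: ok_def)
  moreover have "val w \<le> card Y + card Z" for w
    unfolding val_def using fin by (auto split: prod.split intro!: add_mono card_mono)
  ultimately obtain w where w: "ok w" and wmax: "\<And>w'. ok w' \<Longrightarrow> val w' \<le> val w"
    using ex_has_greatest_nat[of ok _ val "card Y + card Z + 1"] by (metis less_Suc_eq_le Suc_eq_plus1)
  obtain \<psi>0 u0 v0 s0 t0 where wd: "w = (\<psi>0, u0, v0, s0, t0)" by (metis prod_cases5)
  have w': "cyc p \<psi>0" "range \<psi>0 = range \<psi>" "u0 \<le> v0" "s0 \<le> t0" "(v0 - u0) + (t0 - s0) < int p"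
    "Y1 \<subseteq> \<psi>0 ` {u0..v0}" "Z1 \<subseteq> \<psi>0 ` {s0..t0}" using w unfolding wd ok_def by auto
  define Y2 where "Y2 = Y \<inter> \<psi>0 ` {u0..v0}"
  define Z2 where "Z2 = Z \<inter> \<psi>0 ` {s0..t0}"
  define Yt where "Yt = pull \<psi>0 u0 v0 Y"
  define Zt where "Zt = pull \<psi>0 s0 t0 Z"
  have im: "\<psi>0 ` Yt = Y2" "\<psi>0 ` Zt = Z2" by (auto simp: Yt_def Zt_def Y2_def Z2_def pull_image)
  have subt: "Yt \<subseteq> {u0..v0}" "Zt \<subseteq> {s0..t0}" "finite Yt" "finite Zt" by (auto simp: Yt_def Zt_def pull_sub)
  have ct: "card Y2 = card Yt" "card Z2 = card Zt"
    using card_inj_window[OF w'(1) subt(1)] card_inj_window[OF w'(1) subt(2)] w'(3,4,5) im by auto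
  have cs: "card (Y2 + Z2) = card (Yt + Zt)"
    using pull_plus_card[OF w'(1) subt(1,2) w'(5)] im by simp
  have sub1: "Y1 \<subseteq> Y2" "Z1 \<subseteq> Z2" using w'(6,7) Y1 Z1 by (auto simp: Y2_def Z2_def)
  have fin2: "finite Y2" "finite Z2" using fin by (auto simp: Y2_def Z2_def)
  have le1: "card Y1 \<le> card Y2" "card Z1 \<le> card Z2" using sub1 fin2 by (auto intro: card_mono)
  have le2: "card Y2 \<le> card Y" "card Z2 \<le> card Z" using fin by (auto simp: Y2_def Z2_def intro: card_mono)
  have "Y2 + Z2 \<subseteq> Y + Z" by (rule set_plus_mono2) (auto simp: Y2_def Z2_def)
  then have sle: "card (Y2 + Z2) \<le> card (Y + Z)" using fin by (intro card_mono finite_set_plus)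
  have l0: "loss \<ge> 0" using lossd le1 le2 by linarith
  have c3: "card Yt \<ge> 3" "card Zt \<ge> 3" using i r l0 le1 ct by linarith+
  then have net: "Yt \<noteq> {}" "Zt \<noteq> {}" by auto
  \<comment> \<open>The captured parts have at most \<open>card (Y + Z)\<close> sums, that is, an
    excess of at most \<open>loss + r\<close> over their own sizes; \<open>i\<close> says that each
    part exceeds this by 4.\<close>
  have small: "card (Yt + Zt) + 4 \<le> card Yt + card Zt + min (card Yt) (card Zt)"
    using sle cs ct card lossd i le1 le2 by linarith
  obtain D L M where D: "D > 0"
    "Yt \<subseteq> (\<lambda>i. Min Yt + D * i) ` {0..int L}" "Max Yt = Min Yt + D * int L"
    "Zt \<subseteq> (\<lambda>i. Min Zt + D * i) ` {0..int M}" "Max Zt = Min Zt + D * int M"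
    "L + card Zt \<le> card (Yt + Zt)" "M + card Yt \<le> card (Yt + Zt)"
    using three_k_minus_four[OF subt(3,4) net small] by metis
  have "Max Yt \<in> Yt" "Min Yt \<in> Yt" "Max Zt \<in> Zt" "Min Zt \<in> Zt" using subt net by auto
  then have "Max Yt \<in> {u0..v0}" "Min Yt \<in> {u0..v0}" "Max Zt \<in> {s0..t0}" "Min Zt \<in> {s0..t0}"
    using subt(1,2) by blast+
  then have ext: "D * int L \<le> v0 - u0" "D * int M \<le> t0 - s0" using D(3,5) by simp_all
  have L1: "L \<ge> 1"
  proof (rule ccontr)
    assume "\<not> L \<ge> 1"
    then have "Yt \<subseteq> {Min Yt}" using D(2) by auto
    then show False using c3 card_mono[of "{Min Yt}" Yt] by simp
  qed
  have LM: "int L \<le> v0 - u0" "int M \<le> t0 - s0"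
    using ext D(1) mult_right_mono[of 1 D "int L"] mult_right_mono[of 1 D "int M"] by auto
  \<comment> \<open>Since \<open>L \<ge> 1\<close>, \<open>D\<close> is at most the length of a
    window, hence below \<open>p\<close>; so it is invertible modulo \<open>p\<close> and can be
    absorbed into the dilation.\<close>
  have "D * 1 \<le> D * int L" using D(1) L1 by (intro mult_left_mono) auto
  then have "D < int p" using ext(1) w'(4,5) by linarith
  then have nD: "\<not> int p dvd D" using D(1) zdvd_not_zless by blast
  define \<psi>1 where "\<psi>1 = (\<lambda>n. \<psi>0 (D * n))"
  have \<psi>1: "cyc p \<psi>1" "range \<psi>1 = range \<psi>" using cyc_scale[OF w'(1) pr nD] w'(2) by (auto simp: \<psi>1_def)
  obtain \<alpha> where \<alpha>: "\<psi>0 (Min Yt) = \<psi>1 \<alpha>" using \<psi>1(2) w'(2) by (metis rangeE rangeI)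
  obtain \<beta> where \<beta>: "\<psi>0 (Min Zt) = \<psi>1 \<beta>" using \<psi>1(2) w'(2) by (metis rangeE rangeI)
  have YI: "Y2 \<subseteq> \<psi>1 ` {\<alpha>..\<alpha> + int L}"
  proof
    fix y assume "y \<in> Y2"
    then obtain i where i: "i \<in> {0..int L}" "y = \<psi>0 (Min Yt + D * i)" using im D(2) by auto
    then have "y = \<psi>1 \<alpha> + \<psi>1 i" using \<alpha> cyc_add[OF w'(1)] by (simp add: \<psi>1_def)
    then have "y = \<psi>1 (\<alpha> + i)" using cyc_add[OF \<psi>1(1)] by simp
    then show "y \<in> \<psi>1 ` {\<alpha>..\<alpha> + int L}" using i by auto
  qed
  have ZI: "Z2 \<subseteq> \<psi>1 ` {\<beta>..\<beta> + int M}"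
  proof
    fix y assume "y \<in> Z2"
    then obtain i where i: "i \<in> {0..int M}" "y = \<psi>0 (Min Zt + D * i)" using im D(4) by auto
    then have "y = \<psi>1 \<beta> + \<psi>1 i" using \<beta> cyc_add[OF w'(1)] by (simp add: \<psi>1_def)
    then have "y = \<psi>1 (\<beta> + i)" using cyc_add[OF \<psi>1(1)] by simp
    then show "y \<in> \<psi>1 ` {\<beta>..\<beta> + int M}" using i by auto
  qed
  have vw: "val w = card Y2 + card Z2" by (simp add: val_def wd Y2_def Z2_def)
  have LMp: "int L + int M < int p" using LM w'(5) by linarith
  have top: "card (Y \<inter> \<psi>1 ` {u'..v'}) + card (Z \<inter> \<psi>1 ` {s'..t'}) \<le> card Y2 + card Z2"
    if "{\<alpha>..\<alpha> + int L} \<subseteq> {u'..v'}" "{\<beta>..\<beta> + int M} \<subseteq> {s'..t'}" "(v' - u') + (t' - s') < int p" for u' v' s' t'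
  proof -
    have "\<psi>1 ` {\<alpha>..\<alpha> + int L} \<subseteq> \<psi>1 ` {u'..v'}" "\<psi>1 ` {\<beta>..\<beta> + int M} \<subseteq> \<psi>1 ` {s'..t'}"
      using that by (auto intro!: image_mono)
    then have "Y1 \<subseteq> \<psi>1 ` {u'..v'}" "Z1 \<subseteq> \<psi>1 ` {s'..t'}" using sub1 YI ZI by (meson order_trans)+
    moreover have "u' \<le> v'" "s' \<le> t'" using that(1,2) by auto
    ultimately have "ok (\<psi>1, u', v', s', t')" using \<psi>1 that(3) by (simp add: ok_def)
    then show ?thesis using wmax vw by (fastforce simp: val_def)
  qed
  have stuckY: "Y \<inter> \<psi>1 ` {u'..v'} \<subseteq> Y2" if "v' - u' + int M < int p" "{\<alpha>..\<alpha> + int L} \<subseteq> {u'..v'}" for u' v'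
  proof -
    have "Y2 \<subseteq> Y \<inter> \<psi>1 ` {u'..v'}" using YI image_mono[OF that(2), of \<psi>1] by (auto simp: Y2_def)
    moreover have "Z2 \<subseteq> Z \<inter> \<psi>1 ` {\<beta>..\<beta> + int M}" using ZI by (auto simp: Z2_def)
    then have "card Z2 \<le> card (Z \<inter> \<psi>1 ` {\<beta>..\<beta> + int M})" using fin by (intro card_mono) auto
    then have "card (Y \<inter> \<psi>1 ` {u'..v'}) \<le> card Y2" using top[OF that(2), of \<beta> "\<beta> + int M"] that by simp
    ultimately show ?thesis using fin by (metis card_seteq finite_Int subset_refl)
  qed
  have stuckZ: "Z \<inter> \<psi>1 ` {u'..v'} \<subseteq> Z2" if "v' - u' + int L < int p" "{\<beta>..\<beta> + int M} \<subseteq> {u'..v'}" for u' v'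
  proof -
    have "Z2 \<subseteq> Z \<inter> \<psi>1 ` {u'..v'}" using ZI image_mono[OF that(2), of \<psi>1] by (auto simp: Z2_def)
    moreover have "Y2 \<subseteq> Y \<inter> \<psi>1 ` {\<alpha>..\<alpha> + int L}" using YI by (auto simp: Y2_def)
    then have "card Y2 \<le> card (Y \<inter> \<psi>1 ` {\<alpha>..\<alpha> + int L})" using fin by (intro card_mono) auto
    then have "card (Z \<inter> \<psi>1 ` {u'..v'}) \<le> card Z2" using top[OF _ that(2), of \<alpha> "\<alpha> + int L"] that by simp
    ultimately show ?thesis using fin by (metis card_seteq finite_Int subset_refl)
  qed
  have Y2e: "Y2 = Y \<inter> \<psi>1 ` {\<alpha>..\<alpha> + int L}" using stuckY[of "\<alpha> + int L" \<alpha>] LMp YI by (auto simp: Y2_def)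
  have Z2e: "Z2 = Z \<inter> \<psi>1 ` {\<beta>..\<beta> + int M}" using stuckZ[of "\<beta> + int M" \<beta>] LMp ZI by (auto simp: Z2_def)
  have Lb: "int L + int (card Z2) \<le> card (Y2 + Z2)" "int M + int (card Y2) \<le> card (Y2 + Z2)"
    using D(6,7) cs ct by linarith+
  have YZr: "Y \<subseteq> range \<psi>1" "Z \<subseteq> range \<psi>1" using YZ \<psi>1(2) by auto
  have gY: "int (card Z2) + (int p - 1 - L - M) + min (int p - 1 - L - M) (int (card Y) - card Y2 - 1)
     \<le> int M + 1 + 2 * int (card (Y + Z)) - 2 * int (card (Y2 + Z2))" if "Y \<noteq> Y2"
    using gap_bound[OF \<psi>1(1) fin YZr(1) Y2e Z2e _ that stuckY] LMp unfolding right_diff_distrib by simp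
  have gZ: "int (card Y2) + (int p - 1 - M - L) + min (int p - 1 - M - L) (int (card Z) - card Z2 - 1)
     \<le> int L + 1 + 2 * int (card (Y + Z)) - 2 * int (card (Y2 + Z2))" if "Z \<noteq> Z2"
    using gap_bound[OF \<psi>1(1) fin(2,1) YZr(2) Z2e Y2e _ that stuckZ] LMp
    unfolding right_diff_distrib by (simp add: add.commute)
  have "card Y = card Y2 \<and> card Z = card Z2"
  proof (rule ccontr)
    assume neq: "\<not> ?thesis"
    show False
    \<comment> \<open>The set with more missed elements is used. If dY >= dZ are the numbers missed,
      the gap bound yields x <= dY + 2 dZ + 2 r + 3 or 2 x <= 3 (dY + dZ) + 3 r + 3, according to
      the value of the minimum. Both contradict \<open>ii\<close>, as dY + dZ <= loss and r >=
      -1.\<close>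
    proof (cases "int (card Z) - card Z2 \<le> int (card Y) - card Y2")
      case True
      then have "Y \<noteq> Y2" using neq le2 by auto
      from gY[OF this] show False
        using Lb p card ii lossd le1 le2 True sle r l0 by linarith
    next
      case False
      then have "Z \<noteq> Z2" using le2 by auto
      from gZ[OF this] show False
        using Lb p card ii lossd le1 le2 False sle r l0 by linarith
    qed
  qed
  moreover have "Y2 \<subseteq> Y" "Z2 \<subseteq> Z" by (auto simp: Y2_def Z2_def)
  ultimately have "Y2 = Y" "Z2 = Z" using fin by (metis card_subset_eq)+
  then have "Y \<subseteq> \<psi>1 ` {\<alpha>..\<alpha> + int L}" "\<alpha> + int L - \<alpha> \<le> int (card Y) + r" using YI Lb(1) card by auto
  then show ?thesis using that \<psi>1 by blast
qed

text \<open>A difference of at least 2 would stretch \<open>A\<close> over a length of at least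
  \<open>2 * (card A - 1)\<close>, more than its interval allows. So the progression around
  \<open>B\<close> is an interval.\<close>

lemma three_k_minus_four_dense:
  fixes A B :: "int set"
  assumes fin: "finite A" "finite B" and ne: "A \<noteq> {}" "B \<noteq> {}"
    and small: "card (A + B) + 4 \<le> card A + card B + min (card A) (card B)"
    and A: "A \<subseteq> {u..v}" "v - u + 2 < 2 * int (card A)"
  obtains b where "B \<subseteq> {b..b + int (card (A + B)) - int (card A)}"
proof -
  obtain D L M where D: "D > 0"
    "A \<subseteq> (\<lambda>i. Min A + D * i) ` {0..int L}" "Max A = Min A + D * int L"
    "B \<subseteq> (\<lambda>i. Min B + D * i) ` {0..int M}"
    "M + card A \<le> card (A + B)"
    using three_k_minus_four[OF fin ne small] by metis
  have "Max A \<in> A" "Min A \<in> A" using fin ne by auto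
  then have "Max A \<in> {u..v}" "Min A \<in> {u..v}" using A(1) by blast+
  then have ext: "D * int L \<le> v - u" using D(3) by simp
  have "card A \<le> card ((\<lambda>i. Min A + D * i) ` {0..int L})" using D(2) by (intro card_mono) auto
  also have "\<dots> \<le> card {0..int L}" by (rule card_image_le) simp
  finally have "card A \<le> L + 1" by simp
  have "D = 1"
  proof (rule ccontr)
    assume "D \<noteq> 1"
    then have "2 * int L \<le> D * int L" using D(1) by (intro mult_right_mono) auto
    then show False using ext A(2) \<open>card A \<le> L + 1\<close> by linarith
  qed
  then have "B \<subseteq> {Min B..Min B + int (card (A + B)) - int (card A)}" using D(4,5) by auto
  then show ?thesis using that by blast
qed

text \<open>\<open>Z\<close> avoids \<open>w - Y\<close> for any \<open>w\<close> outside
  \<open>Y + Z\<close>. As \<open>Y\<close> nearly fills its interval, almost all of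
  \<open>Z\<close> lies in the complementary window, where nothing wraps around and the 3k-4 theorem
  applies; the remaining elements are then shown to be close, and the theorem is applied again to
  all of \<open>Z\<close>.\<close>

lemma cover_extend:
  fixes Y Z :: "'a::ab_group_add set"
  assumes cyc: "cyc p \<psi>" and Y: "Y \<subseteq> \<psi> ` {u..v}" "v - u \<le> int (card Y) + r" and Z: "Z \<subseteq> range \<psi>"
    and card: "int (card (Y + Z)) \<le> int (card Y) + int (card Z) + r" and r: "r \<ge> -1"
    and p: "int p = int (card Y) + int (card Z) + r + x"
    and big: "int (card Y) \<ge> 9 * r + 27" "int (card Z) \<ge> 9 * r + 27" "x \<ge> 9 * r + 27"
  obtains a b where "Z \<subseteq> \<psi> ` {a..b}" "b - a \<le> int (card Z) + r"
proof -
  have finY: "finite Y" using Y(1) finite_subset by blast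
  have finZ: "finite Z" using Z cyc_card_range[OF cyc] finite_subset by auto
  have fin: "finite (Y + Z)" using finY finZ by (rule finite_set_plus)
  define Yt where "Yt = pull \<psi> u v Y"
  have imY: "\<psi> ` Yt = Y" using Y(1) by (auto simp: Yt_def pull_image)
  have subY: "Yt \<subseteq> {u..v}" "finite Yt" by (auto simp: Yt_def pull_sub)
  have vup: "v - u < int p" using Y(2) p big(2,3) r by linarith
  have cY: "card Yt = card Y" using card_inj_window[OF cyc subY(1) vup] imY by simp
  have neY: "Yt \<noteq> {}" using big r cY by auto
  have vu: "int (card Y) \<le> v - u + 1"
  proof -
    have "card Yt \<le> card {u..v}" using subY by (intro card_mono) auto
    then show ?thesis using cY big r by simp
  qed
  have "card (Y + Z) < card (range \<psi>)" using cyc_card_range[OF cyc] card p big r by linarith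
  then have "\<not> range \<psi> \<subseteq> Y + Z" using card_mono[OF fin, of "range \<psi>"] by linarith
  then obtain w where w: "\<psi> w \<notin> Y + Z" by blast
  define Zt where "Zt = pull \<psi> (w - u + 1) (w - v + p - 1) Z"
  have subZ: "Zt \<subseteq> {w - u + 1..w - v + p - 1}" "finite Zt" by (auto simp: Zt_def pull_sub)
  have cZ: "card (\<psi> ` Zt) = card Zt" by (rule card_inj_window[OF cyc subZ(1)]) (use vu big r in linarith)
  have imZ: "\<psi> ` Zt \<subseteq> Z" by (auto simp: Zt_def pull_def)
  have loss: "int (card Z) - card Zt \<le> r + 1"
  proof -
    have "Z - \<psi> ` Zt \<subseteq> \<psi> ` ({w - v..w - u} - (\<lambda>i. w - i) ` Yt)"
    proof
      fix z assume z: "z \<in> Z - \<psi> ` Zt"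
      then obtain n where n: "z = \<psi> n" "n \<in> {w - v..<w - v + int p}" using Z cyc_range[OF cyc, of "w - v"] by auto
      then have "n \<notin> Zt" using z by auto
      then have "n \<le> w - u" using n z by (auto simp: Zt_def pull_def)
      moreover have "n \<notin> (\<lambda>i. w - i) ` Yt"
      proof
        assume "n \<in> (\<lambda>i. w - i) ` Yt"
        then obtain i where i: "i \<in> Yt" "n = w - i" by blast
        then have "\<psi> i + \<psi> n \<in> Y + Z" using z n imY by (intro set_plus_intro) auto
        then show False using w i by (simp add: cyc_add[OF cyc, symmetric])
      qed
      ultimately show "z \<in> \<psi> ` ({w - v..w - u} - (\<lambda>i. w - i) ` Yt)" using n by auto
    qed
    then have "card (Z - \<psi> ` Zt) \<le> card ({w - v..w - u} - (\<lambda>i. w - i) ` Yt)"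
      by (meson finite_Diff finite_atLeastAtMost_int surj_card_le)
    also have "\<dots> = card {w - v..w - u} - card ((\<lambda>i. w - i) ` Yt)"
      using subY by (intro card_Diff_subset) auto
    also have "card ((\<lambda>i. w - i) ` Yt) = card Y" using cY by (simp add: card_image inj_on_def)
    finally have "int (card (Z - \<psi> ` Zt)) \<le> r + 1" using vu Y(2) r by simp
    moreover have "card (Z - \<psi> ` Zt) = card Z - card Zt" using imZ finZ cZ by (simp add: card_Diff_subset finite_subset)
    ultimately show ?thesis by linarith
  qed
  have neZ: "Zt \<noteq> {}" using loss big r by auto
  have cs: "card (Yt + Zt) = card (Y + \<psi> ` Zt)"
    using pull_plus_card[OF cyc subY(1) subZ(1)] imY by simp
  have subs: "Y + \<psi> ` Zt \<subseteq> Y + Z" using imZ by (intro set_plus_mono2) auto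
  then have csle: "card (Yt + Zt) \<le> card (Y + Z)" unfolding cs using fin by (intro card_mono)
  have dense: "v - u + 2 < 2 * int (card Yt)" using Y(2) big cY r by linarith
  have small: "card (Yt + Zt) + 4 \<le> card Yt + card Zt + min (card Yt) (card Zt)"
    using csle card loss big r cY by linarith
  obtain b where b: "Zt \<subseteq> {b..b + int (card (Yt + Zt)) - int (card Yt)}"
    using three_k_minus_four_dense[OF subY(2) subZ(2) neY neZ small subY(1) dense] by blast
  define M where "M = int (card (Yt + Zt)) - int (card Yt)"
  have M: "M \<le> int (card Z) + r" "M \<ge> 0" using csle card cY card_le_set_plus[OF subY(2) subZ(2) neZ] by (auto simp: M_def)
  have bM: "Zt \<subseteq> {b..b + M}" using b by (simp add: M_def add_diff_eq)
  \<comment> \<open>\<open>Y\<close> has at most \<open>k\<close> holes in its interval. At most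
    \<open>k\<close> elements of \<open>Z\<close> are missing from the image of \<open>Zt\<close>,
    so by \<open>card_sumset_int\<close> at most \<open>2 * k\<close> sums are new. Together this
    gives the tolerance \<open>3 * k\<close>.\<close>
  define k where "k = r + 1"
  have stray: "Z \<subseteq> \<psi> ` {b - 3 * k..b + M + 3 * k}"
  proof
    fix z assume z: "z \<in> Z"
    then obtain n where n: "z = \<psi> n" "n \<in> {b..<b + int p}" using Z cyc_range[OF cyc, of b] by auto
    show "z \<in> \<psi> ` {b - 3 * k..b + M + 3 * k}"
    proof (cases "n \<le> b + M + 3 * k \<or> n \<ge> b + p - 3 * k")
      case True
      then show ?thesis
      proof
        assume "n \<le> b + M + 3 * k" then show ?thesis using n r by (auto simp: k_def)
      next
        assume "n \<ge> b + p - 3 * k"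
        moreover have "\<psi> (n - p) = \<psi> n" using cyc by (simp add: cyc_eq_iff)
        ultimately show ?thesis using n M r
          by (intro image_eqI[of _ _ "n - p"]) (auto simp: k_def)
      qed
    next
      case False
      \<comment> \<open>The positions of \<open>n + {u..v}\<close> that lie outside
        \<open>{u..v} + {b..b + M}\<close> modulo \<open>p\<close>: each is a hole of the translate
        of \<open>Y\<close> or a new sum, so more than \<open>3 * k\<close> of them are
        impossible.\<close>
      define F where "F = {max (n + u) (v + b + M + 1)..min (n + v) (u + b + p - 1)}"
      have cF: "int (card F) > 3 * k"
      proof -
        have "int (card F) \<ge> min (n + v) (u + b + p - 1) - max (n + u) (v + b + M + 1) + 1" by (simp add: F_def)
        moreover have "v - u + 1 > 3 * k" "int p - 1 - (v - u) - M > 3 * k"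
          using vu big Y(2) M p r by (auto simp: k_def)
        ultimately show ?thesis using False by linarith
      qed
      have "\<psi> ` (F \<inter> (+) n ` Yt) \<subseteq> (Y + Z) - (Y + \<psi> ` Zt)"
      proof (rule subsetI, elim imageE IntE)
        fix x y i assume *: "x = \<psi> y" "y \<in> F" "y = n + i" "i \<in> Yt"
        then have "\<psi> i + \<psi> n \<in> Y + Z" using z n imY by (intro set_plus_intro) auto
        then have "x \<in> Y + Z" using * by (simp add: cyc_add[OF cyc] add.commute)
        moreover have "x \<notin> Y + \<psi> ` Zt"
        proof
          assume "x \<in> Y + \<psi> ` Zt"
          then obtain i' j' where ij: "i' \<in> Yt" "j' \<in> Zt" "x = \<psi> i' + \<psi> j'"
            using imY by (auto elim!: set_plus_elim)
          then have "int p dvd y - (i' + j')" using * cyc_add[OF cyc, of i' j'] cyc by (simp add: cyc_eq_iff[symmetric])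
          moreover have "i' \<in> {u..v}" "j' \<in> {b..b + M}" using ij subY(1) bM by auto
          then have "0 < y - (i' + j')" "y - (i' + j') < int p" using * by (auto simp: F_def)
          ultimately show False by (simp add: zdvd_not_zless)
        qed
        ultimately show "x \<in> (Y + Z) - (Y + \<psi> ` Zt)" by simp
      qed
      then have "card (\<psi> ` (F \<inter> (+) n ` Yt)) \<le> card ((Y + Z) - (Y + \<psi> ` Zt))" using fin by (intro card_mono) auto
      also have "\<dots> = card (Y + Z) - card (Yt + Zt)" using subs fin cs by (simp add: card_Diff_subset finite_subset)
      also have "card (\<psi> ` (F \<inter> (+) n ` Yt)) = card (F \<inter> (+) n ` Yt)"
        by (rule card_inj_window[OF cyc, of _ "n + u" "n + v"]) (use vup in \<open>auto simp: F_def\<close>)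
      finally have 1: "int (card (F \<inter> (+) n ` Yt)) \<le> int (card (Y + Z)) - card (Yt + Zt)" using csle by linarith
      have "F \<subseteq> {n + u..n + v}" by (auto simp: F_def)
      then have "F \<subseteq> (F \<inter> (+) n ` Yt) \<union> ({n + u..n + v} - (+) n ` Yt)" by blast
      then have "card F \<le> card ((F \<inter> (+) n ` Yt) \<union> ({n + u..n + v} - (+) n ` Yt))" by (intro card_mono) (auto simp: F_def)
      also have "\<dots> \<le> card (F \<inter> (+) n ` Yt) + card ({n + u..n + v} - (+) n ` Yt)" by (rule card_Un_le)
      also have "card ({n + u..n + v} - (+) n ` Yt) = card {n + u..n + v} - card ((+) n ` Yt)"
        using subY by (intro card_Diff_subset) auto
      finally have "int (card F) \<le> int (card (F \<inter> (+) n ` Yt)) + (v - u + 1 - card Y)"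
        using vu cY by (simp add: card_image)
      moreover have "3 * k = 3 * r + 3" by (simp add: k_def)
      ultimately have False
        using 1 card card_sumset_int[OF subY(2) subZ(2) neY neZ] cF loss cY Y(2) by linarith
      then show ?thesis ..
    qed
  qed
  define Zs where "Zs = pull \<psi> (b - 3 * k) (b + M + 3 * k) Z"
  have imZs: "\<psi> ` Zs = Z" using stray by (auto simp: Zs_def pull_image)
  have subZs: "Zs \<subseteq> {b - 3 * k..b + M + 3 * k}" "finite Zs" by (auto simp: Zs_def pull_sub)
  have len: "(v - u) + ((b + M + 3 * k) - (b - 3 * k)) < int p" using Y(2) M p big r by (auto simp: k_def)
  have cZs: "card Zs = card Z" using card_inj_window[OF cyc subZs(1)] imZs len vu big r by auto
  have css: "card (Yt + Zs) = card (Y + Z)" using pull_plus_card[OF cyc subY(1) subZs(1) len] imY imZs by simp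
  have neZs: "Zs \<noteq> {}" using cZs big r by auto
  have small: "card (Yt + Zs) + 4 \<le> card Yt + card Zs + min (card Yt) (card Zs)"
    using css card big r cY cZs by linarith
  obtain b' where b': "Zs \<subseteq> {b'..b' + int (card (Yt + Zs)) - int (card Yt)}"
    using three_k_minus_four_dense[OF subY(2) subZs(2) neY neZs small subY(1) dense] by blast
  then have "Z \<subseteq> \<psi> ` {b'..b' + int (card (Yt + Zs)) - int (card Yt)}" using imZs by blast
  moreover have "b' + int (card (Yt + Zs)) - int (card Yt) - b' \<le> int (card Z) + r" using css card cY by linarith
  ultimately show ?thesis using that by blast
qed

section \<open>Atoms\<close>

text \<open>A group of prime order is generated by any nonzero element, so a nonzero stabilizer
  would carry one element of \<open>S\<close> to all others.\<close>

lemma prime_stab_trivial: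
  assumes cyc: "cyc p \<psi>" and pr: "prime p" and S: "S \<subseteq> range \<psi>" "S \<noteq> {}" "S \<noteq> range \<psi>" and g: "g \<in> stab S"
  shows "g = 0"
proof (rule ccontr)
  assume "g \<noteq> 0"
  obtain s where s: "s \<in> S" using S by blast
  then have "g + s \<in> range \<psi>" "s \<in> range \<psi>" using S stab_add[OF g] by auto
  then have "g \<in> range \<psi>" using subgrp_diff[OF cyc_subgrp[OF cyc], of "g + s" s] by simp
  then obtain k where k: "g = \<psi> k" by blast
  then have nd: "\<not> int p dvd k" using \<open>g \<noteq> 0\<close> cyc by (simp add: cyc_0_iff)
  have mult: "\<psi> (k * int n) \<in> stab S" for n
  proof (induction n)
    case 0
    then show ?case using cyc_0[OF cyc] subgrp_0[OF subgrp_stab] by simp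
  next
    case (Suc n)
    have "\<psi> (k * int (Suc n)) = \<psi> k + \<psi> (k * int n)" by (simp add: cyc_add[OF cyc, symmetric] algebra_simps)
    then show ?case using Suc g k subgrp_add[OF subgrp_stab] by metis
  qed
  have "range \<psi> \<subseteq> S"
  proof
    fix x assume "x \<in> range \<psi>"
    then have "x - s \<in> range \<psi>" using s S by (intro subgrp_diff[OF cyc_subgrp[OF cyc]]) auto
    then obtain n where "x - s = \<psi> (k * n)" using cyc_scale(2)[OF cyc pr nd] by (metis rangeE)
    also have "\<dots> = \<psi> (k * (n mod int p))"
      using cyc_mod[OF cyc_scale(1)[OF cyc pr nd], of n] by simp
    also have "\<dots> = \<psi> (k * int (nat (n mod int p)))" using cyc_pos[OF cyc] by simp
    finally have "x - s \<in> stab S" using mult[of "nat (n mod int p)"] by (simp only:)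
    then have "(x - s) + s \<in> S" using s by (rule stab_add)
    then show "x \<in> S" by simp
  qed
  then show False using S by blast
qed

lemma cauchy_davenport:
  assumes cyc: "cyc p \<psi>" and pr: "prime p" and AB: "A \<subseteq> range \<psi>" "B \<subseteq> range \<psi>" "A \<noteq> {}" "B \<noteq> {}"
    and "A + B \<noteq> range \<psi>"
  shows "card A + card B \<le> card (A + B) + 1"
proof -
  have fin: "finite A" "finite B" using AB cyc_card_range[OF cyc] finite_subset by auto
  have sub: "A + B \<subseteq> range \<psi>" using AB
    by (auto elim!: set_plus_elim intro!: subgrp_add[OF cyc_subgrp[OF cyc]])
  have "stab (A + B) \<subseteq> {0}" using prime_stab_trivial[OF cyc pr sub set_plus_nonempty[OF AB(3,4)] assms(7)] by blast
  then have "card (stab (A + B)) \<le> card {0::'a}" by (intro card_mono) auto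
  then show ?thesis using kneser[OF fin(1) AB(3) fin(2) AB(4)] by simp
qed

text \<open>\<open>d\<close> is submodular: for a translate \<open>W\<close> of the atom, its values
  at \<open>Z0 \<union> W\<close> and \<open>Z0 \<inter> W\<close> add up to at most twice the
  minimum. A large proper intersection would be admissible and smaller than the atom, hence have
  larger \<open>d\<close>, and the union would fall below the minimum.\<close>

lemma atom_exists:
  fixes Y Z G :: "'a::ab_group_add set"
  assumes G: "subgrp G" "finite G" and Y: "Y \<subseteq> G" "Y \<noteq> {}"
    and Z: "Z \<subseteq> G" "k \<le> card Z" "card (Z + Y) + k \<le> card G"
  obtains Z0 where "Z0 \<subseteq> G" "k \<le> card Z0" "card (Z0 + Y) + card Z \<le> card (Z + Y) + card Z0"
    "card Z0 + card (Z0 + Y) \<le> card G"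
    "\<And>g. g \<in> G \<Longrightarrow> (+) g ` Z0 \<noteq> Z0 \<Longrightarrow> card (Z0 \<inter> (+) g ` Z0) < k"
proof -
  define F where "F = (\<lambda>X. X \<subseteq> G \<and> k \<le> card X \<and> card (X + Y) + k \<le> card G)"
  define d where "d = (\<lambda>X. card (X + Y) - card X)"
  have finY: "finite Y" using Y G finite_subset by blast
  have FZ: "F Z" using Z by (simp add: F_def)
  obtain X where X: "F X" "\<And>X'. F X' \<Longrightarrow> d X \<le> d X'"
    using ex_has_least_nat[of F Z d] FZ by blast
  obtain Z0 where Z0: "F Z0 \<and> d Z0 = d X" "\<And>X'. F X' \<and> d X' = d X \<Longrightarrow> card Z0 \<le> card X'"
    using ex_has_least_nat[of "\<lambda>X'. F X' \<and> d X' = d X" X card] X by blast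
  have dmin: "d Z0 \<le> d X'" if "F X'" for X' using X Z0 that by simp
  have cmin: "card Z0 \<le> card X'" if "F X'" "d X' \<le> d Z0" for X' using Z0 dmin[OF that(1)] that by force
  have finF: "finite X'" if "F X'" for X' using that G finite_subset by (auto simp: F_def)
  have dd: "card (X' + Y) = card X' + d X'" if "finite X'" for X'
    using card_le_set_plus[OF that finY Y(2)] by (simp add: d_def)
  have Z0': "Z0 \<subseteq> G" "k \<le> card Z0" "card (Z0 + Y) + k \<le> card G" "finite Z0"
    using Z0(1) finF[of Z0] unfolding F_def by blast+
  have sub: "X' + Y \<subseteq> G" if "X' \<subseteq> G" for X'
    using that Y G(1) by (auto elim!: set_plus_elim intro!: subgrp_add)
  have ZY: "Z0 + Y \<subseteq> G" using sub Z0' by blast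
  have half: "card Z0 + card (Z0 + Y) \<le> card G"
  proof -
    \<comment> \<open>The dual set: \<open>X0 + Y\<close> avoids the negatives of \<open>Z0\<close>,
      so \<open>d X0 \<le> d Z0\<close>, and minimality of \<open>card Z0\<close> gives
      \<open>half\<close>. This leaves enough room for the union of two translates to be
      admissible.\<close>
    define X0 where "X0 = uminus ` (G - (Z0 + Y))"
    have X0G: "X0 \<subseteq> G" using G(1) subgrp_minus by (auto simp: X0_def)
    have "card X0 = card (G - (Z0 + Y))" unfolding X0_def by (rule card_image) (simp add: inj_on_def)
    then have cX0: "card X0 = card G - card (Z0 + Y)"
      using ZY G(2) by (simp add: card_Diff_subset finite_subset)
    have "X0 + Y \<subseteq> uminus ` (G - Z0)"
    proof
      fix x assume "x \<in> X0 + Y"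
      then obtain w y where wy: "w \<in> G" "w \<notin> Z0 + Y" "y \<in> Y" "x = - w + y"
        by (auto simp: X0_def elim!: set_plus_elim)
      have "w - y \<notin> Z0"
      proof
        assume "w - y \<in> Z0"
        then have "(w - y) + y \<in> Z0 + Y" using wy by (intro set_plus_intro)
        then show False using wy by simp
      qed
      moreover have "w - y \<in> G" using wy Y G(1) by (auto intro: subgrp_diff)
      ultimately show "x \<in> uminus ` (G - Z0)" using wy by (intro image_eqI[of _ _ "w - y"]) auto
    qed
    then have "card (X0 + Y) \<le> card (uminus ` (G - Z0))" using G(2) by (intro card_mono) auto
    also have "\<dots> = card G - card Z0" using Z0' by (simp add: card_image card_Diff_subset)
    finally have c1: "card (X0 + Y) \<le> card G - card Z0" .
    have ZG: "card Z0 \<le> card G" "card (Z0 + Y) \<le> card G" using Z0' ZY G(2) by (auto intro: card_mono)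
    have "F X0" unfolding F_def using X0G cX0 c1 Z0' ZG by auto
    moreover have "d X0 \<le> d Z0" unfolding d_def using cX0 c1 ZG by auto
    ultimately have "card Z0 \<le> card X0" by (rule cmin)
    then show ?thesis using cX0 ZG by linarith
  qed
  have small: "card (Z0 \<inter> (+) g ` Z0) < k" if g: "g \<in> G" "(+) g ` Z0 \<noteq> Z0" for g
  proof (rule ccontr)
    define W where "W = (+) g ` Z0"
    assume "\<not> ?thesis"
    then have ik: "k \<le> card (Z0 \<inter> W)" by (simp add: W_def)
    have W: "W \<subseteq> G" "finite W" "card W = card Z0"
      using Z0' g G(1) by (auto simp: W_def card_image intro: subgrp_add)
    have "W + Y = (+) g ` (Z0 + Y)" using set_plus_translate[of Y g Z0] by (simp add: W_def add.commute)
    then have WY: "card (W + Y) = card (Z0 + Y)" by (simp add: card_image)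
    have un: "(Z0 \<union> W) + Y = (Z0 + Y) \<union> (W + Y)" by (auto elim!: set_plus_elim intro: set_plus_intro)
    have int: "(Z0 \<inter> W) + Y \<subseteq> (Z0 + Y) \<inter> (W + Y)" by (auto elim!: set_plus_elim intro: set_plus_intro)
    have fins: "finite (Z0 + Y)" "finite (W + Y)" using Z0' W finY by (auto intro: finite_set_plus)
    have "card ((Z0 \<inter> W) + Y) \<le> card ((Z0 + Y) \<inter> (W + Y))" using int fins by (intro card_mono) auto
    then have subm: "card ((Z0 \<union> W) + Y) + card ((Z0 \<inter> W) + Y) \<le> 2 * card (Z0 + Y)"
      unfolding un using card_Un_Int[OF fins] WY by simp
    have cu: "card (Z0 \<union> W) + card (Z0 \<inter> W) = 2 * card Z0" using card_Un_Int[of Z0 W] Z0' W by simp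
    have "Z0 \<inter> W \<noteq> Z0"
    proof
      assume "Z0 \<inter> W = Z0"
      then have "Z0 = W" using W Z0' by (metis Int_lower2 card_subset_eq)
      then show False using g by (simp add: W_def)
    qed
    then have lt: "card (Z0 \<inter> W) < card Z0" using Z0' by (intro psubset_card_mono) auto
    have "card ((Z0 \<inter> W) + Y) \<le> card (Z0 + Y)" using int fins by (intro card_mono) auto
    then have Fi: "F (Z0 \<inter> W)" unfolding F_def using ik Z0' by auto
    have "d (Z0 \<inter> W) > d Z0" using cmin[OF Fi] lt by force
    then have 1: "card ((Z0 \<inter> W) + Y) > card (Z0 \<inter> W) + d Z0" using dd[of "Z0 \<inter> W"] Z0' by simp
    have 2: "card (Z0 + Y) = card Z0 + d Z0" using dd Z0' by simp
    have "F (Z0 \<union> W)"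
    proof -
      have "card Z0 \<le> card (Z0 \<union> W)" using Z0' W by (intro card_mono) auto
      then show ?thesis unfolding F_def using Z0' W half subm 1 2 ik by auto
    qed
    then have "d Z0 \<le> d (Z0 \<union> W)" by (rule dmin)
    then have "card ((Z0 \<union> W) + Y) \<ge> card (Z0 \<union> W) + d Z0" using dd[of "Z0 \<union> W"] Z0' W by simp
    then show False using subm 1 2 cu by linarith
  qed
  have "d Z0 \<le> d Z" using dmin FZ by blast
  then have "card (Z0 + Y) + card Z \<le> card (Z + Y) + card Z0"
    using dd[OF Z0'(4)] dd[OF finF[OF FZ]] by linarith
  then show ?thesis using that Z0' half small by blast
qed

text \<open>Cauchy--Schwarz for the number of \<open>y\<close> with \<open>s - y\<close> in
  \<open>Z\<close>: over all \<open>s\<close> it sums to \<open>card Y * card Z\<close>, and its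
  second moment counts pairs \<open>y\<close>, \<open>y'\<close>, where a diagonal pair contributes
  \<open>card Z\<close> and any other at most \<open>k\<close>.\<close>

lemma energy_bound:
  fixes Y Z :: "'a::ab_group_add set"
  assumes fin: "finite Y" "finite Z" and ne: "Y \<noteq> {}"
    and k: "\<And>y y'. y \<in> Y \<Longrightarrow> y' \<in> Y \<Longrightarrow> y \<noteq> y' \<Longrightarrow> real (card (Z \<inter> (+) (y - y') ` Z)) \<le> k"
  shows "(real (card Z))\<^sup>2 * card Y \<le> card (Z + Y) * ((real (card Y) - 1) * k + card Z)"
proof -
  define S where "S = Z + Y"
  have finS: "finite S" using fin by (simp add: S_def finite_set_plus)
  define ind :: "'a \<Rightarrow> 'a \<Rightarrow> real" where "ind = (\<lambda>s y. of_bool (s - y \<in> Z))"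
  have row: "(\<Sum>s\<in>S. ind s y) = card Z" if "y \<in> Y" for y
  proof -
    have "{s\<in>S. s - y \<in> Z} = (\<lambda>z. z + y) ` Z"
    proof
      show "{s\<in>S. s - y \<in> Z} \<subseteq> (\<lambda>z. z + y) ` Z" by (force simp: image_iff)
      show "(\<lambda>z. z + y) ` Z \<subseteq> {s\<in>S. s - y \<in> Z}" using that by (auto simp: S_def)
    qed
    then have "card {s\<in>S. s - y \<in> Z} = card Z" by (simp add: card_image inj_on_def)
    moreover have "S \<inter> {s. s - y \<in> Z} = {s\<in>S. s - y \<in> Z}" by auto
    ultimately show ?thesis by (simp add: ind_def finS)
  qed
  have pair: "(\<Sum>s\<in>S. ind s y * ind s y') \<le> k" if y: "y \<in> Y" "y' \<in> Y" "y \<noteq> y'" for y y'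
  proof -
    have "(\<lambda>s. s - y') ` {s\<in>S. s - y \<in> Z \<and> s - y' \<in> Z} \<subseteq> Z \<inter> (+) (y - y') ` Z"
    proof (rule subsetI, elim imageE)
      fix x s assume "x = s - y'" "s \<in> {s\<in>S. s - y \<in> Z \<and> s - y' \<in> Z}"
      then show "x \<in> Z \<inter> (+) (y - y') ` Z" by (auto intro!: image_eqI[of _ _ "s - y"])
    qed
    then have "card ((\<lambda>s. s - y') ` {s\<in>S. s - y \<in> Z \<and> s - y' \<in> Z}) \<le> card (Z \<inter> (+) (y - y') ` Z)"
      using fin by (intro card_mono) auto
    then have "real (card {s\<in>S. s - y \<in> Z \<and> s - y' \<in> Z}) \<le> k"
      using k[OF y] by (simp add: card_image inj_on_def)
    moreover have "ind s y * ind s y' = of_bool (s - y \<in> Z \<and> s - y' \<in> Z)" for s by (simp add: ind_def)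
    moreover have "S \<inter> {s. s - y \<in> Z \<and> s - y' \<in> Z} = {s\<in>S. s - y \<in> Z \<and> s - y' \<in> Z}" by auto
    ultimately show ?thesis by (simp add: finS)
  qed
  have "(\<Sum>s\<in>S. \<Sum>y\<in>Y. ind s y) = (\<Sum>y\<in>Y. \<Sum>s\<in>S. ind s y)" by (rule sum.swap)
  also have "\<dots> = card Y * card Z" using row by simp
  finally have total: "(\<Sum>s\<in>S. \<Sum>y\<in>Y. ind s y) = card Y * card Z" .
  have "(\<Sum>s\<in>S. (\<Sum>y\<in>Y. ind s y)\<^sup>2) = (\<Sum>s\<in>S. \<Sum>y\<in>Y. \<Sum>y'\<in>Y. ind s y * ind s y')"
    by (simp add: power2_eq_square sum_product)
  also have "\<dots> = (\<Sum>y\<in>Y. \<Sum>s\<in>S. \<Sum>y'\<in>Y. ind s y * ind s y')" by (rule sum.swap)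
  also have "\<dots> = (\<Sum>y\<in>Y. \<Sum>y'\<in>Y. \<Sum>s\<in>S. ind s y * ind s y')" by (intro sum.cong refl sum.swap)
  also have "\<dots> \<le> (\<Sum>y\<in>Y. (real (card Y) - 1) * k + card Z)"
  proof (rule sum_mono)
    fix y assume y: "y \<in> Y"
    have "(\<Sum>y'\<in>Y. \<Sum>s\<in>S. ind s y * ind s y')
        = (\<Sum>s\<in>S. ind s y * ind s y) + (\<Sum>y'\<in>Y - {y}. \<Sum>s\<in>S. ind s y * ind s y')"
      using fin(1) y by (rule sum.remove)
    also have "(\<Sum>s\<in>S. ind s y * ind s y) = (\<Sum>s\<in>S. ind s y)" by (intro sum.cong) (auto simp: ind_def)
    also have "\<dots> = card Z" by (rule row[OF y])
    also have "(\<Sum>y'\<in>Y - {y}. \<Sum>s\<in>S. ind s y * ind s y') \<le> (\<Sum>y'\<in>Y - {y}. k)"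
      using y by (intro sum_mono pair) auto
    also have "(\<Sum>y'\<in>Y - {y}. k) = (real (card Y) - 1) * k"
      using y fin card_gt_0_iff[of Y] by (auto simp: of_nat_diff Suc_leI)
    finally show "(\<Sum>y'\<in>Y. \<Sum>s\<in>S. ind s y * ind s y') \<le> (real (card Y) - 1) * k + card Z" by simp
  qed
  finally have sq: "(\<Sum>s\<in>S. (\<Sum>y\<in>Y. ind s y)\<^sup>2) \<le> card Y * ((real (card Y) - 1) * k + card Z)" by simp
  have "(\<Sum>s\<in>S. (\<Sum>y\<in>Y. ind s y))\<^sup>2 \<le> (\<Sum>s\<in>S. (\<Sum>y\<in>Y. ind s y)\<^sup>2) * card S"
    using sum_squared_le_sum_of_squares[of "\<lambda>s. \<Sum>y\<in>Y. ind s y" S] finS by simp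
  also have "\<dots> \<le> card Y * ((real (card Y) - 1) * k + card Z) * card S"
    using sq by (rule mult_right_mono) simp
  finally have "real (card Y) * ((real (card Z))\<^sup>2 * card Y) \<le> real (card Y) * (card S * ((real (card Y) - 1) * k + card Z))"
    unfolding total by (simp add: power2_eq_square mult_ac)
  moreover have "real (card Y) > 0" using fin ne by (simp add: card_gt_0_iff)
  ultimately show ?thesis unfolding S_def by (rule mult_left_le_imp_le)
qed

section \<open>Fourier analysis modulo \<open>p\<close>\<close>

text \<open>
  If every half circle contains at most \<open>n\<close> of \<open>N\<close> unit vectors, their sum has norm at most \<open>2n - N\<close>:
  in the direction of the sum, each cosine is half the integral of a step function of \<open>sin t\<close>, and
  the sum of the step functions compares a half circle centred at \<open>t\<close> with its complement.
\<close>

lemma step_has_integral: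
  fixes c :: real assumes "\<bar>c\<bar> \<le> 1"
  shows "((\<lambda>x. if x < c then 1 else -1) has_integral 2 * c) {-1..1::real}"
    "((\<lambda>x. if - c < x then 1 else -1) has_integral 2 * c) {-1..1::real}"
proof -
  have const: "((\<lambda>_. k) has_integral k * (b - a)) {a..b}" if "a \<le> b" for a b k :: real
    using has_integral_const_real[of k a b] that by (simp add: mult.commute)
  have 1: "((\<lambda>x. if x < c then 1 else -1) has_integral (1 * (c - (-1)))) {-1..c}"
    by (rule has_integral_spike_finite[OF _ _ const, of "{c}"]) (use assms in auto)
  have 2: "((\<lambda>x. if x < c then 1 else -1) has_integral (-1 * (1 - c))) {c..1}"
    by (rule has_integral_spike_finite[OF _ _ const, of "{}"]) (use assms in auto)
  show "((\<lambda>x. if x < c then 1 else -1) has_integral 2 * c) {-1..1::real}"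
    using has_integral_combine[OF _ _ 1 2] assms by (simp add: algebra_simps)
  have 1: "((\<lambda>x. if - c < x then 1 else -1) has_integral (-1 * (- c - (-1)))) {-1..- c}"
    by (rule has_integral_spike_finite[OF _ _ const, of "{}"]) (use assms in auto)
  have 2: "((\<lambda>x. if - c < x then 1 else -1) has_integral (1 * (1 - - c))) {- c..1}"
    by (rule has_integral_spike_finite[OF _ _ const, of "{- c}"]) (use assms in auto)
  show "((\<lambda>x. if - c < x then 1 else -1) has_integral 2 * c) {-1..1::real}"
    using has_integral_combine[OF _ _ 1 2] assms by (simp add: algebra_simps)
qed

lemma half_arc_bound:
  fixes B :: "int set" and p :: nat and K :: real
  assumes "finite B" "odd p"
    and K: "\<And>u. 2 * real (card {b\<in>B. (b - u) mod int p \<le> (int p - 1) div 2}) \<le> K"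
  shows "norm (\<Sum>b\<in>B. cis (2 * pi * b / p)) + card B \<le> K"
proof -
  define S where "S = (\<Sum>b\<in>B. cis (2 * pi * b / p))"
  define \<phi> where "\<phi> = Arg S"
  have p0: "p > 0" using assms(2) by (cases p) auto
  have "\<exists>k::int. - pi < (2 * pi * b / p - \<phi>) - 2 * pi * k \<and> (2 * pi * b / p - \<phi>) - 2 * pi * k \<le> pi" for b :: int
  proof -
    define x where "x = (2 * pi * b / p - \<phi>) / (2 * pi) - 1 / 2"
    have "x \<le> \<lceil>x\<rceil>" "\<lceil>x\<rceil> < x + 1" by linarith+
    then have "2 * pi * x \<le> 2 * pi * \<lceil>x\<rceil>" "2 * pi * \<lceil>x\<rceil> < 2 * pi * (x + 1)" by auto
    moreover have "2 * pi * x = (2 * pi * b / p - \<phi>) - pi" by (simp add: x_def field_simps)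
    moreover have "2 * pi * (x + 1) = 2 * pi * x + 2 * pi" by (simp add: distrib_left)
    ultimately show ?thesis by (intro exI[of _ "\<lceil>x\<rceil>"] conjI) linarith+
  qed
  then obtain k :: "int \<Rightarrow> int" where k: "\<And>b::int. - pi < (2 * pi * b / p - \<phi>) - 2 * pi * k b"
    "\<And>b::int. (2 * pi * b / p - \<phi>) - 2 * pi * k b \<le> pi" by metis
  define \<alpha> where "\<alpha> = (\<lambda>b::int. (2 * pi * b / p - \<phi>) - 2 * pi * k b)"
  have \<alpha>: "- pi < \<alpha> b" "\<alpha> b \<le> pi" for b using k by (auto simp: \<alpha>_def)
  have "S = norm S * cis \<phi>" unfolding \<phi>_def using rcis_cmod_Arg[of S] by (simp add: rcis_def)
  then have "S * cis (- \<phi>) = norm S * (cis \<phi> * cis (- \<phi>))" by (metis mult.assoc)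
  then have nS: "S * cis (- \<phi>) = norm S" by (simp add: cis_mult)
  have cosa: "cos (\<alpha> b) = cos (2 * pi * b / p - \<phi>)" for b
    unfolding \<alpha>_def cos_diff[of _ "2 * pi * k b"] cos_int_2pin sin_int_2pin by simp
  have "norm S = Re (S * cis (- \<phi>))" by (simp add: nS)
  also have "S * cis (- \<phi>) = (\<Sum>b\<in>B. cis (2 * pi * b / p - \<phi>))"
    by (simp add: S_def sum_distrib_right cis_mult)
  also have "Re \<dots> = (\<Sum>b\<in>B. cos (\<alpha> b))" by (simp add: cosa)
  finally have nS: "norm S = (\<Sum>b\<in>B. cos (\<alpha> b))" .
  \<comment> \<open>Both step functions have integral \<open>2 * cos (\<alpha> b)\<close>. Choosing
    by the sign of \<open>\<alpha> b\<close> puts all \<open>b\<close> with value 1 at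
    \<open>x = sin t\<close> into the half circle from \<open>t - pi / 2\<close> to
    \<open>t + pi / 2\<close>; one form for both signs would not.\<close>
  define f where "f = (\<lambda>b x. if \<alpha> b < 0 then (if x < cos (\<alpha> b) then 1 else -1)
     else (if - cos (\<alpha> b) < x then 1 else -1 :: real))"
  have int_f: "(f b has_integral 2 * cos (\<alpha> b)) {-1..1}" for b
    using step_has_integral[of "cos (\<alpha> b)"] unfolding f_def by (cases "\<alpha> b < 0") auto
  have "((\<lambda>x. \<Sum>b\<in>B. f b x) has_integral (\<Sum>b\<in>B. 2 * cos (\<alpha> b))) {-1..1}"
    using int_f by (intro has_integral_sum assms) auto
  then have total: "((\<lambda>x. \<Sum>b\<in>B. f b x) has_integral 2 * norm S) {-1..1}"
    by (simp add: nS sum_distrib_left)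
  have bnd: "(\<Sum>b\<in>B. f b x) \<le> K - card B" if x: "x \<in> {-1..1}" for x
  proof -
    define t where "t = arcsin x"
    have t: "- (pi / 2) \<le> t" "t \<le> pi / 2" "sin t = x" using x arcsin_bounded[of x] by (auto simp: t_def)
    define P where "P = {b\<in>B. f b x = 1}"
    have arc: "t - pi / 2 \<le> \<alpha> b \<and> \<alpha> b < t + pi / 2" if b: "b \<in> P" for b
    proof (cases "\<alpha> b < 0")
      case True
      then have "sin t < cos (\<alpha> b)" using b t by (auto simp: P_def f_def split: if_splits)
      then have "sin t < sin (\<alpha> b + pi / 2)" by (simp add: sin_add)
      moreover have "\<alpha> b + pi / 2 \<le> pi / 2" "- (pi / 2) \<le> \<alpha> b + pi / 2" using True \<alpha>[of b] by auto
      ultimately have "t < \<alpha> b + pi / 2" using t sin_mono_less_eq[of t "\<alpha> b + pi / 2"] by simp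
      then show ?thesis using True t by auto
    next
      case False
      then have "- cos (\<alpha> b) < sin t" using b t by (auto simp: P_def f_def split: if_splits)
      then have "sin (\<alpha> b - pi / 2) < sin t" by (simp add: sin_diff)
      moreover have "\<alpha> b - pi / 2 \<le> pi / 2" "- (pi / 2) \<le> \<alpha> b - pi / 2" using False \<alpha>[of b] by auto
      ultimately have "\<alpha> b - pi / 2 < t" using t sin_mono_less_eq[of "\<alpha> b - pi / 2" t] by simp
      then show ?thesis using False t by auto
    qed
    \<comment> \<open>In residues the half circle is an interval of real length \<open>p / 2\<close>
      starting at \<open>l\<close>. For odd \<open>p\<close>, being less than \<open>p / 2\<close>
      above \<open>u\<close> means at most \<open>(p - 1) div 2\<close> steps.\<close>
    define l where "l = (t - pi / 2 + \<phi>) * p / (2 * pi)"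
    define u where "u = \<lceil>l\<rceil>"
    have "P \<subseteq> {b\<in>B. (b - u) mod int p \<le> (int p - 1) div 2}"
    proof
      fix b assume b: "b \<in> P"
      define b' where "b' = b - int p * k b"
      have "2 * pi * b' = (\<alpha> b + \<phi>) * p" using p0 by (simp add: \<alpha>_def b'_def field_simps)
      then have "real_of_int b' = (\<alpha> b + \<phi>) * p / (2 * pi)" by (simp add: field_simps)
      moreover have "(t - pi / 2 + \<phi>) * p / (2 * pi) \<le> (\<alpha> b + \<phi>) * p / (2 * pi)"
        using arc[OF b] by (intro divide_right_mono mult_right_mono) auto
      moreover have "(\<alpha> b + \<phi>) * p / (2 * pi) < (t + pi / 2 + \<phi>) * p / (2 * pi)"
        using arc[OF b] p0 by (intro divide_strict_right_mono mult_strict_right_mono) auto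
      moreover have "(t + pi / 2 + \<phi>) * p / (2 * pi) = l + p / 2" by (simp add: l_def field_simps)
      ultimately have "l \<le> b'" "b' < l + p / 2" by (auto simp: l_def)
      then have "u \<le> b'" "real_of_int (b' - u) < p / 2" unfolding u_def by linarith+
      then have "real_of_int (2 * (b' - u)) < real_of_int (int p)" by simp
      then have "2 * (b' - u) < int p" by (simp only: of_int_less_iff)
      with \<open>u \<le> b'\<close> have r: "0 \<le> b' - u" "2 * (b' - u) < int p" by auto
      have "(b - u) mod int p = (b' - u) mod int p" by (simp add: b'_def mod_eq_dvd_iff)
      also have "\<dots> = b' - u" using r by (intro mod_pos_pos_trivial) auto
      finally show "b \<in> {b\<in>B. (b - u) mod int p \<le> (int p - 1) div 2}" using r b by (auto simp: P_def)
    qed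
    then have "card P \<le> card {b\<in>B. (b - u) mod int p \<le> (int p - 1) div 2}"
      using assms(1) by (intro card_mono) auto
    then have cP: "2 * real (card P) \<le> K" using K[of u] by linarith
    have "f b x = 2 * of_bool (b \<in> P) - 1" if "b \<in> B" for b using that by (auto simp: P_def f_def)
    then have "(\<Sum>b\<in>B. f b x) = (\<Sum>b\<in>B. 2 * (of_bool (b \<in> P) :: real) - 1)" by (intro sum.cong) auto
    also have "\<dots> = 2 * (\<Sum>b\<in>B. of_bool (b \<in> P) :: real) - card B" by (simp add: sum_subtractf sum_distrib_left)
    also have "(\<Sum>b\<in>B. of_bool (b \<in> P) :: real) = real (card P)"
    proof -
      have "B \<inter> P = P" by (auto simp: P_def)
      then show ?thesis using assms(1) by simp
    qed
    finally show ?thesis using cP by linarith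
  qed
  have "((\<lambda>x. K - card B) has_integral (1 - (-1)) *\<^sub>R (K - card B)) {-1..1::real}"
    using has_integral_const_real[of "K - card B" "-1" 1] by simp
  then have "2 * norm S \<le> (1 - (-1)) *\<^sub>R (K - card B)"
    by (rule has_integral_le[OF total]) (use bnd in auto)
  then show ?thesis by (simp add: S_def)
qed

lemma half_arc:
  fixes B :: "int set" and p :: nat
  assumes "finite B" "odd p"
  obtains u where "norm (\<Sum>b\<in>B. cis (2 * pi * b / p)) + card B
    \<le> 2 * real (card {b\<in>B. (b - u) mod int p \<le> (int p - 1) div 2})"
proof -
  define n where "n = (\<lambda>u. card {b\<in>B. (b - u) mod int p \<le> (int p - 1) div 2})"
  have "n u \<le> card B" for u using assms by (auto simp: n_def intro: card_mono)
  then have "\<forall>u. True \<longrightarrow> n u < card B + 1" by (simp add: le_imp_less_Suc)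
  then obtain u where u: "\<And>v. n v \<le> n u" using ex_has_greatest_nat[of "\<lambda>_. True" 0 n "card B + 1"] by auto
  have "norm (\<Sum>b\<in>B. cis (2 * pi * b / p)) + card B \<le> 2 * real (n u)"
    by (rule half_arc_bound[OF assms]) (use u in \<open>simp add: n_def\<close>)
  then show ?thesis using that by (simp add: n_def)
qed

definition ft :: "nat \<Rightarrow> int set \<Rightarrow> nat \<Rightarrow> complex" where
  "ft p A k = (\<Sum>a\<in>A. cis (2 * pi * (int k * a) / p))"

lemma sum_cis_root:
  assumes "p > 0"
  shows "(\<Sum>k<p. cis (2 * pi * (int k * n) / p)) = (if int p dvd n then of_nat p else 0)"
proof -
  define w where "w = cis (2 * pi * n / p)"
  have pw: "cis (2 * pi * (int k * n) / p) = w ^ k" for k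
    unfolding w_def Complex.DeMoivre by (simp add: field_simps)
  have w1: "w = 1 \<longleftrightarrow> int p dvd n"
  proof
    assume "int p dvd n"
    then obtain m where "n = int p * m" by (elim dvdE)
    then have "2 * pi * n / p = 2 * pi * m" using assms by simp
    then show "w = 1" unfolding w_def by (simp add: complex_eq_iff)
  next
    assume "w = 1"
    then have "cos (2 * pi * n / p) = 1" by (simp add: w_def complex_eq_iff)
    then obtain m :: int where "2 * pi * n / p = m * 2 * pi" using cos_one_2pi_int by auto
    then have "real_of_int n = real_of_int (int p * m)" using assms by (simp add: field_simps)
    then show "int p dvd n" by (simp only: of_int_eq_iff) simp
  qed
  have wp: "w ^ p = 1"
    unfolding w_def Complex.DeMoivre using assms by (simp add: complex_eq_iff)
  show ?thesis
  proof (cases "w = 1")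
    case False
    then have "(\<Sum>k<p. w ^ k) = 0" using wp by (simp add: geometric_sum)
    then show ?thesis using False w1 pw by simp
  qed (use w1 pw in simp)
qed

lemma ft_0: "ft p A 0 = of_nat (card A)"
  by (simp add: ft_def)

lemma ft_parseval:
  assumes p: "p > 0" and A: "finite A" "\<And>a b. a \<in> A \<Longrightarrow> b \<in> A \<Longrightarrow> int p dvd a - b \<Longrightarrow> a = b"
  shows "(\<Sum>k<p. (norm (ft p A k))\<^sup>2) = p * card A"
proof -
  have "complex_of_real (\<Sum>k<p. (norm (ft p A k))\<^sup>2) = (\<Sum>k<p. ft p A k * cnj (ft p A k))"
    by (simp only: of_real_sum complex_norm_square)
  also have "\<dots> = (\<Sum>k<p. \<Sum>a\<in>A. \<Sum>b\<in>A. cis (2 * pi * (int k * (a - b)) / p))"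
  proof (rule sum.cong[OF refl])
    fix k
    have e: "cis (2 * pi * (int k * a) / p) * cnj (cis (2 * pi * (int k * b) / p))
      = cis (2 * pi * (int k * (a - b)) / p)" for a b
      by (simp add: cis_cnj cis_mult right_diff_distrib diff_divide_distrib)
    show "ft p A k * cnj (ft p A k) = (\<Sum>a\<in>A. \<Sum>b\<in>A. cis (2 * pi * (int k * (a - b)) / p))"
      unfolding e[symmetric] unfolding ft_def cnj_sum by (rule sum_product)
  qed
  also have "\<dots> = (\<Sum>a\<in>A. \<Sum>k<p. \<Sum>b\<in>A. cis (2 * pi * (int k * (a - b)) / p))" by (rule sum.swap)
  also have "\<dots> = (\<Sum>a\<in>A. \<Sum>b\<in>A. \<Sum>k<p. cis (2 * pi * (int k * (a - b)) / p))"
    by (intro sum.cong refl sum.swap)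
  also have "\<dots> = (\<Sum>a\<in>A. \<Sum>b\<in>A. if a = b then of_nat p else 0)"
    unfolding sum_cis_root[OF p] using A(2) by (intro sum.cong refl) auto
  also have "\<dots> = complex_of_real (real (p * card A))" using A(1) by simp
  finally show ?thesis by (simp only: of_real_eq_iff)
qed

lemma ft_triple:
  assumes p: "p > 0" and "\<And>a b c. a \<in> A \<Longrightarrow> b \<in> B \<Longrightarrow> c \<in> C \<Longrightarrow> \<not> int p dvd a + b + c"
  shows "(\<Sum>k<p. ft p A k * ft p B k * ft p C k) = 0"
proof -
  have "(\<Sum>k<p. ft p A k * ft p B k * ft p C k)
     = (\<Sum>k<p. \<Sum>a\<in>A. \<Sum>b\<in>B. \<Sum>c\<in>C. cis (2 * pi * (int k * (a + b + c)) / p))"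
  proof (rule sum.cong[OF refl])
    fix k
    have e: "cis (2 * pi * (int k * a) / p) * cis (2 * pi * (int k * b) / p) * cis (2 * pi * (int k * c) / p)
      = cis (2 * pi * (int k * (a + b + c)) / p)" for a b c
      by (simp add: cis_mult distrib_left add_divide_distrib)
    show "ft p A k * ft p B k * ft p C k = (\<Sum>a\<in>A. \<Sum>b\<in>B. \<Sum>c\<in>C. cis (2 * pi * (int k * (a + b + c)) / p))"
      unfolding e[symmetric] unfolding ft_def
      by (subst sum_product, simp only: sum_distrib_right, simp only: sum_distrib_left)
  qed
  also have "\<dots> = (\<Sum>a\<in>A. \<Sum>k<p. \<Sum>b\<in>B. \<Sum>c\<in>C. cis (2 * pi * (int k * (a + b + c)) / p))" by (rule sum.swap)
  also have "\<dots> = (\<Sum>a\<in>A. \<Sum>b\<in>B. \<Sum>k<p. \<Sum>c\<in>C. cis (2 * pi * (int k * (a + b + c)) / p))"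
    by (intro sum.cong refl sum.swap)
  also have "\<dots> = (\<Sum>a\<in>A. \<Sum>b\<in>B. \<Sum>c\<in>C. \<Sum>k<p. cis (2 * pi * (int k * (a + b + c)) / p))"
    by (intro sum.cong refl sum.swap)
  also have "\<dots> = 0" unfolding sum_cis_root[OF p] using assms(2) by (intro sum.neutral ballI) auto
  finally show ?thesis .
qed

text \<open>As no sum vanishes, the nonzero frequencies must cancel the term
  \<open>card X * card Y * card Z\<close> of frequency 0. Cauchy--Schwarz separates \<open>X\<close>
  from the product \<open>h\<close> of the other two transforms; bounding the square of
  \<open>h\<close> by \<open>M * h\<close> leaves the sum of \<open>h\<close>, to which
  Cauchy--Schwarz and Parseval apply once more. Maximizing the product makes one frequency serve
  \<open>Y\<close> and \<open>Z\<close> together.\<close>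

lemma large_fourier_coefficient:
  fixes X Y Z :: "int set" and p :: nat
  assumes p: "p \<ge> 2" and sub: "X \<subseteq> {0..<int p}" "Y \<subseteq> {0..<int p}" "Z \<subseteq> {0..<int p}"
    and ne: "X \<noteq> {}" "Y \<noteq> {}" "Z \<noteq> {}"
    and no: "\<And>a b c. a \<in> X \<Longrightarrow> b \<in> Y \<Longrightarrow> c \<in> Z \<Longrightarrow> \<not> int p dvd a + b + c"
  obtains k where "k \<in> {1..<p}"
    "real (card X)^2 * real (card Y)^3 * real (card Z)^3
     \<le> (norm (ft p Y k) * norm (ft p Z k))\<^sup>2 * (real p - card X)\<^sup>2 * (real p - card Y) * (real p - card Z)"
proof -
  have p0: "p > 0" using p by simp
  have fin: "finite X" "finite Y" "finite Z" using sub finite_subset by blast+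
  define x y z where "x = real (card X)" and "y = real (card Y)" and "z = real (card Z)"
  have pos: "x > 0" "y > 0" "z > 0" using fin ne by (auto simp: x_def y_def z_def card_gt_0_iff)
  have inc: "a = b" if "a \<in> {0..<int p}" "b \<in> {0..<int p}" "int p dvd a - b" for a b
    using that by (metis atLeastLessThan_iff mod_eq_dvd_iff mod_pos_pos_trivial)
  have split: "(\<Sum>k<p. g k) = g 0 + (\<Sum>k\<in>{1..<p}. g k)" for g :: "nat \<Rightarrow> 'a::comm_monoid_add"
    using sum.atLeast_Suc_lessThan[OF p0, of g] by (simp add: atLeast0LessThan)
  have pars: "(\<Sum>k\<in>{1..<p}. (norm (ft p A k))\<^sup>2) = card A * (real p - card A)"
    if "A \<subseteq> {0..<int p}" for A
  proof -
    have "finite A" using that finite_subset by blast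
    then have "(\<Sum>k<p. (norm (ft p A k))\<^sup>2) = p * card A" using that by (intro ft_parseval p0) (auto intro: inc)
    then show ?thesis unfolding split ft_0 by (simp add: power2_eq_square algebra_simps)
  qed
  define h where "h = (\<lambda>k. norm (ft p Y k) * norm (ft p Z k))"
  have h0: "h k \<ge> 0" for k by (simp add: h_def)
  define M where "M = Max (h ` {1..<p})"
  have "M \<in> h ` {1..<p}" unfolding M_def using p by (intro Max_in) auto
  then obtain k where k: "k \<in> {1..<p}" "M = h k" by blast
  have hM: "h j \<le> M" if "j \<in> {1..<p}" for j unfolding M_def using that by (intro Max_ge) auto
  have "ft p X 0 * ft p Y 0 * ft p Z 0 = - (\<Sum>k\<in>{1..<p}. ft p X k * ft p Y k * ft p Z k)"
    using ft_triple[OF p0 no] unfolding split by (simp add: add_eq_0_iff2)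
  then have "norm (ft p X 0 * ft p Y 0 * ft p Z 0) = norm (\<Sum>k\<in>{1..<p}. ft p X k * ft p Y k * ft p Z k)" by simp
  also have "\<dots> \<le> (\<Sum>k\<in>{1..<p}. norm (ft p X k * ft p Y k * ft p Z k))" by (rule norm_sum)
  also have "\<dots> = (\<Sum>k\<in>{1..<p}. norm (ft p X k) * h k)" by (simp add: norm_mult h_def mult_ac)
  finally have "x * y * z \<le> (\<Sum>k\<in>{1..<p}. norm (ft p X k) * h k)"
    by (simp add: ft_0 norm_mult x_def y_def z_def)
  then have "(x * y * z)\<^sup>2 \<le> (\<Sum>k\<in>{1..<p}. norm (ft p X k) * h k)\<^sup>2" using pos by (intro power_mono) auto
  also have "\<dots> \<le> (\<Sum>k\<in>{1..<p}. (norm (ft p X k))\<^sup>2) * (\<Sum>k\<in>{1..<p}. (h k)\<^sup>2)"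
    by (rule Cauchy_Schwarz_ineq_sum)
  also have "(\<Sum>k\<in>{1..<p}. (h k)\<^sup>2) \<le> (\<Sum>k\<in>{1..<p}. M * h k)"
    using hM h0 by (intro sum_mono) (simp add: power2_eq_square mult_right_mono)
  also have "\<dots> = M * (\<Sum>k\<in>{1..<p}. h k)" by (simp add: sum_distrib_left)
  finally have 1: "(x * y * z)\<^sup>2 \<le> (x * (p - x)) * (M * (\<Sum>k\<in>{1..<p}. h k))"
    using pars[OF sub(1)] by (simp add: x_def mult_left_mono sum_nonneg)
  have "(\<Sum>k\<in>{1..<p}. h k)\<^sup>2 \<le> (\<Sum>k\<in>{1..<p}. (norm (ft p Y k))\<^sup>2) * (\<Sum>k\<in>{1..<p}. (norm (ft p Z k))\<^sup>2)"
    unfolding h_def by (rule Cauchy_Schwarz_ineq_sum)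
  then have 2: "(\<Sum>k\<in>{1..<p}. h k)\<^sup>2 \<le> (y * (p - y)) * (z * (p - z))"
    using pars[OF sub(2)] pars[OF sub(3)] by (simp add: y_def z_def)
  have "((x * y * z)\<^sup>2)\<^sup>2 \<le> ((x * (p - x)) * (M * (\<Sum>k\<in>{1..<p}. h k)))\<^sup>2"
    using 1 by (intro power_mono) auto
  also have "\<dots> = (x * (p - x) * M)\<^sup>2 * (\<Sum>k\<in>{1..<p}. h k)\<^sup>2" by (simp add: power_mult_distrib mult_ac)
  also have "\<dots> \<le> (x * (p - x) * M)\<^sup>2 * ((y * (p - y)) * (z * (p - z)))" using 2 by (intro mult_left_mono) auto
  finally have "(x^2 * y * z) * (x^2 * y^3 * z^3) \<le> (x^2 * y * z) * (M\<^sup>2 * (p - x)\<^sup>2 * (p - y) * (p - z))"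
    by (simp add: power2_eq_square power3_eq_cube mult_ac)
  then have "x^2 * y^3 * z^3 \<le> M\<^sup>2 * (p - x)\<^sup>2 * (p - y) * (p - z)"
    by (rule mult_left_le_imp_le) (use pos in simp)
  then show ?thesis using that k by (simp add: x_def y_def z_def h_def)
qed

section \<open>The numerical conditions\<close>

text \<open>Convexity lets a condition on a whole range of \<open>z\<close> be checked at its two
  ends, as in \<open>numeric_piece\<close>.\<close>

lemma convex_quadratic_between:
  fixes a b c :: real
  assumes "a \<ge> 0" "z1 \<le> z" "z \<le> z2" "a * z1^2 + b * z1 + c \<le> 0" "a * z2^2 + b * z2 + c \<le> 0"
  shows "a * z^2 + b * z + c \<le> 0"
proof (cases "z1 = z2")
  case False
  then have lt: "z2 - z1 > 0" using assms by simp
  have "(z2 - z1) * (a * z^2 + b * z + c) = (z2 - z) * (a * z1^2 + b * z1 + c)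
     + (z - z1) * (a * z2^2 + b * z2 + c) - a * (z - z1) * (z2 - z) * (z2 - z1)"
    by (simp add: algebra_simps power2_eq_square)
  moreover have "(z2 - z) * (a * z1^2 + b * z1 + c) \<le> 0" "(z - z1) * (a * z2^2 + b * z2 + c) \<le> 0"
    using assms by (auto intro: mult_nonneg_nonpos)
  moreover have "a * (z - z1) * (z2 - z) * (z2 - z1) \<ge> 0" using assms lt by simp
  ultimately have "(z2 - z1) * (a * z^2 + b * z + c) \<le> 0" by linarith
  then show ?thesis using lt by (simp add: mult_le_0_iff)
qed (use assms in auto)

text \<open>\<open>\<alpha>\<close>, \<open>\<beta>\<close>, \<open>\<delta>\<close> control the
  factors of \<open>hyp\<close>, so that \<open>q \<le> f * g\<close>. By the inequality of
  arithmetic and geometric means this bounds \<open>f + z * g / 2\<close>,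
  \<open>f / 2 + z * g\<close> and \<open>f + z * g\<close> from below; the three conclusions are
  these bounds rearranged.\<close>

lemma numeric_piece:
  fixes z x \<rho> f g s :: real
  assumes z: "zl \<le> z" "z \<le> zu" and rho: "\<rho> \<le> s" "- 1 < \<rho>" and fg: "0 \<le> f" "0 \<le> g"
    and hyp: "x^2 * z \<le> (f * g)^2 * (1 + z + \<rho>)^2 * (x + z + \<rho>) * (x + 1 + \<rho>)"
    and xl: "xl \<le> x" "s \<le> t" and pos: "0 \<le> t" "0 < zl" "0 < xl"
      "0 \<le> \<alpha>" "\<alpha> \<le> 1" "0 \<le> \<beta>" "\<beta> \<le> 1" "0 \<le> \<delta>" "0 \<le> q" "0 \<le> w"
    and ab: "\<alpha> * (zu + t) \<le> (1 - \<alpha>) * xl" "\<beta> * (1 + t) \<le> (1 - \<beta>) * xl"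
    and d: "\<delta> * (1 + zl + t)^2 \<le> zl" "\<delta> * (1 + zu + t)^2 \<le> zu"
    and q: "q^2 \<le> \<alpha> * \<beta> * \<delta>"
    and i: "(zl / 2 + 3 / 2 * t)^2 \<le> 2 * zl * q" "(zu / 2 + 3 / 2 * t)^2 \<le> 2 * zu * q" "(1 / 2 + 3 / 2 * t)^2 \<le> 2 * zl * q"
    and w: "w^2 \<le> zl * q" and ii: "3 / 2 * (1 + zu) + 4 * t \<le> 2 * xl + 3 * w"
  shows "z * (1 - g) / 2 + 3 / 2 * s \<le> f \<and> (1 - f) / 2 + 3 / 2 * s \<le> z * g \<and>
    3 / 2 * ((1 - f) + z * (1 - g)) + 4 * s \<le> 2 * x"
proof -
  have pos': "0 < z" "0 < x" "0 < 1 + z + \<rho>" using z pos xl rho by auto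
  have "\<alpha> * (x + z + \<rho>) \<le> \<alpha> * x + \<alpha> * (zu + t)"
    using mult_left_mono[of "z + \<rho>" "zu + t" \<alpha>] z rho xl pos by (simp add: algebra_simps)
  also have "\<dots> \<le> \<alpha> * x + (1 - \<alpha>) * x"
    using ab(1) mult_left_mono[OF xl(1), of "1 - \<alpha>"] pos by linarith
  finally have A: "\<alpha> * (x + z + \<rho>) \<le> x" by (simp add: algebra_simps)
  have "\<beta> * (x + 1 + \<rho>) \<le> \<beta> * x + \<beta> * (1 + t)"
    using mult_left_mono[of "1 + \<rho>" "1 + t" \<beta>] rho xl pos by (simp add: algebra_simps)
  also have "\<dots> \<le> \<beta> * x + (1 - \<beta>) * x"
    using ab(2) mult_left_mono[OF xl(1), of "1 - \<beta>"] pos by linarith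
  finally have B: "\<beta> * (x + 1 + \<rho>) \<le> x" by (simp add: algebra_simps)
  have "\<delta> * z^2 + (2 * \<delta> * (1 + t) - 1) * z + \<delta> * (1 + t)^2 \<le> 0"
    by (rule convex_quadratic_between[OF pos(8) z]) (use d in \<open>simp_all add: power2_eq_square algebra_simps\<close>)
  then have "\<delta> * (1 + z + t)^2 \<le> z" by (simp add: power2_eq_square algebra_simps)
  moreover have "\<delta> * (1 + z + \<rho>)^2 \<le> \<delta> * (1 + z + t)^2"
    using pos' rho xl pos by (intro mult_left_mono power_mono) auto
  ultimately have D: "\<delta> * (1 + z + \<rho>)^2 \<le> z" by linarith
  have xz: "0 < x + z + \<rho>" "0 < x + 1 + \<rho>"
  proof -
    have "0 < x + 1 + \<rho>" using pos' rho by linarith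
    then show "0 < x + 1 + \<rho>" .
    show "0 < x + z + \<rho>"
    proof (rule ccontr)
      assume "\<not> ?thesis"
      then have "(f * g)^2 * (1 + z + \<rho>)^2 * (x + z + \<rho>) * (x + 1 + \<rho>) \<le> 0"
        using \<open>0 < x + 1 + \<rho>\<close> by (intro mult_nonpos_nonneg mult_nonneg_nonpos) auto
      moreover have "0 < x^2 * z" using pos' by simp
      ultimately show False using hyp by linarith
    qed
  qed
  define R where "R = (1 + z + \<rho>)^2 * (x + z + \<rho>) * (x + 1 + \<rho>)"
  have R: "R > 0" using xz pos' by (simp add: R_def)
  have "(\<alpha> * \<beta> * \<delta>) * R = (\<alpha> * (x + z + \<rho>)) * (\<beta> * (x + 1 + \<rho>)) * (\<delta> * (1 + z + \<rho>)^2)"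
    by (simp add: R_def mult_ac)
  also have "\<dots> \<le> (x * x) * z"
    using A B D xz pos pos' by (intro mult_mono) auto
  also have "\<dots> \<le> (f * g)^2 * R" using hyp by (simp add: R_def power2_eq_square mult_ac)
  finally have "\<alpha> * \<beta> * \<delta> \<le> (f * g)^2" using R by simp
  then have "q^2 \<le> (f * g)^2" using q by linarith
  then have qfg: "q \<le> f * g" by (rule power2_le_imp_le) (use fg in simp)
  have "(1 / 4) * z^2 + (3 / 2 * t - 2 * q) * z + (3 / 2 * t)^2 \<le> 0"
    by (rule convex_quadratic_between[OF _ z]) (use i in \<open>simp_all add: power2_eq_square algebra_simps\<close>)
  then have "(z / 2 + 3 / 2 * t)^2 \<le> 2 * z * q" by (simp add: power2_eq_square algebra_simps)
  also have "\<dots> \<le> 2 * z * (f * g)" using qfg pos' by (intro mult_left_mono) auto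
  also have "\<dots> = (f + z * g / 2)^2 - (f - z * g / 2)^2" by (simp add: power2_eq_square algebra_simps)
  also have "\<dots> \<le> (f + z * g / 2)^2" by simp
  finally have "z / 2 + 3 / 2 * t \<le> f + z * g / 2" by (rule power2_le_imp_le) (use fg pos' in simp)
  moreover have "z * (1 - g) / 2 = z / 2 - z * g / 2" by (simp add: right_diff_distrib diff_divide_distrib)
  ultimately have 1: "z * (1 - g) / 2 + 3 / 2 * s \<le> f" using xl by linarith
  have zq: "zl * q \<le> z * (f * g)" using z pos pos' qfg by (intro mult_mono) auto
  have "(1 / 2 + 3 / 2 * t)^2 \<le> 2 * (z * (f * g))" using i(3) zq by linarith
  also have "\<dots> = (f / 2 + z * g)^2 - (f / 2 - z * g)^2" by (simp add: power2_eq_square algebra_simps)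
  also have "\<dots> \<le> (f / 2 + z * g)^2" by simp
  finally have "1 / 2 + 3 / 2 * t \<le> f / 2 + z * g" by (rule power2_le_imp_le) (use fg pos' in simp)
  moreover have "(1 - f) / 2 = 1 / 2 - f / 2" by (rule diff_divide_distrib)
  ultimately have 2: "(1 - f) / 2 + 3 / 2 * s \<le> z * g" using xl by linarith
  have "(2 * w)^2 \<le> 4 * (z * (f * g))" using w zq by (simp add: power_mult_distrib)
  also have "\<dots> = (f + z * g)^2 - (f - z * g)^2" by (simp add: power2_eq_square algebra_simps)
  also have "\<dots> \<le> (f + z * g)^2" by simp
  finally have "2 * w \<le> f + z * g" by (rule power2_le_imp_le) (use fg pos' in simp)
  moreover have "3 / 2 * ((1 - f) + z * (1 - g)) = 3 / 2 + 3 / 2 * z - 3 / 2 * f - 3 / 2 * (z * g)"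
    "3 / 2 * (1 + zu) = 3 / 2 + 3 / 2 * zu" by (simp_all add: field_simps)
  ultimately have "3 / 2 * ((1 - f) + z * (1 - g)) + 4 * s \<le> 2 * x" using ii xl z by linarith
  with 1 2 show ?thesis by blast
qed

text \<open>
  All sizes are divided by that of the smallest set \<open>Y\<close>. On each of the rectangles in \<open>(s, z)\<close> below,
  the parameters \<open>xl\<close>, \<open>\<alpha>\<close>, \<open>\<beta>\<close>, \<open>\<delta>\<close>, \<open>q\<close>, \<open>w\<close> are rounded lower bounds for \<open>x\<close>, \<open>x / (x + z + \<rho>)\<close>,
  \<open>x / (x + 1 + \<rho>)\<close>, \<open>z / (1 + z + \<rho>)\<^sup>2\<close>, \<open>f * g\<close> and the square root of \<open>z * f * g\<close>.
\<close>

lemma numeric_core: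
  fixes z x \<rho> f g s :: real
  assumes z: "2 / 3 \<le> z" "z \<le> 1.26" and x: "z \<le> x" "2 \<le> x + z" "37.9 * s \<le> x + z"
    and s: "0 \<le> s" "s \<le> 1 / 9" and rho: "\<rho> \<le> s" "- 1 < \<rho>" and fg: "0 \<le> f" "0 \<le> g"
    and hyp: "x^2 * z \<le> (f * g)^2 * (1 + z + \<rho>)^2 * (x + z + \<rho>) * (x + 1 + \<rho>)"
  shows "z * (1 - g) / 2 + 3 / 2 * s \<le> f \<and> (1 - f) / 2 + 3 / 2 * s \<le> z * g \<and>
    3 / 2 * ((1 - f) + z * (1 - g)) + 4 * s \<le> 2 * x"
proof -
  \<comment> \<open>\<open>xl\<close> is the larger of the lower end for \<open>z\<close> and a
    lower bound for \<open>x + z\<close> minus the upper end for \<open>z\<close>, rounded down. The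
    bound 2 for \<open>x + z\<close> serves up to \<open>s = 0.0528\<close>, about 2 / 37.9; beyond
    that \<open>37.9 * s\<close> is better.\<close>
  have p1: ?thesis if "0 \<le> s" "s \<le> 0.0528"
  proof -
    consider "2/3 \<le> z" "z \<le> 0.88" | "0.88 \<le> z" "z \<le> 1.035" | "1.035 \<le> z" "z \<le> 1.21" | "1.21 \<le> z" "z \<le> 1.26" using z by linarith
    then show ?thesis
    proof cases
      case 1
      show ?thesis
        by (rule numeric_piece[OF 1 rho fg hyp, where xl="1.12" and t="0.0528" and \<alpha>="0.5455" and \<beta>="0.5154" and \<delta>="0.2254" and q="0.2517" and w="0.409"])
          (use 1 x that in \<open>simp_all add: power2_eq_square\<close>)
    next
      case 2
      show ?thesis
        by (rule numeric_piece[OF 2 rho fg hyp, where xl="0.965" and t="0.0528" and \<alpha>="0.47" and \<beta>="0.4782" and \<delta>="0.2355" and q="0.23" and w="0.449"])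
          (use 2 x that in \<open>simp_all add: power2_eq_square\<close>)
    next
      case 3
      show ?thesis
        by (rule numeric_piece[OF 3 rho fg hyp, where xl="1.035" and t="0.0528" and \<alpha>="0.4504" and \<beta>="0.4957" and \<delta>="0.2363" and q="0.2296" and w="0.487"])
          (use 3 x that in \<open>simp_all add: power2_eq_square\<close>)
    next
      case 4
      show ?thesis
        by (rule numeric_piece[OF 4 rho fg hyp, where xl="1.21" and t="0.0528" and \<alpha>="0.4796" and \<beta>="0.5347" and \<delta>="0.2355" and q="0.2457" and w="0.545"])
          (use 4 x that in \<open>simp_all add: power2_eq_square\<close>)
    qed
  qed
  have p2: ?thesis if "0.0528 \<le> s" "s \<le> 0.06"
  proof -
    consider "2/3 \<le> z" "z \<le> 0.81" | "0.81 \<le> z" "z \<le> 1.015" | "1.015 \<le> z" "z \<le> 1.155" | "1.155 \<le> z" "z \<le> 1.26" using z by linarith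
    then show ?thesis
    proof cases
      case 1
      show ?thesis
        by (rule numeric_piece[OF 1 rho fg hyp, where xl="1.191" and t="0.06" and \<alpha>="0.5778" and \<beta>="0.529" and \<delta>="0.2236" and q="0.2614" and w="0.417"])
          (use 1 x that in \<open>simp_all add: power2_eq_square\<close>)
    next
      case 2
      show ?thesis
        by (rule numeric_piece[OF 2 rho fg hyp, where xl="0.986" and t="0.06" and \<alpha>="0.4784" and \<beta>="0.4819" and \<delta>="0.2316" and q="0.231" and w="0.432"])
          (use 2 x that in \<open>simp_all add: power2_eq_square\<close>)
    next
      case 3
      show ?thesis
        by (rule numeric_piece[OF 3 rho fg hyp, where xl="1.015" and t="0.06" and \<alpha>="0.4551" and \<beta>="0.4891" and \<delta>="0.2354" and q="0.2289" and w="0.482"])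
          (use 3 x that in \<open>simp_all add: power2_eq_square\<close>)
    next
      case 4
      show ?thesis
        by (rule numeric_piece[OF 4 rho fg hyp, where xl="1.155" and t="0.06" and \<alpha>="0.4666" and \<beta>="0.5214" and \<delta>="0.234" and q="0.2385" and w="0.524"])
          (use 4 x that in \<open>simp_all add: power2_eq_square\<close>)
    qed
  qed
  have p3: ?thesis if "0.06 \<le> s" "s \<le> 0.07"
  proof -
    consider "2/3 \<le> z" "z \<le> 0.865" | "0.865 \<le> z" "z \<le> 1.175" | "1.175 \<le> z" "z \<le> 1.26" using z by linarith
    then show ?thesis
    proof cases
      case 1
      show ?thesis
        by (rule numeric_piece[OF 1 rho fg hyp, where xl="1.409" and t="0.07" and \<alpha>="0.6011" and \<beta>="0.5683" and \<delta>="0.221" and q="0.2747" and w="0.427"])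
          (use 1 x that in \<open>simp_all add: power2_eq_square\<close>)
    next
      case 2
      show ?thesis
        by (rule numeric_piece[OF 2 rho fg hyp, where xl="1.099" and t="0.07" and \<alpha>="0.4688" and \<beta>="0.5066" and \<delta>="0.231" and q="0.2342" and w="0.45"])
          (use 2 x that in \<open>simp_all add: power2_eq_square\<close>)
    next
      case 3
      show ?thesis
        by (rule numeric_piece[OF 3 rho fg hyp, where xl="1.175" and t="0.07" and \<alpha>="0.469" and \<beta>="0.5233" and \<delta>="0.232" and q="0.2386" and w="0.529"])
          (use 3 x that in \<open>simp_all add: power2_eq_square\<close>)
    qed
  qed
  have p4: ?thesis if "0.07 \<le> s" "s \<le> 0.08"
  proof -
    consider "2/3 \<le> z" "z \<le> 0.95" | "0.95 \<le> z" "z \<le> 1.26" using z by linarith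
    then show ?thesis
    proof cases
      case 1
      show ?thesis
        by (rule numeric_piece[OF 1 rho fg hyp, where xl="1.703" and t="0.08" and \<alpha>="0.6231" and \<beta>="0.6119" and \<delta>="0.2185" and q="0.2886" and w="0.438"])
          (use 1 x that in \<open>simp_all add: power2_eq_square\<close>)
    next
      case 2
      show ?thesis
        by (rule numeric_piece[OF 2 rho fg hyp, where xl="1.393" and t="0.08" and \<alpha>="0.5096" and \<beta>="0.5632" and \<delta>="0.2301" and q="0.2569" and w="0.494"])
          (use 2 x that in \<open>simp_all add: power2_eq_square\<close>)
    qed
  qed
  have p5: ?thesis if "0.08 \<le> s" "s \<le> 0.095"
  proof -
    consider "2/3 \<le> z" "z \<le> 0.91" | "0.91 \<le> z" "z \<le> 1.26" using z by linarith
    then show ?thesis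
    proof cases
      case 1
      show ?thesis
        by (rule numeric_piece[OF 1 rho fg hyp, where xl="2.122" and t="0.095" and \<alpha>="0.6786" and \<beta>="0.6596" and \<delta>="0.2148" and q="0.31" and w="0.454"])
          (use 1 x that in \<open>simp_all add: power2_eq_square\<close>)
    next
      case 2
      show ?thesis
        by (rule numeric_piece[OF 2 rho fg hyp, where xl="1.772" and t="0.095" and \<alpha>="0.5666" and \<beta>="0.618" and \<delta>="0.2263" and q="0.2814" and w="0.506"])
          (use 2 x that in \<open>simp_all add: power2_eq_square\<close>)
    qed
  qed
  have p6: ?thesis if "0.095 \<le> s" "s \<le> 1/9"
  proof -
    consider "2/3 \<le> z" "z \<le> 0.85" | "0.85 \<le> z" "z \<le> 1.26" using z by linarith
    then show ?thesis
    proof cases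
      case 1
      show ?thesis
        by (rule numeric_piece[OF 1 rho fg hyp, where xl="2.75" and t="1/9" and \<alpha>="0.741" and \<beta>="0.7122" and \<delta>="0.2109" and q="0.3336" and w="0.471"])
          (use 1 x that in \<open>simp_all add: power2_eq_square\<close>)
    next
      case 2
      show ?thesis
        by (rule numeric_piece[OF 2 rho fg hyp, where xl="2.34" and t="1/9" and \<alpha>="0.6305" and \<beta>="0.678" and \<delta>="0.221" and q="0.3073" and w="0.511"])
          (use 2 x that in \<open>simp_all add: power2_eq_square\<close>)
    qed
  qed
  consider "0 \<le> s" "s \<le> 0.0528" | "0.0528 \<le> s" "s \<le> 0.06" | "0.06 \<le> s" "s \<le> 0.07"
    | "0.07 \<le> s" "s \<le> 0.08" | "0.08 \<le> s" "s \<le> 0.095" | "0.095 \<le> s" "s \<le> 1 / 9"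
    using s by linarith
  then show ?thesis using p1 p2 p3 p4 p5 p6 by cases blast+
qed

text \<open>To leading order the bound reads t^2 <= (t + 10/9) * 2/3 for t = z / y, and the positive
  root is about 1.256. Expanding at \<open>z = 1.26 * y + u\<close> leaves a polynomial in
  \<open>y\<close> and \<open>u\<close> that is positive from \<open>y = 18\<close> on.\<close>

lemma atom_size_bound:
  fixes z y \<rho> k s :: real
  assumes "y \<ge> 18" "9 * s \<le> y" "\<rho> \<le> s - 3" "3 * k \<le> 2 * y - 1" "z \<ge> 0" "k \<ge> 0" "z + y + \<rho> \<ge> 0"
    and e: "z^2 * y \<le> (z + y + \<rho>) * ((y - 1) * k + z)"
  shows "z \<le> 1.26 * y"
proof (rule ccontr)
  assume *: "\<not> ?thesis"
  define u where "u = z - 1.26 * y"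
  have u: "u > 0" using * by (simp add: u_def)
  have z: "z = 1.26 * y + u" by (simp add: u_def)
  have "(y - 1) * k \<le> (y - 1) * ((2 * y - 1) / 3)" using assms by (intro mult_left_mono) auto
  moreover have "(y - 1) * k \<ge> 0" using assms by simp
  ultimately have "(z + y + \<rho>) * ((y - 1) * k + z) \<le> (z + y + (y / 9 - 3)) * ((y - 1) * ((2 * y - 1) / 3) + z)"
    using assms by (intro mult_mono) auto
  with e have "z^2 * y \<le> (z + y + (y / 9 - 3)) * ((y - 1) * ((2 * y - 1) / 3) + z)" by linarith
  moreover have "z^2 * y - (z + y + (y / 9 - 3)) * ((y - 1) * ((2 * y - 1) / 3) + z)
    = 463 / 67500 * y^3 + 31129 / 22500 * y^2 - 7 / 675 * y + 1
      + u * (139 / 75 * y^2 - 592 / 225 * y + 8 / 3) + u^2 * (y - 1)"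
    unfolding z by (simp add: field_simps power2_eq_square power3_eq_cube)
  moreover have "y^3 \<ge> 0" using assms(1) by simp
  moreover have yy: "y^2 \<ge> 18 * y" using assms(1) by (simp add: power2_eq_square)
  moreover have "u * (139 / 75 * y^2 - 592 / 225 * y + 8 / 3) \<ge> 0"
    using yy u assms(1) by (intro mult_nonneg_nonneg) auto
  moreover have "u^2 * (y - 1) \<ge> 0" using assms(1) by simp
  ultimately show False using assms(1) by linarith
qed

section \<open>Structure of a balanced pair\<close>

lemma cis_mod: "p > 0 \<Longrightarrow> cis (2 * pi * (n mod int p) / p) = cis (2 * pi * n / p)" for n :: int
proof -
  assume "p > 0"
  have "real_of_int n = real_of_int (n mod int p) + p * real_of_int (n div int p)"
    by (metis add.commute mult_div_mod_eq of_int_add of_int_mult of_int_of_nat_eq)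
  then have "2 * pi * n / p = 2 * pi * (n mod int p) / p + 2 * pi * (n div int p)"
    using \<open>p > 0\<close> by (simp add: field_simps)
  moreover have "cis (2 * pi * (n div int p)) = 1" by (simp add: complex_eq_iff)
  ultimately show ?thesis by (simp add: cis_mult[symmetric])
qed

text \<open>Dilating by the inverse \<open>k'\<close> of \<open>k\<close> turns frequency
  \<open>k\<close> into frequency 1, to which \<open>half_arc\<close> applies.\<close>

lemma fourier_arc:
  fixes Y :: "'a::ab_group_add set"
  assumes cyc: "cyc p \<psi>" "cyc p (\<lambda>n. \<psi> (k' * n))" and k: "int p dvd k' * int k - 1" and odd: "odd p"
    and Y: "Y \<subseteq> range \<psi>"
  obtains u where "norm (ft p (pull \<psi> 0 (int p - 1) Y) k) + card Y
    \<le> 2 * real (card (Y \<inter> (\<lambda>n. \<psi> (k' * n)) ` {u..u + (int p - 1) div 2}))"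
proof -
  define \<psi>' where "\<psi>' = (\<lambda>n. \<psi> (k' * n))"
  have cyc': "cyc p \<psi>'" using cyc by (simp add: \<psi>'_def)
  have p0: "p > 0" using cyc_pos[OF cyc(1)] .
  define Yn where "Yn = pull \<psi> 0 (int p - 1) Y"
  have Yn: "Yn \<subseteq> {0..int p - 1}" "finite Yn" by (auto simp: Yn_def pull_sub)
  have "{0..int p - 1} = {0..<0 + int p}" by auto
  then have imY: "\<psi> ` Yn = Y" using Y cyc_range[OF cyc(1), of 0] by (auto simp: Yn_def pull_image)
  have cYn: "card Yn = card Y" using card_inj_window[OF cyc(1) Yn(1)] imY by simp
  define h where "h = (\<lambda>a. (int k * a) mod int p)"
  have \<psi>h: "\<psi>' (h a) = \<psi> a" for a
  proof -
    have "\<psi>' (h a) = \<psi>' (int k * a)" unfolding h_def by (rule cyc_mod[OF cyc'])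
    also have "\<dots> = \<psi> (k' * int k * a)" by (simp add: \<psi>'_def mult.assoc)
    also have "\<dots> = \<psi> a"
    proof -
      have "int p dvd (k' * int k - 1) * a" using k by simp
      then show ?thesis using cyc(1) by (simp add: cyc_eq_iff algebra_simps)
    qed
    finally show ?thesis .
  qed
  have injh: "inj_on h Yn"
  proof (rule inj_onI)
    fix a b assume ab: "a \<in> Yn" "b \<in> Yn" "h a = h b"
    then have "\<psi> a = \<psi> b" using \<psi>h by metis
    then show "a = b" using ab Yn(1) cyc_inj[OF cyc(1), of Yn 0] by (force simp: inj_on_def)
  qed
  define B where "B = h ` Yn"
  have "(\<Sum>b\<in>B. cis (2 * pi * b / p)) = (\<Sum>a\<in>Yn. cis (2 * pi * h a / p))"
    unfolding B_def by (simp add: sum.reindex[OF injh])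
  also have "\<dots> = ft p Yn k" unfolding ft_def h_def by (intro sum.cong refl cis_mod p0)
  finally have S: "(\<Sum>b\<in>B. cis (2 * pi * b / p)) = ft p Yn k" .
  obtain u where u: "norm (\<Sum>b\<in>B. cis (2 * pi * b / p)) + card B
    \<le> 2 * real (card {b\<in>B. (b - u) mod int p \<le> (int p - 1) div 2})"
    using half_arc[OF _ odd, of B] Yn by (auto simp: B_def)
  define B1 where "B1 = {b\<in>B. (b - u) mod int p \<le> (int p - 1) div 2}"
  have B1: "B1 \<subseteq> {0..<0 + int p}" using p0 by (auto simp: B1_def B_def h_def)
  have "\<psi>' ` B1 \<subseteq> Y \<inter> \<psi>' ` {u..u + (int p - 1) div 2}"
  proof (rule subsetI, elim imageE)
    fix y b assume b: "y = \<psi>' b" "b \<in> B1"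
    then have "y \<in> Y" using \<psi>h imY by (auto simp: B1_def B_def)
    moreover have "y = \<psi>' (u + (b - u) mod int p)"
      using b by (simp add: cyc_add[OF cyc'] cyc_mod[OF cyc'] cyc_diff[OF cyc'])
    then have "y \<in> \<psi>' ` {u..u + (int p - 1) div 2}" using b p0 by (auto simp: B1_def intro!: imageI)
    ultimately show "y \<in> Y \<inter> \<psi>' ` {u..u + (int p - 1) div 2}" by blast
  qed
  then have "card (\<psi>' ` B1) \<le> card (Y \<inter> \<psi>' ` {u..u + (int p - 1) div 2})" by (intro card_mono) auto
  moreover have "card (\<psi>' ` B1) = card B1" using cyc_inj[OF cyc' B1] by (rule card_image)
  moreover have "card B = card Y" unfolding B_def using injh cYn by (simp add: card_image)
  ultimately have "norm (ft p Yn k) + card Y \<le> 2 * real (card (Y \<inter> \<psi>' ` {u..u + (int p - 1) div 2}))"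
    using u S by (simp add: B1_def)
  then show ?thesis using that by (simp add: Yn_def \<psi>'_def)
qed

text \<open>\<open>f\<close> and \<open>g\<close> stand for the Fourier coefficients of
  \<open>Y\<close> and \<open>Z\<close> at a common frequency, relative to the set sizes. Half
  circles then capture at least \<open>y * (1 + f) / 2\<close> and \<open>z * (1 + g) / 2\<close>
  elements, and \<open>num\<close> says that any values allowed by the Fourier bound suffice for
  \<open>rectified_pair\<close>.\<close>

lemma pair_structure:
  fixes Y Z :: "'a::ab_group_add set"
  assumes cyc: "cyc p \<psi>" and pr: "prime p" and odd: "odd p" and YZ: "Y \<subseteq> range \<psi>" "Z \<subseteq> range \<psi>" "Y \<noteq> {}" "Z \<noteq> {}"
    and card: "int (card (Y + Z)) = int (card Y) + int (card Z) + r" and r: "r \<ge> -1"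
    and p: "int p = int (card Y) + int (card Z) + r + x" and x: "x > 0"
    and num: "\<And>(f::real) (g::real). 0 \<le> f \<Longrightarrow> 0 \<le> g \<Longrightarrow>
      (real_of_int x)^2 * real (card Y) * real (card Z) \<le> (f * g)^2 * (real p - x)^2 * (real p - card Y) * (real p - card Z) \<Longrightarrow>
      real (card Y) * (1 - f) / 2 + real (card Z) * (1 - g) / 2 + r + 4 \<le> real (card Y) * (1 + f) / 2 \<and>
      real (card Y) * (1 - f) / 2 + real (card Z) * (1 - g) / 2 + r + 4 \<le> real (card Z) * (1 + g) / 2 \<and>
      3 * (real (card Y) * (1 - f) / 2 + real (card Z) * (1 - g) / 2) + 4 * r + 6 < 2 * x"
  obtains \<psi>' :: "int \<Rightarrow> 'a" and a b :: int where "cyc p \<psi>'" "range \<psi>' = range \<psi>"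
    "Y \<subseteq> \<psi>' ` {a..b}" "b - a \<le> int (card Y) + r"
proof -
  have p0: "p > 0" and p2: "p \<ge> 2" using pr prime_ge_2_nat[of p] by auto
  have fin: "finite Y" "finite Z" using YZ cyc_card_range[OF cyc] finite_subset by auto
  define y z where "y = real (card Y)" and "z = real (card Z)"
  have yz: "y > 0" "z > 0" using fin YZ by (auto simp: y_def z_def card_gt_0_iff)
  have win: "{0..int p - 1} = {0..<0 + int p}" by auto
  define Yn Zn where "Yn = pull \<psi> 0 (int p - 1) Y" and "Zn = pull \<psi> 0 (int p - 1) Z"
  have sub: "Yn \<subseteq> {0..<int p}" "Zn \<subseteq> {0..<int p}" using pull_sub(1)[of \<psi> 0 "int p - 1"] by (fastforce simp: Yn_def Zn_def)+
  have im: "\<psi> ` Yn = Y" "\<psi> ` Zn = Z" using YZ cyc_range[OF cyc, of 0] win by (auto simp: Yn_def Zn_def pull_image)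
  have cYn: "card Yn = card Y" "card Zn = card Z"
    using card_inj_window[OF cyc, of Yn 0 "int p - 1"] card_inj_window[OF cyc, of Zn 0 "int p - 1"] sub im win by auto
  define X where "X = {n\<in>{0..<int p}. \<psi> (- n) \<notin> Y + Z}"
  have cX: "int (card X) = x"
  proof -
    have "inj_on (\<lambda>n. \<psi> (- n)) {0..<int p}"
      using cyc_inj[OF cyc, of "{0..<int p}" 0] by (auto simp: inj_on_def cyc_minus[OF cyc])
    then have "card X = card ((\<lambda>n. \<psi> (- n)) ` X)" by (subst card_image) (auto simp: X_def inj_on_def)
    also have "(\<lambda>n. \<psi> (- n)) ` X = range \<psi> - (Y + Z)"
    proof
      show "(\<lambda>n. \<psi> (- n)) ` X \<subseteq> range \<psi> - (Y + Z)" by (auto simp: X_def)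
      show "range \<psi> - (Y + Z) \<subseteq> (\<lambda>n. \<psi> (- n)) ` X"
      proof
        fix w assume w: "w \<in> range \<psi> - (Y + Z)"
        then obtain m where m: "w = \<psi> m" by blast
        have "\<psi> (- ((- m) mod int p)) = w" using m by (simp add: cyc_minus[OF cyc] cyc_mod[OF cyc])
        moreover then have "(- m) mod int p \<in> X" using w p0 by (simp add: X_def)
        ultimately show "w \<in> (\<lambda>n. \<psi> (- n)) ` X" by (metis image_eqI)
      qed
    qed
    also have "card (range \<psi> - (Y + Z)) = p - card (Y + Z)"
      using YZ cyc_card_range[OF cyc] fin
      by (subst card_Diff_subset) (auto simp: finite_set_plus elim!: set_plus_elim intro!: subgrp_add[OF cyc_subgrp[OF cyc]])
    finally show ?thesis using card p x by linarith
  qed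
  have ne: "X \<noteq> {}" "Yn \<noteq> {}" "Zn \<noteq> {}" using cX x im YZ by auto
  have XS: "X \<subseteq> {0..<int p}" by (auto simp: X_def)
  have no: "\<not> int p dvd a + b + c" if "a \<in> X" "b \<in> Yn" "c \<in> Zn" for a b c
  proof
    assume "int p dvd a + b + c"
    then have "int p dvd (b + c) - (- a)" by (simp add: add_ac)
    then have "\<psi> (b + c) = \<psi> (- a)" using cyc by (simp only: cyc_eq_iff)
    moreover have "\<psi> b + \<psi> c \<in> Y + Z" using that im by (intro set_plus_intro) auto
    ultimately show False using that(1) by (simp add: X_def cyc_add[OF cyc])
  qed
  obtain k where k: "k \<in> {1..<p}" and
    F: "real (card X)^2 * real (card Yn)^3 * real (card Zn)^3
     \<le> (norm (ft p Yn k) * norm (ft p Zn k))\<^sup>2 * (real p - card X)\<^sup>2 * (real p - card Yn) * (real p - card Zn)"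
    using large_fourier_coefficient[OF p2 XS sub ne no] by blast
  have "\<not> int p dvd int k" using k by (auto dest: zdvd_imp_le)
  from cyc_scale(2)[OF cyc pr this] obtain k' where "\<psi> (int k * k') = \<psi> 1" by (metis rangeE rangeI)
  then have k': "int p dvd k' * int k - 1" using cyc by (simp add: cyc_eq_iff mult.commute)
  have nk': "\<not> int p dvd k'"
  proof
    assume "int p dvd k'"
    then have "int p dvd k' * int k" by simp
    then have "int p dvd k' * int k - (k' * int k - 1)" using k' by (rule dvd_diff)
    then show False using p2 by simp
  qed
  define \<psi>1 where "\<psi>1 = (\<lambda>n. \<psi> (k' * n))"
  have \<psi>1: "cyc p \<psi>1" "range \<psi>1 = range \<psi>" using cyc_scale[OF cyc pr nk'] by (auto simp: \<psi>1_def)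
  \<comment> \<open>Two windows of length \<open>(p - 1) / 2\<close> have total length
    \<open>p - 1\<close>, just short enough for their sums not to wrap around.\<close>
  define m where "m = (int p - 1) div 2"
  obtain u where u: "norm (ft p Yn k) + card Y \<le> 2 * real (card (Y \<inter> \<psi>1 ` {u..u + m}))"
    using fourier_arc[OF cyc \<psi>1(1)[unfolded \<psi>1_def] k' odd YZ(1)] by (auto simp: Yn_def \<psi>1_def m_def)
  obtain s where s: "norm (ft p Zn k) + card Z \<le> 2 * real (card (Z \<inter> \<psi>1 ` {s..s + m}))"
    using fourier_arc[OF cyc \<psi>1(1)[unfolded \<psi>1_def] k' odd YZ(2)] by (auto simp: Zn_def \<psi>1_def m_def)
  define Y1 Z1 where "Y1 = Y \<inter> \<psi>1 ` {u..u + m}" and "Z1 = Z \<inter> \<psi>1 ` {s..s + m}"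
  define f g where "f = norm (ft p Yn k) / y" and "g = norm (ft p Zn k) / z"
  have fy: "norm (ft p Yn k) = y * f" "norm (ft p Zn k) = z * g" using yz by (auto simp: f_def g_def)
  have fg0: "0 \<le> f" "0 \<le> g" using yz by (auto simp: f_def g_def)
  have "(y * z)^2 * ((real_of_int x)^2 * y * z) \<le> (y * z)^2 * ((f * g)^2 * (real p - x)^2 * (real p - y) * (real p - z))"
    using F unfolding cYn fy y_def[symmetric] z_def[symmetric] cX[symmetric]
    by (simp add: power2_eq_square power3_eq_cube mult_ac)
  then have "(real_of_int x)^2 * y * z \<le> (f * g)^2 * (real p - x)^2 * (real p - y) * (real p - z)"
    by (rule mult_left_le_imp_le) (use yz in simp)
  from num[OF fg0 this[unfolded y_def z_def]]
  have N: "y * (1 - f) / 2 + z * (1 - g) / 2 + r + 4 \<le> y * (1 + f) / 2"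
    "y * (1 - f) / 2 + z * (1 - g) / 2 + r + 4 \<le> z * (1 + g) / 2"
    "3 * (y * (1 - f) / 2 + z * (1 - g) / 2) + 4 * r + 6 < 2 * x" by (auto simp: y_def z_def)
  define ly lz where "ly = y * (1 - f) / 2" and "lz = z * (1 - g) / 2"
  have e: "y * (1 + f) / 2 = y - ly" "z * (1 + g) / 2 = z - lz" by (simp_all add: ly_def lz_def field_simps)
  have Y1: "real (card Y1) \<ge> y - ly" using u fy by (simp add: Y1_def y_def[symmetric] e(1)[symmetric] field_simps)
  have Z1: "real (card Z1) \<ge> z - lz" using s fy by (simp add: Z1_def z_def[symmetric] e(2)[symmetric] field_simps)
  define loss where "loss = int (card Y) + int (card Z) - int (card Y1) - int (card Z1)"
  have loss: "real_of_int loss \<le> ly + lz" using Y1 Z1 by (simp add: loss_def y_def z_def)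
  have "real_of_int (loss + r + 4) \<le> real_of_int (int (card Y1))" "real_of_int (loss + r + 4) \<le> real_of_int (int (card Z1))"
    using N(1,2) loss Y1 Z1 unfolding e unfolding ly_def[symmetric] lz_def[symmetric] by auto
  then have i: "loss + r + 4 \<le> int (card Y1)" "loss + r + 4 \<le> int (card Z1)" by (simp_all only: of_int_le_iff)
  have "real_of_int (3 * loss + 4 * r + 6) < real_of_int (2 * x)"
    using N(3) loss unfolding ly_def[symmetric] lz_def[symmetric] by simp
  then have ii: "2 * x > 3 * loss + 4 * r + 6" by (simp only: of_int_less_iff)
  have m: "m \<ge> 0" "(u + m - u) + (s + m - s) < int p" using p2 by (auto simp: m_def)
  have YZ1: "Y \<subseteq> range \<psi>1" "Z \<subseteq> range \<psi>1" using YZ \<psi>1 by auto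
  obtain \<psi>' :: "int \<Rightarrow> 'a" and a b where "cyc p \<psi>'" "range \<psi>' = range \<psi>1"
    "Y \<subseteq> \<psi>' ` {a..b}" "b - a \<le> int (card Y) + r"
    using rectified_pair[OF \<psi>1(1) pr YZ1 card r p _ _ m(2) Y1_def Z1_def loss_def i ii] m(1) by (metis le_add_same_cancel1)
  then show ?thesis using that \<psi>1(2) by metis
qed

text \<open>Dividing by \<open>y\<close> leads to \<open>numeric_core\<close>. The additive
  constants are absorbed into \<open>s\<close>:
  \<open>\<rho> + 4 \<le> s + 1 \<le> 3 / 2 * s\<close> since \<open>2 \<le> s\<close>, and
  \<open>4 * \<rho> + 6 \<le> 4 * s - 6\<close>, which also makes the last inequality
  strict.\<close>

lemma numeric_conditions:
  fixes y z x \<rho> s f g :: real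
  assumes y: "9 * s \<le> y" "2 \<le> s" and z: "2 * y \<le> 3 * z" "z \<le> 1.26 * y"
    and x: "z \<le> x" "2 * y \<le> x + z" "37.9 * s \<le> x + z" and rho: "\<rho> \<le> s - 3" "- 1 \<le> \<rho>" and fg: "0 \<le> f" "0 \<le> g"
    and hyp: "x^2 * y * z \<le> (f * g)^2 * (y + z + \<rho>)^2 * (x + z + \<rho>) * (x + y + \<rho>)"
  shows "y * (1 - f) / 2 + z * (1 - g) / 2 + \<rho> + 4 \<le> y * (1 + f) / 2 \<and>
     y * (1 - f) / 2 + z * (1 - g) / 2 + \<rho> + 4 \<le> z * (1 + g) / 2 \<and>
     3 * (y * (1 - f) / 2 + z * (1 - g) / 2) + 4 * \<rho> + 6 < 2 * x"
proof -
  have y0: "y > 0" using y by linarith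
  have "(x^2 * y * z) / y^4 \<le> ((f * g)^2 * (y + z + \<rho>)^2 * (x + z + \<rho>) * (x + y + \<rho>)) / y^4"
    using hyp y0 by (intro divide_right_mono) auto
  moreover have "(x^2 * y * z) / y^4 = (x / y)^2 * (z / y)"
    using y0 by (simp add: field_simps power2_eq_square power4_eq_xxxx)
  moreover have "((f * g)^2 * (y + z + \<rho>)^2 * (x + z + \<rho>) * (x + y + \<rho>)) / y^4
    = (f * g)^2 * (1 + z / y + \<rho> / y)^2 * (x / y + z / y + \<rho> / y) * (x / y + 1 + \<rho> / y)"
  proof -
    have "y + z + \<rho> = y * (1 + z / y + \<rho> / y)" "x + z + \<rho> = y * (x / y + z / y + \<rho> / y)"
      "x + y + \<rho> = y * (x / y + 1 + \<rho> / y)" using y0 by (simp_all add: field_simps)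
    then show ?thesis using y0 by (simp add: power_mult_distrib power4_eq_xxxx power2_eq_square)
  qed
  ultimately have h: "(x / y)^2 * (z / y) \<le>
    (f * g)^2 * (1 + z / y + \<rho> / y)^2 * (x / y + z / y + \<rho> / y) * (x / y + 1 + \<rho> / y)" by simp
  have "z / y * (1 - g) / 2 + 3 / 2 * (s / y) \<le> f \<and> (1 - f) / 2 + 3 / 2 * (s / y) \<le> z / y * g \<and>
    3 / 2 * ((1 - f) + z / y * (1 - g)) + 4 * (s / y) \<le> 2 * (x / y)"
  proof (rule numeric_core[OF _ _ _ _ _ _ _ _ _ fg h])
    show "2 / 3 \<le> z / y" "z / y \<le> 1.26" using z y0 by (simp_all add: field_simps)
    show "z / y \<le> x / y" using x y0 by (simp add: divide_right_mono)
    show "2 \<le> x / y + z / y" "37.9 * (s / y) \<le> x / y + z / y" using x y0 by (simp_all add: field_simps)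
    show "0 \<le> s / y" "s / y \<le> 1 / 9" using y y0 by (simp_all add: field_simps)
    show "\<rho> / y \<le> s / y" using rho y0 by (simp add: divide_right_mono)
    show "- 1 < \<rho> / y" using rho y y0 by (simp add: field_simps)
  qed
  then have c: "z / y * (1 - g) / 2 + 3 / 2 * (s / y) \<le> f" "(1 - f) / 2 + 3 / 2 * (s / y) \<le> z / y * g"
    "3 / 2 * ((1 - f) + z / y * (1 - g)) + 4 * (s / y) \<le> 2 * (x / y)" by blast+
  have "y * (z / y * (1 - g) / 2 + 3 / 2 * (s / y)) \<le> y * f" "y * ((1 - f) / 2 + 3 / 2 * (s / y)) \<le> y * (z / y * g)"
    "y * (3 / 2 * ((1 - f) + z / y * (1 - g)) + 4 * (s / y)) \<le> y * (2 * (x / y))" by (intro mult_left_mono c less_imp_le[OF y0])+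
  moreover have "y * (z / y * (1 - g) / 2 + 3 / 2 * (s / y)) = z * (1 - g) / 2 + 3 / 2 * s"
    "y * ((1 - f) / 2 + 3 / 2 * (s / y)) = y * (1 - f) / 2 + 3 / 2 * s" "y * (z / y * g) = z * g"
    "y * (3 / 2 * ((1 - f) + z / y * (1 - g)) + 4 * (s / y)) = 3 / 2 * (y * (1 - f) + z * (1 - g)) + 4 * s"
    "y * (2 * (x / y)) = 2 * x" using y0 by (simp_all add: field_simps)
  ultimately have *: "z * (1 - g) / 2 + 3 / 2 * s \<le> y * f" "y * (1 - f) / 2 + 3 / 2 * s \<le> z * g"
    "3 / 2 * (y * (1 - f) + z * (1 - g)) + 4 * s \<le> 2 * x" by simp_all
  have "y * (1 + f) / 2 = y * (1 - f) / 2 + y * f" "z * (1 + g) / 2 = z * (1 - g) / 2 + z * g" by (simp_all add: field_simps)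
  moreover have "3 * (y * (1 - f) / 2 + z * (1 - g) / 2) = 3 / 2 * (y * (1 - f) + z * (1 - g))" by (simp add: field_simps)
  ultimately show ?thesis using * rho y by (intro conjI) linarith+
qed

section \<open>Structure of a triple\<close>

lemma card_sumset_le:
  fixes X Y Z :: "'a::ab_group_add set"
  assumes cyc: "cyc p \<psi>" and sub: "X \<subseteq> range \<psi>" "Y \<subseteq> range \<psi>" "Z \<subseteq> range \<psi>"
    and no: "\<forall>a\<in>X. \<forall>b\<in>Y. \<forall>c\<in>Z. a + b + c \<noteq> 0"
  shows "card (Y + Z) + card X \<le> p"
proof -
  have G: "finite (range \<psi>)" "card (range \<psi>) = p" "subgrp (range \<psi>)"
    using cyc_card_range[OF cyc] cyc_subgrp[OF cyc] by auto
  have fin: "finite X" "finite Y" "finite Z" using sub G finite_subset by auto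
  have "(Y + Z) \<inter> uminus ` X = {}"
  proof (rule ccontr)
    assume "\<not> ?thesis"
    then obtain a b c where "a \<in> X" "b \<in> Y" "c \<in> Z" "b + c = - a" by (auto elim!: set_plus_elim)
    moreover then have "a + b + c = 0" by (simp add: add.assoc)
    ultimately show False using no by blast
  qed
  moreover have "card (uminus ` X) = card X" by (simp add: card_image)
  ultimately have "card (Y + Z) + card X = card ((Y + Z) \<union> uminus ` X)"
    using fin by (simp add: card_Un_disjoint finite_set_plus)
  also have "\<dots> \<le> card (range \<psi>)"
  proof (rule card_mono[OF G(1)], rule Un_least)
    show "Y + Z \<subseteq> range \<psi>" using sub by (auto elim!: set_plus_elim intro!: subgrp_add[OF G(3)])
    show "uminus ` X \<subseteq> range \<psi>" using sub subgrp_minus[OF G(3)] by blast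
  qed
  finally show ?thesis using G by simp
qed

text \<open>The pair of \<open>Y\<close> and its atom \<open>Z0\<close> has its own excess
  \<open>r0\<close> and its own complement size \<open>x0\<close>. Since \<open>r0 \<le> r\<close>,
  a progression found for this pair is short enough for the triple.\<close>

lemma triple_smallest_cover:
  fixes X Y Z :: "'a::ab_group_add set"
  assumes cyc: "cyc p \<psi>" and pr: "prime p" and sub: "X \<subseteq> range \<psi>" "Y \<subseteq> range \<psi>" "Z \<subseteq> range \<psi>"
    and no: "\<forall>a\<in>X. \<forall>b\<in>Y. \<forall>c\<in>Z. a + b + c \<noteq> 0"
    and p: "int p = int (card X) + int (card Y) + int (card Z) + r" and r: "r \<ge> -1"
    and min: "card Y \<le> card X" "card Y \<le> card Z"
    and big: "9 * r + 27 \<le> int (card Y)" "379 * r + 1137 \<le> 10 * (int (card X) + int (card Z))"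
  obtains \<psi>' :: "int \<Rightarrow> 'a" and a b :: int where "cyc p \<psi>'" "range \<psi>' = range \<psi>"
    "Y \<subseteq> \<psi>' ` {a..b}" "b - a \<le> int (card Y) + r"
proof -
  have G: "finite (range \<psi>)" "card (range \<psi>) = p" "subgrp (range \<psi>)"
    using cyc_card_range[OF cyc] cyc_subgrp[OF cyc] by auto
  have fin: "finite X" "finite Y" "finite Z" using sub G finite_subset by auto
  have y18: "card Y \<ge> 18" using big(1) r by linarith
  have neY: "Y \<noteq> {}" using y18 by auto
  \<comment> \<open>Two thirds of \<open>card Y\<close>, rounded up. As atoms meet their translates
    in at most \<open>k - 1\<close> elements, the rounding costs nothing beyond
    \<open>3 * (k - 1) \<le> 2 * card Y - 1\<close>, the form taken by
    \<open>atom_size_bound\<close>.\<close>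
  define k where "k = (2 * card Y + 2) div 3"
  have k: "2 * card Y \<le> 3 * k" "3 * k \<le> 2 * card Y + 2" "k \<le> card Y" "k > 0" using y18 by (auto simp: k_def)
  have no2: "\<forall>a\<in>X. \<forall>b\<in>Z. \<forall>c\<in>Y. a + b + c \<noteq> 0"
    using no by (metis add.assoc add.commute)
  have ZYX: "card (Z + Y) + card X \<le> p" by (rule card_sumset_le[OF cyc sub(1,3,2) no2])
  have kZ: "k \<le> card Z" "card (Z + Y) + k \<le> card (range \<psi>)" using ZYX k min G(2) by linarith+
  obtain Z0 where Z0': "Z0 \<subseteq> range \<psi>" "k \<le> card Z0" "card (Z0 + Y) + card Z \<le> card (Z + Y) + card Z0"
    "card Z0 + card (Z0 + Y) \<le> card (range \<psi>)"
    and few0: "\<And>g. g \<in> range \<psi> \<Longrightarrow> (+) g ` Z0 \<noteq> Z0 \<Longrightarrow> card (Z0 \<inter> (+) g ` Z0) < k"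
    by (rule atom_exists[OF G(3,1) sub(2) neY sub(3) kZ]) blast
  note Z0 = Z0'[unfolded G(2)]
  have fZ0: "finite Z0" and neZ0: "Z0 \<noteq> {}" using Z0(1,2) G(1) k finite_subset by auto
  define r0 where "r0 = int (card (Z0 + Y)) - int (card Z0) - int (card Y)"
  define x0 where "x0 = int p - int (card (Z0 + Y))"
  have r0r: "r0 \<le> r" using Z0(3) ZYX p by (simp add: r0_def)
  have x0z: "x0 \<ge> int (card Z0)" using Z0(4) by (simp add: x0_def)
  have ltp: "card (Z0 + Y) < card (range \<psi>)" using Z0(2,4) k G by linarith
  have "Z0 + Y \<noteq> range \<psi>" using ltp by (metis less_irrefl)
  from cauchy_davenport[OF cyc pr Z0(1) sub(2) neZ0 neY this] have r0: "r0 \<ge> -1"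
    unfolding r0_def by linarith
  have cardYZ: "int (card (Y + Z0)) = int (card Y) + int (card Z0) + r0" by (simp add: r0_def add.commute)
  have p0: "int p = int (card Y) + int (card Z0) + r0 + x0" by (simp add: r0_def x0_def)
  have few: "real (card (Z0 \<inter> (+) (a - b) ` Z0)) \<le> real k - 1" if "a \<in> Y" "b \<in> Y" "a \<noteq> b" for a b
  proof -
    have "a - b \<in> range \<psi>" using that sub(2) by (intro subgrp_diff[OF G(3)]) auto
    moreover have "card Z0 \<le> card (Z0 + Y)" using fZ0 fin(2) neY by (rule card_le_set_plus)
    then have "Z0 \<noteq> range \<psi>" using ltp by auto
    then have "a - b \<notin> stab Z0" using prime_stab_trivial[OF cyc pr Z0(1) neZ0] that by fastforce
    then have "(+) (a - b) ` Z0 \<noteq> Z0" by (simp add: stab_def)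
    ultimately show ?thesis using few0[of "a - b"] by simp
  qed
  define y z x \<rho> s where "y = real (card Y)" and "z = real (card Z0)" and "x = real_of_int x0"
    and "\<rho> = real_of_int r0" and "s = real_of_int (r + 3)"
  have sumr: "real (card (Z0 + Y)) = z + y + \<rho>" by (simp add: z_def y_def \<rho>_def r0_def)
  have xr: "real p = x + z + y + \<rho>" using p0 by (simp add: x_def z_def y_def \<rho>_def)
  have rho: "\<rho> \<le> s - 3" "- 1 \<le> \<rho>" using r0r r0 by (simp_all add: \<rho>_def s_def)
  have s2: "2 \<le> s" using r by (simp add: s_def)
  have ys: "9 * s \<le> y"
  proof -
    have "real_of_int (9 * r + 27) \<le> real_of_int (int (card Y))" using big(1) by (simp only: of_int_le_iff)
    then show ?thesis by (simp add: s_def y_def)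
  qed
  have zy: "z \<le> 1.26 * y"
  proof (rule atom_size_bound[where s=s and \<rho>=\<rho> and k="real k - 1"])
    show "z\<^sup>2 * y \<le> (z + y + \<rho>) * ((y - 1) * (real k - 1) + z)"
      using energy_bound[OF fin(2) fZ0 neY few] unfolding sumr by (simp add: z_def y_def)
    have "real (3 * k) \<le> real (2 * card Y + 2)" using k(2) by (simp only: of_nat_le_iff)
    then show "3 * (real k - 1) \<le> 2 * y - 1" by (simp add: y_def)
    show "0 \<le> z + y + \<rho>" using sumr[symmetric] by simp
  qed (use y18 ys rho k in \<open>auto simp: y_def z_def\<close>)
  have z23: "2 * y \<le> 3 * z" using k(1) Z0(2) by (simp add: y_def z_def)
  have xz: "z \<le> x" using x0z by (simp add: x_def z_def)
  \<comment> \<open>The left side is \<open>p - card Y - r0\<close> and \<open>r0 \<le> r\<close>: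
    lower bounds for the two larger sets together pass to the atom and its complement.\<close>
  have "x0 + int (card Z0) \<ge> int (card X) + int (card Z)" using p0 p r0r by linarith
  then have xz': "x + z \<ge> real (card X) + real (card Z)"
    unfolding x_def z_def by (metis of_int_add of_int_le_iff of_int_of_nat_eq)
  have x2: "2 * y \<le> x + z" using xz' min by (simp add: y_def)
  have "real_of_int (379 * r + 1137) \<le> real_of_int (10 * (int (card X) + int (card Z)))"
    using big(2) by (simp only: of_int_le_iff)
  then have x3: "37.9 * s \<le> x + z" using xz' by (simp add: s_def)
  have "y * (1 - f) / 2 + z * (1 - g) / 2 + \<rho> + 4 \<le> y * (1 + f) / 2 \<and>
      y * (1 - f) / 2 + z * (1 - g) / 2 + \<rho> + 4 \<le> z * (1 + g) / 2 \<and>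
      3 * (y * (1 - f) / 2 + z * (1 - g) / 2) + 4 * \<rho> + 6 < 2 * x"
    if "0 \<le> f" "0 \<le> g" "x^2 * y * z \<le> (f * g)^2 * (real p - x)^2 * (real p - y) * (real p - z)" for f g :: real
  proof (rule numeric_conditions[OF ys s2 z23 zy xz x2 x3 rho that(1,2)])
    have e: "real p - x = y + z + \<rho>" "real p - y = x + z + \<rho>" "real p - z = x + y + \<rho>" using xr by auto
    show "x\<^sup>2 * y * z \<le> (f * g)\<^sup>2 * (y + z + \<rho>)\<^sup>2 * (x + z + \<rho>) * (x + y + \<rho>)" using that(3) unfolding e .
  qed
  note num = this[unfolded y_def z_def x_def \<rho>_def]
  have x0: "x0 > 0" using x0z Z0(2) k by linarith
  have "p > 2" using p y18 min r by linarith
  then have odd: "odd p" using pr prime_odd_nat by auto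
  show ?thesis
  proof (rule pair_structure[OF cyc pr odd sub(2) Z0(1) neY neZ0 cardYZ r0 p0 x0], goal_cases)
    case (1 f g)
    then show ?case using num[OF 1] by simp
  next
    case (2 \<psi>' a b)
    then show ?case using r0r by (intro that[of \<psi>' a b]) auto
  qed
qed

text \<open>\<open>cover_extend\<close> leads from the smallest set to each of the others, with the
  size of the remaining set in the role of \<open>x\<close>. It keeps \<open>\<psi>'\<close>, whence
  the common difference.\<close>

lemma triple_covers:
  fixes X Y Z :: "'a::ab_group_add set"
  assumes cyc: "cyc p \<psi>" and pr: "prime p" and sub: "X \<subseteq> range \<psi>" "Y \<subseteq> range \<psi>" "Z \<subseteq> range \<psi>"
    and no: "\<forall>a\<in>X. \<forall>b\<in>Y. \<forall>c\<in>Z. a + b + c \<noteq> 0"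
    and p: "int p = int (card X) + int (card Y) + int (card Z) + r" and r: "r \<ge> -1"
    and min: "card Y \<le> card X" "card Y \<le> card Z"
    and big: "9 * r + 27 \<le> int (card Y)" "379 * r + 1137 \<le> 10 * (int (card X) + int (card Z))"
  obtains \<psi>' :: "int \<Rightarrow> 'a" where "cyc p \<psi>'" "range \<psi>' = range \<psi>"
    "\<And>U. U \<in> {X, Y, Z} \<Longrightarrow> \<exists>a b. U \<subseteq> \<psi>' ` {a..b} \<and> b - a \<le> int (card U) + r"
proof -
  obtain \<psi>' :: "int \<Rightarrow> 'a" and a b where \<psi>': "cyc p \<psi>'" "range \<psi>' = range \<psi>"
    and Y: "Y \<subseteq> \<psi>' ` {a..b}" "b - a \<le> int (card Y) + r"
    using triple_smallest_cover[OF cyc pr sub no p r min big] by metis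
  have sub': "X \<subseteq> range \<psi>'" "Y \<subseteq> range \<psi>'" "Z \<subseteq> range \<psi>'" using sub \<psi>' by auto
  have 1: "int (card (Y + Z)) \<le> int (card Y) + int (card Z) + r"
    using card_sumset_le[OF cyc sub no] p by linarith
  have no2: "\<forall>a\<in>Z. \<forall>b\<in>Y. \<forall>c\<in>X. a + b + c \<noteq> 0"
    using no by (metis add.assoc add.commute)
  have "card (Y + X) + card Z \<le> p" by (rule card_sumset_le[OF cyc sub(3,2,1) no2])
  then have 2: "int (card (Y + X)) \<le> int (card Y) + int (card X) + r" using p by linarith
  have big': "9 * r + 27 \<le> int (card X)" "9 * r + 27 \<le> int (card Z)" using big min by linarith+
  have p1: "int p = int (card Y) + int (card Z) + r + int (card X)"
    and p2: "int p = int (card Y) + int (card X) + r + int (card Z)" using p by linarith+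
  have "\<exists>a b. Z \<subseteq> \<psi>' ` {a..b} \<and> b - a \<le> int (card Z) + r"
    using cover_extend[OF \<psi>'(1) Y sub'(3) 1 r p1 big(1) big'(2,1)] by metis
  moreover have "\<exists>a b. X \<subseteq> \<psi>' ` {a..b} \<and> b - a \<le> int (card X) + r"
    using cover_extend[OF \<psi>'(1) Y sub'(1) 2 r p2 big(1) big'(1,2)] by metis
  ultimately show ?thesis using that \<psi>' Y by blast
qed

section \<open>Transfer to the residue ring\<close>

lemma Zmod_add_pow:
  assumes "p > 1" "d \<in> carrier (Zmod p)"
  shows "[i] \<cdot>\<^bsub>Zmod p\<^esub> d = (int i * d) mod int p"
proof -
  interpret residues "int p" "Zmod p" using assms by unfold_locales auto
  have "monoid (add_monoid (Zmod p))" by (rule a_monoid)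
  show ?thesis unfolding add_pow_def
  proof (induction i)
    case 0
    then show ?case by (simp add: res_zero_eq)
  next
    case (Suc i)
    have "d [^]\<^bsub>add_monoid (Zmod p)\<^esub> Suc i = d [^]\<^bsub>add_monoid (Zmod p)\<^esub> i \<oplus>\<^bsub>Zmod p\<^esub> d"
      using monoid.nat_pow_Suc[OF a_monoid, of d i] by simp
    then show ?case using Suc by (simp add: res_add_eq mod_simps algebra_simps)
  qed
qed

text \<open>The generator \<open>\<psi>' 1\<close> is the residue \<open>d\<close> read through
  \<open>\<psi>\<close>, so intervals under \<open>\<psi>'\<close> become progressions of difference
  \<open>d\<close>.\<close>

lemma cover_to_progression:
  fixes \<psi> \<psi>' :: "int \<Rightarrow> 'a::ab_group_add"
  assumes p: "p > 1" and cyc: "cyc p \<psi>" "cyc p \<psi>'" "range \<psi>' = range \<psi>"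
    and d: "d \<in> carrier (Zmod p)" "\<psi>' 1 = \<psi> d"
    and U: "U \<subseteq> carrier (Zmod p)" "U \<noteq> {}" "\<psi> ` U \<subseteq> \<psi>' ` {a..b}" "b - a \<le> int (card U) + r"
  shows "\<exists>P. arith_progression (Zmod p) d P \<and> U \<subseteq> P \<and> int (card P) \<le> int (card U) + r + 1"
proof -
  interpret residues "int p" "Zmod p" using p by unfold_locales auto
  have "\<psi>' a \<in> \<psi> ` {0..<0 + int p}" using cyc cyc_range[OF cyc(1), of 0] by auto
  then obtain a0 where a0: "a0 \<in> {0..<int p}" "\<psi>' a = \<psi> a0" by auto
  have a0c: "a0 \<in> carrier (Zmod p)" using a0 by (auto simp: res_carrier_eq)
  define n where "n = nat (b - a + 1)"
  have ab: "a \<le> b" using U(2,3) by auto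
  define P where "P = {a0 \<oplus>\<^bsub>Zmod p\<^esub> [i] \<cdot>\<^bsub>Zmod p\<^esub> d | i::nat. i < n}"
  have Pi: "P = (\<lambda>i. (a0 + int i * d) mod int p) ` {..<n}"
    unfolding P_def Zmod_add_pow[OF p d(1)] by (auto simp: res_add_eq mod_simps)
  have step: "\<psi>' (int i) = \<psi> (int i * d)" for i
  proof (induction i)
    case 0
    then show ?case using cyc_0[OF cyc(1)] cyc_0[OF cyc(2)] by simp
  next
    case (Suc i)
    have "\<psi>' (int (Suc i)) = \<psi>' (int i) + \<psi>' 1" by (simp add: cyc_add[OF cyc(2), symmetric] add.commute)
    also have "\<dots> = \<psi> (int i * d + d)" using Suc d(2) by (simp add: cyc_add[OF cyc(1)])
    finally show ?case by (simp add: algebra_simps)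
  qed
  have "U \<subseteq> P"
  proof
    fix u assume u: "u \<in> U"
    then obtain m where m: "m \<in> {a..b}" "\<psi> u = \<psi>' m" using U(3) by blast
    define i where "i = nat (m - a)"
    have "\<psi>' m = \<psi>' a + \<psi>' (int i)" using m by (simp add: i_def cyc_add[OF cyc(2), symmetric])
    also have "\<dots> = \<psi> (a0 + int i * d)" using a0 step by (simp add: cyc_add[OF cyc(1)])
    finally have "int p dvd u - (a0 + int i * d)" using m cyc_eq_iff[OF cyc(1)] by metis
    then have "u mod int p = (a0 + int i * d) mod int p" by (simp add: mod_eq_dvd_iff)
    moreover have "u mod int p = u" using u U(1) by (auto simp: res_carrier_eq)
    ultimately show "u \<in> P" unfolding Pi using m by (intro image_eqI[of _ _ i]) (auto simp: i_def n_def)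
  qed
  moreover have "card P \<le> n" unfolding Pi using card_image_le[of "{..<n}"] by fastforce
  then have "int (card P) \<le> int (card U) + r + 1" using U(4) ab by (simp add: n_def)
  moreover have "arith_progression (Zmod p) d P" unfolding arith_progression_def P_def
    using d(1) a0c ab by (intro conjI bexI[of _ a0] exI[of _ n]) (auto simp: n_def)
  ultimately show ?thesis by blast
qed

theorem theorem1p3:
  fixes p :: nat and A B C :: "int set" and r :: int
  assumes "prime p"
    and "A \<subseteq> carrier (Zmod p)" and "A \<noteq> {}"
    and "B \<subseteq> carrier (Zmod p)" and "B \<noteq> {}"
    and "A <+>\<^bsub>Zmod p\<^esub> B \<noteq> carrier (Zmod p)"
    and "C = a_set_inv\<^bsub>Zmod p\<^esub> (carrier (Zmod p) - (A <+>\<^bsub>Zmod p\<^esub> B))"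
    and "card A \<ge> card B"
    and "int (card (A <+>\<^bsub>Zmod p\<^esub> B)) = int (card A) + int (card B) + r"
    and "real (card (A <+>\<^bsub>Zmod p\<^esub> B))
           \<le> min (real (card A) + 1.0527 * real (card B) - 3)
                 (real p - 9 * (real_of_int r + 3))"
  shows "\<exists>d P\<^sub>A P\<^sub>B P\<^sub>C.
           arith_progression (Zmod p) d P\<^sub>A \<and>
           arith_progression (Zmod p) d P\<^sub>B \<and>
           arith_progression (Zmod p) d P\<^sub>C \<and>
           A \<subseteq> P\<^sub>A \<and> int (card P\<^sub>A) \<le> int (card A) + r + 1 \<and>
           B \<subseteq> P\<^sub>B \<and> int (card P\<^sub>B) \<le> int (card B) + r + 1 \<and>
           C \<subseteq> P\<^sub>C \<and> int (card P\<^sub>C) \<le> int (card C) + r + 1"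
proof -
  have p1: "p > 1" using assms(1) by (rule prime_gt_1_nat)
  interpret residues "int p" "Zmod p" using p1 by unfold_locales auto
  have car: "carrier (Zmod p) = {0..<int p}" by (auto simp: res_carrier_eq)
  define S where "S = A <+>\<^bsub>Zmod p\<^esub> B"
  have S: "S = {(a + b) mod int p | a b. a \<in> A \<and> b \<in> B}"
    by (auto simp: S_def set_add_def set_mult_def res_add_eq)
  have SG: "S \<subseteq> {0..<int p}" using p1 by (auto simp: S)
  have C: "C = (\<lambda>w. (- w) mod int p) ` ({0..<int p} - S)"
    unfolding assms(7) S_def[symmetric] car
    by (auto simp: A_SET_INV_def' res_neg_eq)
  have CG: "C \<subseteq> {0..<int p}" using p1 by (auto simp: C)
  have AG: "A \<subseteq> {0..<int p}" and BG: "B \<subseteq> {0..<int p}" using assms(2,4) car by auto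
  obtain \<psi> :: "int \<Rightarrow> circ" where \<psi>: "cyc p \<psi>" using ex_cyc[of p] p1 by auto
  have inj: "inj_on \<psi> {0..<int p}" using cyc_inj[OF \<psi>, of "{0..<int p}" 0] by simp
  have cimg: "card (\<psi> ` U) = card U" if "U \<subseteq> {0..<int p}" for U
    using inj_on_subset[OF inj that] by (rule card_image)
  have finS: "finite S" using SG finite_subset by blast
  have cC: "int (card C) = int p - int (card S)"
  proof -
    have "inj_on (\<lambda>w. (- w) mod int p) ({0..<int p} - S)"
    proof (rule inj_onI)
      fix v w assume *: "v \<in> {0..<int p} - S" "w \<in> {0..<int p} - S" "(- v) mod int p = (- w) mod int p"
      then have "\<psi> (- v) = \<psi> (- w)" using cyc_mod[OF \<psi>] by metis
      then have "\<psi> v = \<psi> w" by (simp add: cyc_minus[OF \<psi>])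
      then show "v = w" using inj * by (auto simp: inj_on_def)
    qed
    then have "card C = card ({0..<int p} - S)" unfolding C by (rule card_image)
    also have "\<dots> = p - card S" using SG finS by (simp add: card_Diff_subset)
    finally show ?thesis using card_mono[OF _ SG] by simp
  qed
  have no: "\<psi> a + \<psi> b + \<psi> c \<noteq> 0" if abc: "a \<in> A" "b \<in> B" "c \<in> C" for a b c
  proof
    assume z: "\<psi> a + \<psi> b + \<psi> c = 0"
    obtain w where w: "w \<in> {0..<int p} - S" "c = (- w) mod int p" using abc(3) C by blast
    then have "\<psi> c = - \<psi> w" by (simp add: cyc_mod[OF \<psi>] cyc_minus[OF \<psi>])
    then have "\<psi> ((a + b) mod int p) = \<psi> w" using z by (simp add: cyc_mod[OF \<psi>] cyc_add[OF \<psi>])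
    then have "(a + b) mod int p = w" using inj w p1 by (auto simp: inj_on_def)
    then show False using w abc S by blast
  qed
  have cS: "int (card S) = int (card A) + int (card B) + r" using assms(9) by (simp add: S_def)
  have sum: "int (card A) + int (card B) + int (card C) + r = int p" using cC cS by simp
  have neC: "C \<noteq> {}" using assms(6) SG unfolding C car S_def[symmetric] by auto
  have rs: "real (card S) \<le> real (card A) + 1.0527 * real (card B) - 3" "real (card S) \<le> real p - 9 * (real_of_int r + 3)"
    using assms(10) by (auto simp: S_def)
  have cSr: "real (card S) = real (card A) + real (card B) + real_of_int r"
    using cS by (metis of_int_add of_int_of_nat_eq)
  \<comment> \<open>In other terms \<open>18.95 * (r + 3) \<le> card B\<close>; this follows from
    the first bound since \<open>379 * 0.0527 = 19.9733\<close> is below 20.\<close>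
  have h1: "379 * r + 1137 \<le> 20 * int (card B)"
  proof -
    have "real_of_int (379 * r + 1137) \<le> real_of_int (20 * int (card B))" using rs(1) cSr by simp
    then show ?thesis by (simp only: of_int_le_iff)
  qed
  have h2: "9 * r + 27 \<le> int (card C)"
  proof -
    have "real (card C) = real p - real (card S)" using cC by (metis of_int_diff of_int_of_nat_eq)
    then have "real_of_int (9 * r + 27) \<le> real_of_int (int (card C))" using rs(2) by simp
    then show ?thesis by (simp only: of_int_le_iff)
  qed
  define A' B' C' where "A' = \<psi> ` A" and "B' = \<psi> ` B" and "C' = \<psi> ` C"
  have sub: "A' \<subseteq> range \<psi>" "B' \<subseteq> range \<psi>" "C' \<subseteq> range \<psi>" by (auto simp: A'_def B'_def C'_def)
  have card': "card A' = card A" "card B' = card B" "card C' = card C"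
    using cimg AG BG CG by (auto simp: A'_def B'_def C'_def)
  have ne': "A' \<noteq> {}" "B' \<noteq> {}" "C' \<noteq> {}" using assms(3,5) neC by (auto simp: A'_def B'_def C'_def)
  have no': "\<forall>a\<in>A'. \<forall>b\<in>B'. \<forall>c\<in>C'. a + b + c \<noteq> 0"
    using no by (simp add: A'_def B'_def C'_def)
  have fin': "finite A'" "finite B'" "finite C'" using sub cyc_card_range[OF \<psi>] finite_subset by auto
  have sums: "card (A' + B') + card C \<le> p"
  proof -
    have "\<forall>c\<in>C'. \<forall>a\<in>A'. \<forall>b\<in>B'. c + a + b \<noteq> 0" using no' by (metis add.assoc add.commute)
    then show ?thesis using card_sumset_le[OF \<psi> sub(3,1,2)] card' by simp
  qed
  \<comment> \<open>Cauchy--Davenport applies because \<open>C\<close> is nonempty, so that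
    \<open>A' + B'\<close> is not the whole group.\<close>
  have r: "r \<ge> -1"
  proof -
    have "card C > 0" using ne'(3) fin'(3) card' by (metis card_gt_0_iff)
    then have "A' + B' \<noteq> range \<psi>" using sums cyc_card_range[OF \<psi>] by auto
    then have "card A' + card B' \<le> card (A' + B') + 1"
      using cauchy_davenport[OF \<psi> assms(1) sub(1,2) ne'(1,2)] by simp
    then show ?thesis using sums sum card' by linarith
  qed
  obtain \<psi>' :: "int \<Rightarrow> circ" where \<psi>': "cyc p \<psi>'" "range \<psi>' = range \<psi>"
    and cov: "\<And>U. U \<in> {A', B', C'} \<Longrightarrow> \<exists>a b. U \<subseteq> \<psi>' ` {a..b} \<and> b - a \<le> int (card U) + r"
  \<comment> \<open>As \<open>card B \<le> card A\<close>, \<open>B\<close> or \<open>C\<close> is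
    smallest. In both cases the other two sets have at least \<open>2 * card B\<close> elements
    together, so \<open>h1\<close> supplies the second size condition.\<close>
  proof (cases "card B \<le> card C")
    case True
    have h3: "9 * r + 27 \<le> int (card B)" using h1 by linarith
    show ?thesis
      by (rule triple_covers[OF \<psi> assms(1) sub no', where r=r]) (use True assms(8) sum r h1 h3 card' that in \<open>auto\<close>)
  next
    case False
    have no2: "\<forall>a\<in>A'. \<forall>b\<in>C'. \<forall>c\<in>B'. a + b + c \<noteq> 0" using no' by (metis add.assoc add.commute)
    have c: "int p = int (card A') + int (card C') + int (card B') + r" "card C' \<le> card A'" "card C' \<le> card B'"
      "9 * r + 27 \<le> int (card C')" "379 * r + 1137 \<le> 10 * (int (card A') + int (card B'))"
      using False assms(8) sum h1 h2 card' by auto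
    obtain \<psi>' :: "int \<Rightarrow> circ" where "cyc p \<psi>'" "range \<psi>' = range \<psi>"
      "\<And>U. U \<in> {A', C', B'} \<Longrightarrow> \<exists>a b. U \<subseteq> \<psi>' ` {a..b} \<and> b - a \<le> int (card U) + r"
      by (rule triple_covers[OF \<psi> assms(1) sub(1,3,2) no2 c(1) r c(2-5)]) blast
    then show ?thesis by (intro that[of \<psi>']) auto
  qed
  have "\<psi>' 1 \<in> \<psi> ` {0..<0 + int p}" using \<psi>'(2) cyc_range[OF \<psi>, of 0] by blast
  then obtain d where d: "d \<in> carrier (Zmod p)" "\<psi>' 1 = \<psi> d" using car by auto
  have prog: "\<exists>P. arith_progression (Zmod p) d P \<and> U \<subseteq> P \<and> int (card P) \<le> int (card U) + r + 1"
    if "U \<in> {A, B, C}" for U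
  proof -
    have U: "U \<subseteq> carrier (Zmod p)" "U \<noteq> {}" using that assms(2,3,4,5) CG car neC by auto
    have "\<psi> ` U \<in> {A', B', C'}" using that by (auto simp: A'_def B'_def C'_def)
    from cov[OF this] obtain a b where "\<psi> ` U \<subseteq> \<psi>' ` {a..b}" "b - a \<le> int (card (\<psi> ` U)) + r"
      by (elim exE conjE)
    moreover have "card (\<psi> ` U) = card U" using cimg U car by auto
    ultimately show ?thesis using cover_to_progression[OF p1 \<psi> \<psi>' d U] by simp
  qed
  show ?thesis using prog[of A] prog[of B] prog[of C] by blast
qed

end
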